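(* Let $m\ge 1$ and $n\ge 1$ be integers, and let $II_{8n+1,1}$ be the even unimodular lattice of signature $(8n+1,1)$. Then $II_{8n+1,1}$ has exactly one orbit of primitive vectors of norm $2m$ under $\mathrm{Aut}(II_{8n+1,1})$.
   Context: A vector $v$ of a lattice $L$ is primitive if $v/k\notin L$ for every integer $k>1$. The norm of $v$ is $(v,v)$. *)

theory Defs
  imports "HOL-Analysis.Analysis" "HOL-Algebra.Group_Action"
begin

text \<open>A lattice is a full-rank integer span \<open>L\<close> of a basis of a real vector space \<open>V\<close>, and
  \<open>(x,y)\<close> is given by a symmetric bilinear form \<open>B\<close> on \<open>V\<close>; the inner product of a type
  class cannot be used, since \<open>B\<close> is indefinite.\<close>

definition int_span :: "'v::real_vector set \<Rightarrow> 'v set" where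
  "int_span S = {\<Sum>s\<in>S. of_int (c s) *\<^sub>R s | c :: 'v \<Rightarrow> int. True}"

definition is_lattice :: "('v::real_vector \<Rightarrow> 'v \<Rightarrow> real) \<Rightarrow> 'v set \<Rightarrow> bool" where
  "is_lattice B L \<longleftrightarrow>
     bilinear B \<and> (\<forall>x y. B x y = B y x) \<and>
     (\<exists>S. finite S \<and> independent S \<and> span S = UNIV \<and> L = int_span S)"

text \<open>By polarization, an even lattice is integral.\<close>

definition even_lattice :: "('v::real_vector \<Rightarrow> 'v \<Rightarrow> real) \<Rightarrow> 'v set \<Rightarrow> bool" where
  "even_lattice B L \<longleftrightarrow> (\<forall>x\<in>L. \<exists>k::int. B x x = 2 * of_int k)"

definition dual_lattice :: "('v::real_vector \<Rightarrow> 'v \<Rightarrow> real) \<Rightarrow> 'v set \<Rightarrow> 'v set" where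
  "dual_lattice B L = {x. \<forall>y\<in>L. B x y \<in> \<int>}"

definition unimodular_lattice :: "('v::real_vector \<Rightarrow> 'v \<Rightarrow> real) \<Rightarrow> 'v set \<Rightarrow> bool" where
  "unimodular_lattice B L \<longleftrightarrow> dual_lattice B L = L"

text \<open>Signature \<open>(p, q)\<close>: \<open>p\<close> positive and \<open>q\<close> negative squares. As \<open>P \<union> N\<close> is a basis of the
  whole space, the form is nondegenerate of rank \<open>p + q\<close>.\<close>

definition has_signature :: "('v::real_vector \<Rightarrow> 'v \<Rightarrow> real) \<Rightarrow> nat \<Rightarrow> nat \<Rightarrow> bool" where
  "has_signature B p q \<longleftrightarrow>
     (\<exists>P N. finite P \<and> finite N \<and> card P = p \<and> card N = q \<and>
        independent (P \<union> N) \<and> span (P \<union> N) = UNIV \<and>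
        (\<forall>x\<in>P \<union> N. \<forall>y\<in>P \<union> N. x \<noteq> y \<longrightarrow> B x y = 0) \<and>
        (\<forall>x\<in>P. B x x > 0) \<and> (\<forall>x\<in>N. B x x < 0))"

definition primitive_in :: "'v::real_vector set \<Rightarrow> 'v \<Rightarrow> bool" where
  "primitive_in L v \<longleftrightarrow> v \<in> L \<and> (\<forall>k::int. k > 1 \<longrightarrow> v /\<^sub>R of_int k \<notin> L)"

definition primitive_vectors_of_norm ::
    "('v::real_vector \<Rightarrow> 'v \<Rightarrow> real) \<Rightarrow> 'v set \<Rightarrow> real \<Rightarrow> 'v set" where
  "primitive_vectors_of_norm B L r = {v. primitive_in L v \<and> B v v = r}"

text \<open>Since \<open>L\<close> spans \<open>V\<close>, each additive isometry of \<open>L\<close> onto itself extends uniquely to a linear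
  isometry of \<open>V\<close>; these extensions are the elements of the group.\<close>

definition Aut_lattice :: "('v::real_vector \<Rightarrow> 'v \<Rightarrow> real) \<Rightarrow> 'v set \<Rightarrow> ('v \<Rightarrow> 'v) monoid" where
  "Aut_lattice B L =
     \<lparr>carrier = {f. linear f \<and> bij f \<and> f ` L = L \<and> (\<forall>x y. B (f x) (f y) = B x y)},
      mult = (\<circ>), one = id\<rparr>"

lemma group_Aut_lattice: "group (Aut_lattice B L)"
proof (rule groupI)
  fix f assume "f \<in> carrier (Aut_lattice B L)"
  then have f: "linear f" "bij f" "f ` L = L" "\<And>x y. B (f x) (f y) = B x y"
    by (auto simp: Aut_lattice_def)
  define g where "g = inv_into UNIV f"
  have fg: "f (g x) = x" and gf: "g (f x) = x" for x
    using f(2) by (simp_all add: g_def bij_is_surj bij_is_inj surj_f_inv_f)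
  have "linear g"
    by (rule linearI; rule injD[OF bij_is_inj[OF f(2)]])
      (simp_all add: fg linear_add[OF f(1)] linear_scale[OF f(1)])
  moreover have "bij g"
    using f(2) by (simp add: g_def bij_imp_bij_inv)
  moreover have "g ` L = L"
    using f(3) gf by (metis (no_types, lifting) image_cong image_ident image_image)
  moreover have "B (g x) (g y) = B x y" for x y
    using f(4)[of "g x" "g y"] by (simp add: fg)
  ultimately have "g \<in> carrier (Aut_lattice B L)"
    by (simp add: Aut_lattice_def)
  moreover have "g \<circ> f = id"
    by (auto simp: gf)
  ultimately show "\<exists>g\<in>carrier (Aut_lattice B L).
      g \<otimes>\<^bsub>Aut_lattice B L\<^esub> f = \<one>\<^bsub>Aut_lattice B L\<^esub>"
    by (auto simp: Aut_lattice_def)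
qed (simp_all add: Aut_lattice_def linear_compose bij_comp comp_assoc linear_id,
   metis image_image)

end

theory Submission
  imports Defs "HOL-Number_Theory.Cong" "HOL-Analysis.Finite_Function_Topology"
begin

text \<open>Milnor's argument for the Witt group of the rationals shows that the rational quadratic
  space of \<open>L\<close> has an orthogonal basis with \<open>8 n + 1\<close> norms \<open>1\<close> and one norm \<open>- 1\<close>: after adding
  hyperbolic planes, the prime divisors of the norms of an orthogonal basis are removed one after
  the other, the largest first, since the residue form at \<open>p\<close> of a space containing a unimodular
  lattice is metabolic. In particular \<open>L\<close> contains isotropic vectors.

  Let \<open>v\<close> be primitive of norm \<open>2 m\<close>. There is an isotropic \<open>f\<^sub>1 \<in> L\<close> whose inner product \<open>c\<close> with \<open>v\<close>
  is prime to \<open>2 m\<close>. With \<open>f = f\<^sub>1 / c\<close> and \<open>e = v - m f\<close>, the space is the sum of the hyperbolic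
  plane of \<open>e, f\<close> and a sum of \<open>8 n\<close> unit vectors, in which there is a standard even unimodular
  lattice \<open>M\<close> containing \<open>v = e + m f\<close>. By Lagrange's theorem \<open>2 m - 1\<close> is a sum of four squares,
  which gives a hyperbolic plane in \<open>M\<close> orthogonal to \<open>v\<close>. Eichler transvections along this plane show
  that every Kneser neighbour of \<open>M\<close> containing \<open>v\<close>, except the one in the direction of \<open>v\<close>, is
  the image of \<open>M\<close> under an isometry fixing \<open>v\<close>. A chain of such neighbours leads from \<open>M\<close> to \<open>L\<close>; the
  exceptional neighbour is avoided because it exists only at primes dividing \<open>m\<close>, where \<open>f\<close> is
  integral. So \<open>(L, v)\<close> is isometric to \<open>(M, e + m f)\<close>, which does not depend on \<open>v\<close>.\<close>

text \<open>Comparing \<open>L\<close> with a standard lattice requires both to lie in one rational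
  space, for which an isotropic vector is not enough. Once the space has a diagonal of units, Witt
  cancellation gives every hyperbolic pair a complement spanned by 8 n orthonormal vectors, so
  \<open>M\<close> can be built around a pair adapted to \<open>v\<close>; the divisibility of 8 n
  by 8 makes the half-integral vectors of \<open>M\<close> have even norm.

  The obstacle is that all isometries must fix \<open>v\<close>. A transvection orthogonal to
  \<open>v\<close> produces an isotropic vector that pairs to 1 with a vector orthogonal to
  \<open>v\<close>, so modulo p it never has the direction of \<open>v\<close>. This is why
  \<open>f\<close> is only rational, with denominator prime to m: the vector \<open>c f\<close> lies
  in \<open>M\<close> and in \<open>L\<close> and is kept by the whole chain. At a neighbour in the
  direction of \<open>v\<close> its integral pairings would force p to divide c, and evenness would
  force p to divide m.

  The number 2 m - 1 arises because the isotropic vector \<open>e - m f + y\<close> needs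
  \<open>y\<close> of norm 2 m, and one coordinate of \<open>y\<close> is set to 1 to provide the
  partner of this vector.\<close>

section \<open>Diagonal forms up to Witt equivalence\<close>

text \<open>A multiset of integers stands for the norms of an orthogonal basis of a rational quadratic
  space; the rules are elementary changes of such a basis.\<close>

inductive diag_eq :: "int multiset \<Rightarrow> int multiset \<Rightarrow> bool" where
  refl: "diag_eq A A"
| sym: "diag_eq A B \<Longrightarrow> diag_eq B A"
| trans: "diag_eq A B \<Longrightarrow> diag_eq B C \<Longrightarrow> diag_eq A C"
| square: "a \<noteq> 0 \<Longrightarrow> c \<noteq> 0 \<Longrightarrow> diag_eq (add_mset a A) (add_mset (a * c\<^sup>2) A)"
| plus: "a \<noteq> 0 \<Longrightarrow> b \<noteq> 0 \<Longrightarrow> a + b \<noteq> 0 \<Longrightarrow>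
    diag_eq (add_mset a (add_mset b A)) (add_mset (a + b) (add_mset (a * b * (a + b)) A))"
| hyperbolic: "a \<noteq> 0 \<Longrightarrow> diag_eq (add_mset a (add_mset (- a) A)) (add_mset 1 (add_mset (- 1) A))"

lemma diag_eq_add: "diag_eq A B \<Longrightarrow> diag_eq (A + C) (B + C)"
proof (induction rule: diag_eq.induct)
  case (trans A B D) then show ?case by (blast intro: diag_eq.trans)
qed (auto intro: diag_eq.intros)

lemma diag_eq_add2: "diag_eq A B \<Longrightarrow> diag_eq C D \<Longrightarrow> diag_eq (A + C) (B + D)"
  by (metis diag_eq.trans diag_eq_add union_commute)

definition npos :: "int multiset \<Rightarrow> nat" where "npos A = size (filter_mset (\<lambda>a. a > 0) A)"

lemma diag_eq_size: "diag_eq A B \<Longrightarrow> size A = size B"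
  by (induction rule: diag_eq.induct) auto

text \<open>Once every entry is 1 or - 1, this number and the size determine the multiset. In this
  way the signature decides the final diagonal in \<open>unimodular_diagonal_units\<close>.\<close>

lemma diag_eq_npos: "diag_eq A B \<Longrightarrow> npos A = npos B"
proof (induction rule: diag_eq.induct)
  case (plus a b A)
  then have "a + b > 0 \<or> a + b < 0" by linarith
  have "(a*b*(a+b) > 0) = ((a > 0 \<and> b > 0) \<or> ((a > 0 \<or> b > 0) \<and> a + b < 0))"
    using plus by (auto simp: zero_less_mult_iff mult_less_0_iff)
  with plus show ?case by (auto simp: npos_def)
qed (auto simp: npos_def zero_less_mult_iff)

definition hyp :: "nat \<Rightarrow> int multiset" where
  "hyp k = replicate_mset k 1 + replicate_mset k (- 1)"

lemma hyp_add: "hyp (j + k) = hyp j + hyp k"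
  by (induction j) (auto simp: hyp_def)

text \<open>Equality in the Witt group. Different numbers of planes are allowed on the two sides, so
  that \<open>{#a, - a#}\<close> becomes zero and classes with nonzero entries have negatives; the
  dimension lost in this way is recovered from \<open>npos\<close> and \<open>size\<close>.\<close>

definition witt_eq :: "int multiset \<Rightarrow> int multiset \<Rightarrow> bool" where
  "witt_eq A B \<longleftrightarrow> (\<exists>j k. diag_eq (A + hyp j) (B + hyp k))"

lemma diag_witt_eq: "diag_eq A B \<Longrightarrow> witt_eq A B"
  unfolding witt_eq_def by (rule exI[of _ 0], rule exI[of _ 0]) (simp add: hyp_def)

lemma witt_eq_refl [simp]: "witt_eq A A"
  by (simp add: diag_witt_eq diag_eq.refl)

lemma witt_eq_sym: "witt_eq A B \<Longrightarrow> witt_eq B A"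
  unfolding witt_eq_def using diag_eq.sym by blast

lemma witt_eq_trans [trans]:
  assumes "witt_eq A B" "witt_eq B C" shows "witt_eq A C"
proof -
  obtain j k j' k' where 1: "diag_eq (A + hyp j) (B + hyp k)" and 2: "diag_eq (B + hyp j') (C + hyp k')"
    using assms unfolding witt_eq_def by blast
  have "diag_eq (A + hyp j + hyp j') (B + hyp k + hyp j')" using 1 by (rule diag_eq_add)
  moreover have "diag_eq (B + hyp j' + hyp k) (C + hyp k' + hyp k)" using 2 by (rule diag_eq_add)
  ultimately have "diag_eq (A + hyp (j + j')) (C + hyp (k' + k))"
    by (metis diag_eq.trans hyp_add union_assoc union_commute)
  then show ?thesis unfolding witt_eq_def by blast
qed

lemma witt_eq_add:
  assumes "witt_eq A B" "witt_eq C D" shows "witt_eq (A + C) (B + D)"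
proof -
  obtain j k j' k' where 1: "diag_eq (A + hyp j) (B + hyp k)" and 2: "diag_eq (C + hyp j') (D + hyp k')"
    using assms unfolding witt_eq_def by blast
  have "diag_eq ((A + hyp j) + (C + hyp j')) ((B + hyp k) + (D + hyp k'))"
    using 1 2 by (rule diag_eq_add2)
  then have "diag_eq ((A + C) + hyp (j + j')) ((B + D) + hyp (k + k'))"
    by (simp add: hyp_add union_ac)
  then show ?thesis unfolding witt_eq_def by blast
qed

lemma witt_eq_add_left: "witt_eq A B \<Longrightarrow> witt_eq (C + A) (C + B)"
  by (simp add: witt_eq_add)

lemma witt_eq_cancel: assumes "a \<noteq> 0" shows "witt_eq {#a, - a#} {#}"
proof -
  have "diag_eq {#a, - a#} {#1, -1#}" by (rule diag_eq.hyperbolic[OF assms, of "{#}"])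
  then have "diag_eq ({#a, -a#} + hyp 0) ({#} + hyp 1)"
    by (simp add: hyp_def add_mset_commute)
  then show ?thesis unfolding witt_eq_def by blast
qed

lemma witt_eq_cancel_mset:
  assumes "0 \<notin># A" shows "witt_eq (A + image_mset uminus A) {#}"
  using assms
proof (induction A)
  case (add a A)
  have "witt_eq ({#a, - a#} + (A + image_mset uminus A)) ({#} + {#})"
    by (rule witt_eq_add) (use add in \<open>auto intro: witt_eq_cancel\<close>)
  then show ?case by (simp add: add_mset_commute)
qed simp

lemma witt_eq_square: "a \<noteq> 0 \<Longrightarrow> c \<noteq> 0 \<Longrightarrow> witt_eq {#a#} {#a * c\<^sup>2#}"
  using diag_witt_eq[OF diag_eq.square[of a c "{#}"]] by simp

lemma witt_eq_plus: "a \<noteq> 0 \<Longrightarrow> b \<noteq> 0 \<Longrightarrow> a + b \<noteq> 0 \<Longrightarrow> witt_eq {#a, b#} {#a + b, a * b * (a + b)#}"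
  using diag_witt_eq[OF diag_eq.plus[of a b "{#}"]] by simp

text \<open>Division with remainder inside the Witt group: \<open>l * p\<^sup>2\<close> and
  \<open>p * r\<close> add up to \<open>p * n\<close>, and their product with this sum is
  \<open>l * r * n\<close> times a fourth power. So \<open>plus\<close> trades \<open>p * n\<close>
  for \<open>p * r\<close> and two entries in which the factor \<open>p\<close> no longer appears
  explicitly.\<close>

lemma witt_eq_division:
  assumes "n = p * l + r" "n \<noteq> 0" "p \<noteq> 0" "l \<noteq> 0" "r \<noteq> (0::int)"
  shows "witt_eq {#p * n#} {#p * r, l, - (l * r * n)#}"
proof -
  have e: "l * p\<^sup>2 + p * r = p * n" using assms(1) by (simp add: algebra_simps power2_eq_square)
  have e': "(l * p\<^sup>2) * (p * r) * (p * n) = l * r * n * (p\<^sup>2)\<^sup>2"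
    by (simp add: power2_eq_square)
  have "witt_eq {#l * p\<^sup>2, p * r#} {#l * p\<^sup>2 + p * r, (l * p\<^sup>2) * (p * r) * (l * p\<^sup>2 + p * r)#}"
    by (rule witt_eq_plus) (use assms e in auto)
  then have w2: "witt_eq {#l * p\<^sup>2, p * r#} {#p * n, l * r * n * (p\<^sup>2)\<^sup>2#}"
    by (simp only: e e')
  have w1: "witt_eq {#l, p * r#} {#l * p\<^sup>2, p * r#}"
    using witt_eq_add[OF witt_eq_square[OF assms(4,3)] witt_eq_refl[of "{#p * r#}"]]
    by (simp add: add_mset_commute)
  have w3: "witt_eq {#p * n, l * r * n * (p\<^sup>2)\<^sup>2#} {#p * n, l * r * n#}"
    using witt_eq_add_left[OF witt_eq_sym[OF witt_eq_square[of "l * r * n" "p\<^sup>2"]], of "{#p * n#}"] assms(2-5)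
    by (simp add: add_mset_commute)
  have 1: "witt_eq {#l, p * r#} {#p * n, l * r * n#}"
    by (rule witt_eq_trans[OF witt_eq_trans[OF w1 w2] w3])
  have "witt_eq ({#p * n#} + {#}) ({#p * n#} + {#l * r * n, - (l * r * n)#})"
    using assms by (intro witt_eq_add_left witt_eq_sym[OF witt_eq_cancel]) auto
  also have "\<dots> = {#p * n, l * r * n#} + {#- (l * r * n)#}" by simp
  also have "witt_eq \<dots> ({#l, p * r#} + {#- (l * r * n)#})"
    by (rule witt_eq_add[OF witt_eq_sym[OF 1] witt_eq_refl])
  finally show ?thesis by (simp add: add_mset_commute)
qed

section \<open>Integers with small prime factors, and residue forms at a prime\<close>

text \<open>For q > 1 these are the nonzero integers all of whose prime factors are below q. They
  are given as products of small factors, not through their primes, because the reduction modulo p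
  in \<open>witt_eq_mod_reduce_aux\<close> multiplies in one small factor at a time.\<close>

inductive smooth :: "int \<Rightarrow> int \<Rightarrow> bool" for q where
  one: "smooth q 1"
| mult: "u \<noteq> 0 \<Longrightarrow> \<bar>u\<bar> < q \<Longrightarrow> smooth q n \<Longrightarrow> smooth q (u * n)"

lemma smooth_mult: "smooth q a \<Longrightarrow> smooth q b \<Longrightarrow> smooth q (a * b)"
  by (induction rule: smooth.induct) (auto simp: mult.assoc intro: smooth.intros)

lemma smooth_small: "u \<noteq> 0 \<Longrightarrow> \<bar>u\<bar> < q \<Longrightarrow> smooth q u"
  using smooth.mult[OF _ _ smooth.one] by fastforce

lemma smooth_nonzero: "smooth q a \<Longrightarrow> a \<noteq> 0"
  by (induction rule: smooth.induct) auto

lemma smooth_uminus: "q > 1 \<Longrightarrow> smooth q a \<Longrightarrow> smooth q (- a)"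
  using smooth.mult[of "-1" q a] by simp

lemma smooth_not_dvd: assumes "prime p" "smooth p a" shows "\<not> p dvd a"
  using assms(2)
proof (induction rule: smooth.induct)
  case one
  then show ?case using assms(1) not_prime_unit by blast
next
  case (mult u n)
  then show ?case using assms(1) by (metis abs_dvd_iff dvd_abs_iff prime_dvd_mult_iff zdvd_not_zless zero_less_abs_iff)
qed

lemma smooth_2: "smooth 2 a \<Longrightarrow> a = 1 \<or> a = - 1"
proof (induction rule: smooth.induct)
  case (mult u n)
  then have "u = 1 \<or> u = -1" by linarith
  with mult show ?case by auto
qed auto

definition smooth_mset :: "int \<Rightarrow> int multiset \<Rightarrow> bool" where
  "smooth_mset q A \<longleftrightarrow> (\<forall>a\<in>#A. smooth q a)"

lemma smooth_mset_simps [simp]: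
  "smooth_mset q {#}" "smooth_mset q (add_mset a A) \<longleftrightarrow> smooth q a \<and> smooth_mset q A"
  "smooth_mset q (A + B) \<longleftrightarrow> smooth_mset q A \<and> smooth_mset q B"
  by (auto simp: smooth_mset_def)

text \<open>Congruence modulo the classes with smooth entries, which form the steps of Milnor's
  filtration of the Witt group of the rationals. For q = p prime, the class of \<open>p * b\<close>
  with smooth b then depends only on b modulo p, up to squares, as in a Witt group over the field
  with p elements.\<close>

definition witt_eq_mod :: "int \<Rightarrow> int multiset \<Rightarrow> int multiset \<Rightarrow> bool" where
  "witt_eq_mod q A B \<longleftrightarrow> (\<exists>C. smooth_mset q C \<and> witt_eq A (B + C))"

lemma witt_eq_mod_witt_eq: "witt_eq A B \<Longrightarrow> witt_eq_mod q A B"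
  unfolding witt_eq_mod_def by (rule exI[of _ "{#}"]) simp

lemma witt_eq_mod_refl [simp]: "witt_eq_mod q A A"
  by (simp add: witt_eq_mod_witt_eq)

lemma witt_eq_mod_trans [trans]:
  assumes "witt_eq_mod q A B" "witt_eq_mod q B C" shows "witt_eq_mod q A C"
proof -
  obtain D E where D: "smooth_mset q D" "witt_eq A (B + D)" and E: "smooth_mset q E" "witt_eq B (C + E)"
    using assms unfolding witt_eq_mod_def by blast
  have "witt_eq A ((C + E) + D)"
    using D(2) witt_eq_add[OF E(2) witt_eq_refl] by (rule witt_eq_trans)
  then show ?thesis unfolding witt_eq_mod_def using D E
    by (intro exI[of _ "E + D"]) (simp add: union_ac)
qed

lemma witt_eq_mod_sym:
  assumes "q > 1" "witt_eq_mod q A B" shows "witt_eq_mod q B A"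
proof -
  obtain D where D: "smooth_mset q D" "witt_eq A (B + D)"
    using assms unfolding witt_eq_mod_def by blast
  have "0 \<notin># D" using D(1) smooth_nonzero by (auto simp: smooth_mset_def)
  then have "witt_eq (B + (D + image_mset uminus D)) (B + {#})"
    by (intro witt_eq_add_left witt_eq_cancel_mset)
  then have "witt_eq B (B + D + image_mset uminus D)"
    using witt_eq_sym by (simp add: union_assoc)
  also have "witt_eq \<dots> (A + image_mset uminus D)"
    by (rule witt_eq_add[OF witt_eq_sym[OF D(2)] witt_eq_refl])
  finally have "witt_eq B (A + image_mset uminus D)" .
  moreover have "smooth_mset q (image_mset uminus D)"
    using D(1) assms(1) smooth_uminus by (auto simp: smooth_mset_def)
  ultimately show ?thesis unfolding witt_eq_mod_def by blast
qed

lemma witt_eq_mod_add: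
  assumes "witt_eq_mod q A B" "witt_eq_mod q C D" shows "witt_eq_mod q (A + C) (B + D)"
proof -
  obtain E F where E: "smooth_mset q E" "witt_eq A (B + E)" and F: "smooth_mset q F" "witt_eq C (D + F)"
    using assms unfolding witt_eq_mod_def by blast
  have "witt_eq (A + C) ((B + E) + (D + F))" by (rule witt_eq_add[OF E(2) F(2)])
  then show ?thesis unfolding witt_eq_mod_def using E F
    by (intro exI[of _ "E + F"]) (simp add: union_ac)
qed

text \<open>The factors of \<open>n\<close> are absorbed one by one into the remainder
  \<open>r\<close>. Since both \<open>u\<close> and \<open>r\<close> are smaller than p, the
  quotient \<open>l\<close> of \<open>u * r\<close> by p is smaller than p in absolute value, so the
  two extra entries produced by \<open>witt_eq_division\<close> are smooth.\<close>

lemma witt_eq_mod_reduce_aux: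
  assumes "prime p" "smooth p n"
  shows "0 < r \<Longrightarrow> r < p \<Longrightarrow> witt_eq_mod p {#p * (n * r)#} {#p * ((n * r) mod p)#}"
  using assms(2)
proof (induction arbitrary: r rule: smooth.induct)
  case one
  then show ?case by simp
next
  case (mult u n)
  define r1 where "r1 = (u * r) mod p"
  define l where "l = (u * r) div p"
  have p: "p > 1" using assms(1) prime_gt_1_int by blast
  have "smooth p u" "smooth p r" using mult by (auto intro: smooth_small)
  then have "\<not> p dvd u * r" using assms(1) smooth_not_dvd prime_dvd_mult_iff by blast
  then have r1: "0 < r1" "r1 < p"
    using p pos_mod_bound[of p "u * r"] pos_mod_sign[of p "u * r"]
    unfolding r1_def dvd_eq_mod_eq_0 by linarith+
  have eq: "u * n * r = p * (n * l) + n * r1"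
    unfolding r1_def l_def using mult_div_mod_eq[of p "u * r"]
    by (metis (no_types, lifting) distrib_left mult.assoc mult.commute)
  have n: "smooth p n" "n \<noteq> 0" using mult smooth_nonzero by auto
  have "\<bar>l\<bar> < p"
  proof -
    have "\<bar>u\<bar> * r < p * p - p"
    proof -
      have "\<bar>u\<bar> * r \<le> (p - 1) * (p - 1)" using mult by (intro mult_mono) auto
      also have "\<dots> = p * p - p - (p - 1)" by (simp add: algebra_simps)
      finally show ?thesis using p by linarith
    qed
    then have "\<bar>u * r\<bar> < p * p - p" using mult(5) by (simp add: abs_mult)
    then have b: "- (p * p - p) < u * r" "u * r < p * p - p" by linarith+
    have "p * l = u * r - r1" unfolding l_def r1_def by (simp add: minus_mod_eq_mult_div)
    then have "p * l < p * p" "p * (- p) < p * l" using b r1 p by (auto simp only: mult_minus_right)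
    then have "l < p" "- p < l" 
      using p mult_left_less_imp_less[of p l p] mult_left_less_imp_less[of p "- p" l] by auto
    then show ?thesis by simp
  qed
  have "witt_eq_mod p {#p * (u * n * r)#} {#p * (n * r1)#}"
  proof (cases "l = 0")
    case True
    then have "u * n * r = n * r1" using eq by simp
    then show ?thesis by (simp only: witt_eq_mod_refl)
  next
    case False
    then have l: "smooth p l" using \<open>\<bar>l\<bar> < p\<close> smooth_small by blast
    have sr: "smooth p r1" using r1 by (auto intro: smooth_small)
    have "witt_eq {#p * (u * n * r)#} {#p * (n * r1), n * l, - ((n * l) * (n * r1) * (u * n * r))#}"
      by (rule witt_eq_division[OF eq]) (use mult n False r1 p in auto)
    then have "witt_eq {#p * (u * n * r)#} ({#p * (n * r1)#} + {#n * l, - ((n * l) * (n * r1) * (u * n * r))#})"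
      by (simp add: add_mset_commute)
    moreover have "smooth_mset p {#n * l, - ((n * l) * (n * r1) * (u * n * r))#}"
      using l sr n \<open>smooth p u\<close> \<open>smooth p r\<close> p smooth_mult smooth_uminus by (simp del: mult_minus_left)
    ultimately show ?thesis unfolding witt_eq_mod_def by blast
  qed
  also have "witt_eq_mod p {#p * (n * r1)#} {#p * ((n * r1) mod p)#}"
    by (rule mult.IH) (use r1 in auto)
  also have "(n * r1) mod p = (u * n * r) mod p"
    using eq by simp
  finally show ?case by simp
qed

lemma witt_eq_mod_reduce:
  assumes "prime p" "smooth p n" shows "witt_eq_mod p {#p * n#} {#p * (n mod p)#}"
  using witt_eq_mod_reduce_aux[OF assms, of 1] prime_gt_1_int[OF assms(1)] by simp

lemma witt_eq_mod_cong:
  assumes "prime p" "smooth p n" "smooth p n'" "[n = n'] (mod p)"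
  shows "witt_eq_mod p {#p * n#} {#p * n'#}"
proof -
  have "witt_eq_mod p {#p * n#} {#p * (n' mod p)#}"
    using witt_eq_mod_reduce[OF assms(1,2)] assms(4) by (simp add: cong_def)
  also have "witt_eq_mod p \<dots> {#p * n'#}"
    using witt_eq_mod_sym[OF prime_gt_1_int witt_eq_mod_reduce] assms by blast
  finally show ?thesis .
qed

lemma witt_eq_mod_square:
  assumes "prime p" "smooth p b" "smooth p c" "\<not> p dvd x" "[b * x\<^sup>2 = c] (mod p)"
  shows "witt_eq_mod p {#p * b#} {#p * c#}"
proof -
  define y where "y = x mod p"
  have p: "p > 1" using assms(1) prime_gt_1_int by blast
  have y: "0 < y" "y < p" 
    using assms(4) p pos_mod_bound[of p x] pos_mod_sign[of p x] unfolding y_def dvd_eq_mod_eq_0 by linarith+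
  then have sy: "smooth p y" by (auto intro: smooth_small)
  have "[b * y\<^sup>2 = b * x\<^sup>2] (mod p)"
    unfolding y_def by (intro cong_mult cong_pow) auto
  then have c: "[b * y\<^sup>2 = c] (mod p)" using assms(5) cong_trans by blast
  have "witt_eq {#p * b#} {#p * b * y\<^sup>2#}"
    using assms p y smooth_nonzero by (intro witt_eq_square) auto
  then have "witt_eq_mod p {#p * b#} {#p * (b * y\<^sup>2)#}"
    by (simp add: witt_eq_mod_witt_eq mult.assoc)
  also have "witt_eq_mod p \<dots> {#p * c#}"
    by (rule witt_eq_mod_cong) (use assms c sy in \<open>auto simp: power2_eq_square intro: smooth_mult\<close>)
  finally show ?thesis .
qed

lemma witt_eq_mod_pair:
  assumes "prime p" "smooth p b" "smooth p c" "\<not> p dvd x" "[b * x\<^sup>2 + c = 0] (mod p)"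
  shows "witt_eq_mod p {#p * b, p * c#} {#}"
proof -
  have p: "p > 1" using assms(1) prime_gt_1_int by blast
  have "[b * x\<^sup>2 = - c] (mod p)" using assms(5) by (simp add: cong_iff_dvd_diff)
  then have "witt_eq_mod p {#p * b#} {#p * (- c)#}"
    using assms p by (intro witt_eq_mod_square) (auto intro: smooth_uminus)
  then have "witt_eq_mod p ({#p * b#} + {#p * c#}) ({#p * (- c)#} + {#p * c#})"
    by (rule witt_eq_mod_add) simp
  also have "witt_eq_mod p \<dots> {#}"
    using witt_eq_cancel[of "p * c"] assms p smooth_nonzero
    by (intro witt_eq_mod_witt_eq) (auto simp: add_mset_commute)
  finally show ?thesis by (simp add: add_mset_commute)
qed

text \<open>On 0, ..., p div 2 both \<open>b * x\<^sup>2\<close> and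
  \<open>- c * y\<^sup>2 - d\<close> take p div 2 + 1 different values modulo p, so they share a
  value. The argument includes p = 2.\<close>

lemma quadratic_residue_pigeonhole:
  fixes b c d :: int
  assumes "prime p" "\<not> p dvd b" "\<not> p dvd c"
  shows "\<exists>x y. p dvd b * x\<^sup>2 + c * y\<^sup>2 + d"
proof -
  have p: "p > 1" using assms(1) prime_gt_1_int by blast
  define I where "I = {0..p div 2}"
  have inj: "inj_on (\<lambda>x. (k * x\<^sup>2 + l) mod p) I" if k: "\<not> p dvd k" for k l
  proof (rule inj_onI, rule ccontr)
    fix x y assume xy: "x \<in> I" "y \<in> I" "(k * x\<^sup>2 + l) mod p = (k * y\<^sup>2 + l) mod p" "x \<noteq> y"
    then have "p dvd (k * x\<^sup>2 + l) - (k * y\<^sup>2 + l)" by (simp add: mod_eq_dvd_iff)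
    also have "\<dots> = k * ((x - y) * (x + y))" by (simp add: algebra_simps power2_eq_square)
    finally have "p dvd x - y \<or> p dvd x + y" using assms(1) k by (simp add: prime_dvd_mult_iff)
    moreover have "0 < x + y" "x + y < p" "\<bar>x - y\<bar> < p" "x - y \<noteq> 0"
      using xy p unfolding I_def by auto
    ultimately show False by (metis abs_ge_zero zdvd_not_zless zero_less_abs_iff dvd_abs_iff)
  qed
  have fin: "finite I" and card: "int (card I) = p div 2 + 1" using p by (auto simp: I_def)
  define X where "X = (\<lambda>x. (b * x\<^sup>2 + 0) mod p) ` I"
  define Y where "Y = (\<lambda>y. ((- c) * y\<^sup>2 + (- d)) mod p) ` I"
  have "card X = card I" "card Y = card I"
    unfolding X_def Y_def using assms by (intro card_image inj; simp)+
  moreover have "X \<union> Y \<subseteq> {0..<p}" using p by (auto simp: X_def Y_def)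
  then have "card (X \<union> Y) \<le> nat p" using card_mono[of "{0..<p}" "X \<union> Y"] by simp
  ultimately have "X \<inter> Y \<noteq> {}"
    using card_Un_disjoint[of X Y] fin card p by (auto simp: X_def Y_def)
  then obtain x y where "(b * x\<^sup>2 + 0) mod p = ((- c) * y\<^sup>2 + (- d)) mod p"
    unfolding X_def Y_def by blast
  then have "p dvd (b * x\<^sup>2 + 0) - ((- c) * y\<^sup>2 + (- d))" by (simp only: mod_eq_dvd_iff)
  then show ?thesis by (intro exI[of _ x] exI[of _ y]) (simp add: algebra_simps)
qed

text \<open>A ternary form over the field with p elements is isotropic. Either two of the entries
  already cancel, or the first two can be changed so that their sum is congruent to
  \<open>- d\<close>; then \<open>plus\<close> creates an entry that cancels
  \<open>p * d\<close>.\<close>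

lemma witt_eq_mod_triple:
  assumes p: "prime p" and s: "smooth p b" "smooth p c" "smooth p d"
  shows "\<exists>e. smooth p e \<and> witt_eq_mod p {#p * b, p * c, p * d#} {#p * e#}"
proof -
  have p1: "p > 1" using p prime_gt_1_int by blast
  obtain x y where xy: "p dvd b * x\<^sup>2 + c * y\<^sup>2 + d"
    using quadratic_residue_pigeonhole[OF p, of b c d] s smooth_not_dvd[OF p] by blast
  consider "p dvd x" | "p dvd y" | "\<not> p dvd x" "\<not> p dvd y" by blast
  then show ?thesis
  proof cases
    case 1
    have "[b * x\<^sup>2 + c * y\<^sup>2 + d = 0 + c * y\<^sup>2 + d] (mod p)"
      using 1 by (intro cong_add) (auto simp: cong_0_iff power2_eq_square)
    then have c: "[c * y\<^sup>2 + d = 0] (mod p)" using xy by (simp add: cong_def dvd_eq_mod_eq_0)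
    have "\<not> p dvd y"
    proof
      assume "p dvd y"
      then have "p dvd c * y\<^sup>2" by (simp add: power2_eq_square)
      then have "p dvd d" using c by (simp add: cong_0_iff dvd_add_right_iff)
      then show False using s p smooth_not_dvd by blast
    qed
    then have "witt_eq_mod p ({#p * b#} + {#p * c, p * d#}) ({#p * b#} + {#})"
      by (intro witt_eq_mod_add witt_eq_mod_pair[OF p s(2,3) _ c]) auto
    then show ?thesis using s by (intro exI[of _ b]) (simp add: add_mset_commute)
  next
    case 2
    have "[b * x\<^sup>2 + c * y\<^sup>2 + d = b * x\<^sup>2 + 0 + d] (mod p)"
      using 2 by (intro cong_add) (auto simp: cong_0_iff power2_eq_square)
    then have c: "[b * x\<^sup>2 + d = 0] (mod p)" using xy by (simp add: cong_def dvd_eq_mod_eq_0)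
    have "\<not> p dvd x"
    proof
      assume "p dvd x"
      then have "p dvd b * x\<^sup>2" by (simp add: power2_eq_square)
      then have "p dvd d" using c by (simp add: cong_0_iff dvd_add_right_iff)
      then show False using s p smooth_not_dvd by blast
    qed
    then have "witt_eq_mod p ({#p * c#} + {#p * b, p * d#}) ({#p * c#} + {#})"
      by (intro witt_eq_mod_add witt_eq_mod_pair[OF p s(1,3) _ c]) auto
    then show ?thesis using s by (intro exI[of _ c]) (simp add: add_mset_commute)
  next
    case 3
    define r where "r = (b * x\<^sup>2) mod p"
    \<comment> \<open>The residue is taken negative: with 0 < r < p and - p < t < 0 the sum
      \<open>r + t\<close> is again below p in absolute value, hence smooth.\<close>
    define t where "t = (c * y\<^sup>2) mod p - p"
    have nd: "\<not> p dvd b * x\<^sup>2" "\<not> p dvd c * y\<^sup>2"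
      using 3 s p by (auto simp: prime_dvd_mult_iff prime_dvd_power_iff dest: smooth_not_dvd)
    have r: "0 < r" "r < p" "- p < t" "t < 0"
      using nd p1 pos_mod_bound[of p "b * x\<^sup>2"] pos_mod_sign[of p "b * x\<^sup>2"]
        pos_mod_bound[of p "c * y\<^sup>2"] pos_mod_sign[of p "c * y\<^sup>2"]
      unfolding r_def t_def dvd_eq_mod_eq_0 by linarith+
    have cr: "[b * x\<^sup>2 = r] (mod p)" by (simp add: r_def cong_def)
    have ct: "[c * y\<^sup>2 = t] (mod p)" by (simp add: t_def cong_def)
    have "[r + t = b * x\<^sup>2 + c * y\<^sup>2] (mod p)"
      by (intro cong_add cong_sym[OF cr] cong_sym[OF ct])
    then have crt: "[r + t = - d] (mod p)"
      using xy by (metis (no_types, opaque_lifting) add.commute add_diff_cancel_left' cong_iff_dvd_diff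
          cong_trans diff_minus_eq_add)
    have "r + t \<noteq> 0"
    proof
      assume "r + t = 0"
      then have "p dvd d" using crt by (simp add: cong_iff_dvd_diff)
      then show False using s p smooth_not_dvd by blast
    qed
    then have sm: "smooth p r" "smooth p t" "smooth p (r + t)" using r by (auto intro!: smooth_small)
    have "witt_eq_mod p ({#p * b#} + ({#p * c#} + {#p * d#})) ({#p * r#} + ({#p * t#} + {#p * d#}))"
      using 3 by (intro witt_eq_mod_add witt_eq_mod_square[OF p s(1) sm(1) _ cr]
          witt_eq_mod_square[OF p s(2) sm(2) _ ct]) auto
    also have "witt_eq {#p * r, p * t#} {#p * r + p * t, (p * r) * (p * t) * (p * r + p * t)#}"
    proof (rule witt_eq_plus)
      have "p * (r + t) \<noteq> 0" using p1 \<open>r + t \<noteq> 0\<close> by simp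
      then show "p * r + p * t \<noteq> 0" by (metis distrib_left)
    qed (use p1 r in auto)
    then have "witt_eq_mod p ({#p * r, p * t#} + {#p * d#})
        ({#p * (r + t), (p * r * t * (r + t)) * p\<^sup>2#} + {#p * d#})"
      by (intro witt_eq_mod_add witt_eq_mod_witt_eq) (simp_all add: algebra_simps power2_eq_square)
    then have "witt_eq_mod p ({#p * r#} + ({#p * t#} + {#p * d#}))
        ({#p * (r + t)#} + ({#(p * r * t * (r + t)) * p\<^sup>2#} + {#p * d#}))" by (simp add: add_mset_commute)
    also have "witt_eq_mod p \<dots> ({#p * (- d)#} + ({#p * r * t * (r + t)#} + {#p * d#}))"
      using p1 sm smooth_nonzero
      by (intro witt_eq_mod_add witt_eq_mod_cong[OF p sm(3) smooth_uminus[OF _ s(3)] crt]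
          witt_eq_mod_witt_eq[OF witt_eq_sym[OF witt_eq_square]]) auto
    finally have 1: "witt_eq_mod p {#p * b, p * c, p * d#} {#- (p * d), p * (r * t * (r + t)), p * d#}"
      by (simp add: mult.assoc add_mset_commute)
    have "witt_eq_mod p ({#p * (r * t * (r + t))#} + {#p * d, - (p * d)#}) ({#p * (r * t * (r + t))#} + {#})"
      using p1 s smooth_nonzero by (intro witt_eq_mod_add witt_eq_mod_witt_eq[OF witt_eq_cancel]) auto
    then have "witt_eq_mod p {#- (p * d), p * (r * t * (r + t)), p * d#} {#p * (r * t * (r + t))#}"
      by (simp add: add_mset_commute)
    with 1 show ?thesis using sm by (intro exI[of _ "r * t * (r + t)"]) (auto intro: witt_eq_mod_trans smooth_mult)
  qed
qed

text \<open>The trace of unimodularity at \<open>p\<close> on a residue form of dimension at most two: dimension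
  one is impossible, and in dimension two the residue form is isotropic.\<close>

definition locally_ok :: "int multiset \<Rightarrow> bool" where
  "locally_ok C \<longleftrightarrow>
    (\<forall>p b A. prime p \<longrightarrow> C = add_mset (p * b) A \<longrightarrow> \<not> p dvd b \<longrightarrow> (\<exists>a\<in>#A. p dvd a)) \<and>
    (\<forall>p b c A. prime p \<longrightarrow> C = add_mset (p * b) (add_mset (p * c) A) \<longrightarrow> \<not> p dvd b \<longrightarrow> \<not> p dvd c \<longrightarrow>
       (\<forall>a\<in>#A. \<not> p dvd a) \<longrightarrow> (\<exists>x y. \<not> p dvd x \<and> p dvd b * y\<^sup>2 + c * x\<^sup>2))"

text \<open>The lattice enters the descent through the primes only in this form. Being a condition
  on all representatives of a class, it survives every change of representative.\<close>

definition witt_ok :: "int multiset \<Rightarrow> bool" where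
  "witt_ok A \<longleftrightarrow> (\<forall>C. witt_eq A C \<longrightarrow> locally_ok C)"

lemma witt_ok_cong: "witt_ok A \<Longrightarrow> witt_eq A B \<Longrightarrow> witt_ok B"
  unfolding witt_ok_def using witt_eq_trans by blast

text \<open>Induction on the dimension of the residue form \<open>B\<close>: three entries collapse
  to one, and the local condition excludes a single entry and lets a pair cancel. What remains is
  prime to p.\<close>

lemma witt_ok_remove_prime:
  assumes p: "prime p" and "smooth_mset p A" "smooth_mset p B" "witt_ok (A + image_mset ((*) p) B)"
  shows "\<exists>C. smooth_mset p C \<and> witt_eq (A + image_mset ((*) p) B) C"
  using assms(2-)
proof (induction "size B" arbitrary: A B rule: less_induct)
  case less
  have nd: "\<forall>a\<in>#A. \<not> p dvd a" using less.prems smooth_not_dvd[OF p] by (auto simp: smooth_mset_def)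
  have lo: "locally_ok (A + image_mset ((*) p) B)" using less.prems unfolding witt_ok_def by simp
  have step: ?case if B: "B = B1 + B2" and w: "witt_eq_mod p (image_mset ((*) p) B1) (image_mset ((*) p) B3)"
    and B3: "smooth_mset p B3" and size: "size B3 < size B1" for B1 B2 B3
  proof -
    obtain D where D: "smooth_mset p D" "witt_eq (image_mset ((*) p) B1) (image_mset ((*) p) B3 + D)"
      using w unfolding witt_eq_mod_def by blast
    define A' where "A' = A + D"
    define B' where "B' = B3 + B2"
    have "witt_eq ((A + image_mset ((*) p) B2) + image_mset ((*) p) B1)
        ((A + image_mset ((*) p) B2) + (image_mset ((*) p) B3 + D))" using D(2) by (rule witt_eq_add_left)
    then have e: "witt_eq (A + image_mset ((*) p) B) (A' + image_mset ((*) p) B')"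
      by (simp add: B A'_def B'_def union_ac)
    have "\<exists>C. smooth_mset p C \<and> witt_eq (A' + image_mset ((*) p) B') C"
    proof (rule less.hyps)
      show "size B' < size B" using size by (simp add: B B'_def)
      show "smooth_mset p A'" "smooth_mset p B'" using less.prems D B3 by (auto simp: A'_def B'_def B)
      show "witt_ok (A' + image_mset ((*) p) B')" using less.prems(3) e by (rule witt_ok_cong)
    qed
    then show ?thesis using e witt_eq_trans by blast
  qed
  consider "B = {#}" | b where "B = {#b#}" | b c where "B = {#b, c#}"
    | b c d B' where "B = {#b, c, d#} + B'"
  proof (cases B)
    case (add b B1)
    show thesis
    proof (cases B1)
      case (add c B2)
      then show thesis using \<open>B = add_mset b B1\<close> that(3,4) by (cases B2) auto
    qed (use add that in auto)
  qed (use that in auto)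
  then show ?case
  proof cases
    case 1
    then show ?thesis using less.prems by (intro exI[of _ A]) simp
  next
    case 2
    then have "\<not> p dvd b" using less.prems smooth_not_dvd[OF p] by simp
    then show ?thesis using lo[unfolded locally_ok_def, THEN conjunct1, rule_format, of p b A] p nd 2 by auto
  next
    case 3
    then have s: "smooth p b" "smooth p c" using less.prems by auto
    then have b: "\<not> p dvd b" "\<not> p dvd c" using smooth_not_dvd[OF p] by auto
    then obtain x y where xy: "\<not> p dvd x" "p dvd b * y\<^sup>2 + c * x\<^sup>2"
      using lo[unfolded locally_ok_def, THEN conjunct2, rule_format, of p b c A] p nd 3 by auto
    have "coprime x p" using xy(1) p by (simp add: coprime_commute prime_imp_coprime)
    then obtain z where z: "[x * z = 1] (mod p)" using cong_solve_coprime_int by blast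
    have "[b * (y * z)\<^sup>2 + c * 1 = b * (y * z)\<^sup>2 + c * (x * z)\<^sup>2] (mod p)"
      using cong_pow[OF cong_sym[OF z], of 2] by (intro cong_add cong_mult cong_refl) simp_all
    also have "b * (y * z)\<^sup>2 + c * (x * z)\<^sup>2 = (b * y\<^sup>2 + c * x\<^sup>2) * z\<^sup>2"
      by (simp add: algebra_simps power_mult_distrib)
    also have "[\<dots> = 0] (mod p)" using xy(2) by (simp add: cong_0_iff)
    finally have c: "[b * (y * z)\<^sup>2 + c = 0] (mod p)" by simp
    have "\<not> p dvd y * z"
    proof
      assume "p dvd y * z"
      then have "p dvd b * (y * z)\<^sup>2" by (simp add: power2_eq_square)
      then have "p dvd c" using c by (simp add: cong_0_iff dvd_add_right_iff)
      then show False using b by blast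
    qed
    from witt_eq_mod_pair[OF p s this c] show ?thesis
      by (intro step[of B "{#}" "{#}"]) (use 3 in auto)
  next
    case 4
    then have s: "smooth p b" "smooth p c" "smooth p d" using less.prems by auto
    from witt_eq_mod_triple[OF p this] obtain e where
      "smooth p e" "witt_eq_mod p {#p * b, p * c, p * d#} {#p * e#}" by blast
    then show ?thesis by (intro step[of "{#b, c, d#}" B' "{#e#}"]) (use 4 in auto)
  qed
qed

section \<open>Descent through the primes to a diagonal of units\<close>

text \<open>Only the parity of the exponent of p matters: a second factor p moves into the square
  \<open>c\<^sup>2\<close>.\<close>

lemma smooth_prime_split:
  assumes "smooth (p + 1) n" "prime p"
  shows "\<exists>m c. smooth p m \<and> c \<noteq> 0 \<and> (n = m * c\<^sup>2 \<or> n = p * m * c\<^sup>2)"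
  using assms(1)
proof (induction rule: smooth.induct)
  case one
  show ?case by (intro exI[of _ 1]) (simp add: smooth.one)
next
  case (mult u n)
  have p1: "p > 1" using assms(2) prime_gt_1_int by blast
  obtain m c where mc: "smooth p m" "c \<noteq> 0" "n = m * c\<^sup>2 \<or> n = p * m * c\<^sup>2" using mult by blast
  show ?case
  proof (cases "\<bar>u\<bar> < p")
    case True
    then have "smooth p (u * m)" using mult mc by (auto intro: smooth.mult)
    then show ?thesis using mc by (intro exI[of _ "u * m"] exI[of _ c]) auto
  next
    case False
    then obtain s where s: "u = p * s" "s = 1 \<or> s = - 1" using mult by (metis abs_if mult.right_neutral
      mult_minus_right minus_minus linorder_not_less zle_add1_eq_le order_antisym_conv)
    have sm: "smooth p (s * m)" using s(2) mc(1) p1 smooth_uminus by auto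
    from mc(3) show ?thesis
    proof
      assume "n = m * c\<^sup>2"
      then show ?thesis using s sm mc by (intro exI[of _ "s * m"] exI[of _ c]) auto
    next
      assume "n = p * m * c\<^sup>2"
      then have "u * n = (s * m) * (p * c)\<^sup>2" using s by (simp add: power2_eq_square)
      then show ?thesis using sm mc p1 by (intro exI[of _ "s * m"] exI[of _ "p * c"]) auto
    qed
  qed
qed

lemma smooth_nonprime:
  assumes "smooth (q + 1) n" "\<not> prime q" "q > 1" shows "smooth q n"
  using assms(1)
proof (induction rule: smooth.induct)
  case (mult u n)
  show ?case
  proof (cases "\<bar>u\<bar> < q")
    case True then show ?thesis using mult by (auto intro: smooth.mult)
  next
    case False
    then have u: "u = q \<or> u = - q" using mult by linarith
    obtain a where a: "a dvd q" "prime a"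
      using prime_divisor_exists[of q] assms(3) by auto
    then obtain b where b: "q = a * b" by blast
    have "a > 1" using a prime_gt_1_int by blast
    have "b > 0" using b \<open>a > 1\<close> assms(3) zero_less_mult_pos[of a b] by simp
    moreover have "b \<noteq> 1" using a b assms(2) by auto
    ultimately have "a * 1 < a * b" "1 * b < a * b"
      using \<open>a > 1\<close> by (intro mult_strict_left_mono mult_strict_right_mono; simp)+
    then have "a < q" "b < q" using b by simp_all
    then have "smooth q a" "smooth q b" using \<open>a > 1\<close> \<open>b > 0\<close> by (auto intro: smooth_small)
    then have "smooth q q" by (subst (2) b) (rule smooth_mult)
    then have "smooth q u" using u smooth_uminus assms(3) by auto
    then show ?thesis using mult smooth_mult by blast
  qed
qed (rule smooth.one)

lemma smooth_mset_prime_split: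
  assumes "smooth_mset (p + 1) A" "prime p"
  shows "\<exists>B C. smooth_mset p B \<and> smooth_mset p C \<and> witt_eq A (B + image_mset ((*) p) C)"
  using assms(1)
proof (induction A)
  case empty
  show ?case by (intro exI[of _ "{#}"]) simp
next
  case (add a A)
  then obtain B C where BC: "smooth_mset p B" "smooth_mset p C" "witt_eq A (B + image_mset ((*) p) C)" by auto
  have "smooth (p + 1) a" using add.prems by simp
  from smooth_prime_split[OF this assms(2)]
  obtain m c where m: "smooth p m" "c \<noteq> 0" "a = m * c\<^sup>2 \<or> a = p * m * c\<^sup>2" by blast
  have "m \<noteq> 0" using m smooth_nonzero by blast
  from m(3) show ?case
  proof
    assume a: "a = m * c\<^sup>2"
    have "witt_eq ({#a#} + A) ({#m#} + (B + image_mset ((*) p) C))"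
      using witt_eq_sym[OF witt_eq_square] a \<open>m \<noteq> 0\<close> m by (intro witt_eq_add BC) auto
    then show ?thesis using BC m by (intro exI[of _ "add_mset m B"] exI[of _ C]) simp
  next
    assume a: "a = p * m * c\<^sup>2"
    have "witt_eq ({#a#} + A) ({#p * m#} + (B + image_mset ((*) p) C))"
      using witt_eq_sym[OF witt_eq_square] a \<open>m \<noteq> 0\<close> m assms(2) by (intro witt_eq_add BC) auto
    then show ?thesis using BC m by (intro exI[of _ B] exI[of _ "add_mset m C"]) simp
  qed
qed

text \<open>The bound is lowered by one in each step, removing a prime or, at a composite number,
  nothing. The shift by 2 puts the base case at \<open>smooth 2\<close>, where the entries are 1 and
  - 1.\<close>

lemma witt_ok_smooth:
  assumes "witt_ok A" "smooth_mset (int q + 2) A"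
  shows "\<exists>C. witt_eq A C \<and> set_mset C \<subseteq> {1, - 1}"
  using assms
proof (induction q arbitrary: A)
  case 0
  then show ?case using smooth_2 by (intro exI[of _ A]) (auto simp: smooth_mset_def)
next
  case (Suc q)
  have q: "int (Suc q) + 2 = (int q + 2) + 1" by simp
  show ?case
  proof (cases "prime (int q + 2)")
    case True
    obtain B C where BC: "smooth_mset (int q + 2) B" "smooth_mset (int q + 2) C"
      "witt_eq A (B + image_mset ((*) (int q + 2)) C)"
      using smooth_mset_prime_split[OF Suc.prems(2)[unfolded q] True] by blast
    then obtain D where D: "smooth_mset (int q + 2) D" "witt_eq (B + image_mset ((*) (int q + 2)) C) D"
      using witt_ok_remove_prime[OF True BC(1,2)] witt_ok_cong Suc.prems(1) by blast
    then have "witt_eq A D" using BC(3) witt_eq_trans by blast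
    then show ?thesis using Suc.IH[OF witt_ok_cong[OF Suc.prems(1)] D(1)] witt_eq_trans by blast
  next
    case False
    have "smooth_mset (int q + 2) A"
      using Suc.prems(2) smooth_nonprime[OF _ False] unfolding q smooth_mset_def by auto
    then show ?thesis using Suc by blast
  qed
qed

lemma witt_ok_imp_units:
  assumes "witt_ok A" "0 \<notin># A"
  shows "\<exists>C. witt_eq A C \<and> set_mset C \<subseteq> {1, - 1}"
proof -
  define q where "q = nat (\<Sum>a\<in>#A. \<bar>a\<bar>)"
  have nn: "0 \<le> (\<Sum>a\<in>#B. \<bar>a\<bar>)" for B :: "int multiset" by (induction B) auto
  have "\<bar>a\<bar> \<le> (\<Sum>a\<in>#A. \<bar>a\<bar>)" if "a \<in># A" for a
    using nn by (subst insert_DiffM[OF that, symmetric]) simp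
  then have "smooth_mset (int q + 2) A"
    unfolding smooth_mset_def q_def using assms(2) nn[of A] by (auto intro!: smooth_small) fastforce
  then show ?thesis using witt_ok_smooth assms(1) by blast
qed

section \<open>Rational quadratic spaces and neighbours of lattices\<close>

text \<open>The locale is interpreted a second time for \<open>stabilize B k\<close>, which is
  degenerate on its type. Nondegeneracy is therefore expressed relative to a rational subspace,
  through the completeness clause of \<open>diagonalizes\<close>.\<close>

locale symmetric_form =
  fixes B :: "'v::real_vector \<Rightarrow> 'v \<Rightarrow> real"
  assumes bilin: "bilinear B" and sym: "B x y = B y x"
begin

lemmas form_simps [simp] =
  bilinear_ladd[OF bilin] bilinear_radd[OF bilin] bilinear_lsub[OF bilin] bilinear_rsub[OF bilin]
  bilinear_lmul[OF bilin] bilinear_rmul[OF bilin] bilinear_lneg[OF bilin] bilinear_rneg[OF bilin]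
  bilinear_lzero[OF bilin] bilinear_rzero[OF bilin]

lemma form_sum_right: "B x (\<Sum>i\<in>I. f i) = (\<Sum>i\<in>I. B x (f i))"
  using bilin linear_sum[of "B x" f I] by (simp add: bilinear_def)

lemma form_sum_left: "B (\<Sum>i\<in>I. f i) x = (\<Sum>i\<in>I. B (f i) x)"
  using form_sum_right[of x f I] by (simp add: sym)

definition rational_subspace :: "'v set \<Rightarrow> bool" where
  "rational_subspace S \<longleftrightarrow> 0 \<in> S \<and> (\<forall>x\<in>S. \<forall>y\<in>S. x + y \<in> S) \<and> (\<forall>r\<in>\<rat>. \<forall>x\<in>S. r *\<^sub>R x \<in> S) \<and>
     (\<forall>x\<in>S. \<forall>y\<in>S. B x y \<in> \<rat>)"

lemma rational_subspaceD:
  assumes "rational_subspace S"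
  shows "0 \<in> S" "\<And>x y. x \<in> S \<Longrightarrow> y \<in> S \<Longrightarrow> x + y \<in> S" "\<And>r x. r \<in> \<rat> \<Longrightarrow> x \<in> S \<Longrightarrow> r *\<^sub>R x \<in> S"
    "\<And>x y. x \<in> S \<Longrightarrow> y \<in> S \<Longrightarrow> B x y \<in> \<rat>" "\<And>x y. x \<in> S \<Longrightarrow> y \<in> S \<Longrightarrow> x - y \<in> S"
    "\<And>x. x \<in> S \<Longrightarrow> - x \<in> S"
proof -
  show 1: "0 \<in> S" "\<And>x y. x \<in> S \<Longrightarrow> y \<in> S \<Longrightarrow> x + y \<in> S" "\<And>r x. r \<in> \<rat> \<Longrightarrow> x \<in> S \<Longrightarrow> r *\<^sub>R x \<in> S"
    "\<And>x y. x \<in> S \<Longrightarrow> y \<in> S \<Longrightarrow> B x y \<in> \<rat>"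
    using assms by (auto simp: rational_subspace_def)
  show 2: "- x \<in> S" if "x \<in> S" for x
    using 1(3)[OF _ that, of "-1"] by simp
  show "x - y \<in> S" if "x \<in> S" "y \<in> S" for x y
    using 1(2)[OF that(1) 2[OF that(2)]] by simp
qed

definition orth :: "'v set \<Rightarrow> 'v \<Rightarrow> 'v set" where
  "orth S x = {y\<in>S. B x y = 0}"

lemma rational_subspace_orth: "rational_subspace S \<Longrightarrow> rational_subspace (orth S x)"
  by (auto simp: rational_subspace_def orth_def)

text \<open>The last clause says that \<open>X\<close> spans \<open>S\<close> over the rationals.\<close>

definition diagonalizes :: "'v set \<Rightarrow> 'v set \<Rightarrow> int multiset \<Rightarrow> bool" where
  "diagonalizes X S A \<longleftrightarrow> finite X \<and> X \<subseteq> S \<and> (\<forall>x\<in>X. B x x \<noteq> 0) \<and> (\<forall>x\<in>X. \<forall>y\<in>X. x \<noteq> y \<longrightarrow> B x y = 0) \<and>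
     image_mset (\<lambda>x. B x x) (mset_set X) = image_mset real_of_int A \<and>
     (\<forall>y\<in>S. (\<forall>x\<in>X. B x y = 0) \<longrightarrow> y = 0)"

definition diagonal :: "'v set \<Rightarrow> int multiset \<Rightarrow> bool" where
  "diagonal S A \<longleftrightarrow> (\<exists>X. diagonalizes X S A)"

lemma diagonalizesD:
  assumes "diagonalizes X S A"
  shows "finite X"
    "X \<subseteq> S"
    "\<forall>x\<in>X. B x x \<noteq> 0"
    "\<forall>x\<in>X. \<forall>y\<in>X. x \<noteq> y \<longrightarrow> B x y = 0"
    "image_mset (\<lambda>x. B x x) (mset_set X) = image_mset real_of_int A"
    "\<forall>y\<in>S. (\<forall>x\<in>X. B x y = 0) \<longrightarrow> y = 0"
proof -
  note d = assms[unfolded diagonalizes_def]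
  show "finite X" by (rule d[THEN conjunct1])
  show "X \<subseteq> S" by (rule d[THEN conjunct2, THEN conjunct1])
  show "\<forall>x\<in>X. B x x \<noteq> 0" by (rule d[THEN conjunct2, THEN conjunct2, THEN conjunct1])
  show "\<forall>x\<in>X. \<forall>y\<in>X. x \<noteq> y \<longrightarrow> B x y = 0" by (rule d[THEN conjunct2, THEN conjunct2, THEN conjunct2, THEN conjunct1])
  show "image_mset (\<lambda>x. B x x) (mset_set X) = image_mset real_of_int A" by (rule d[THEN conjunct2, THEN conjunct2, THEN conjunct2, THEN conjunct2, THEN conjunct1])
  show "\<forall>y\<in>S. (\<forall>x\<in>X. B x y = 0) \<longrightarrow> y = 0" by (rule d[THEN conjunct2, THEN conjunct2, THEN conjunct2, THEN conjunct2, THEN conjunct2])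
qed

text \<open>Turns the unordered basis into a recursion that splits off one vector. Here the vector
  is some suitable one; \<open>diagonal_cancel\<close> strengthens this to every vector of the right
  norm.\<close>

lemma diagonal_add_mset:
  "diagonal S (add_mset a A) \<longleftrightarrow> a \<noteq> 0 \<and> (\<exists>x\<in>S. B x x = of_int a \<and> diagonal (orth S x) A)"
proof
  assume "diagonal S (add_mset a A)"
  then obtain X where "diagonalizes X S (add_mset a A)" unfolding diagonal_def by blast
  then have X: "finite X" "X \<subseteq> S" "\<forall>x\<in>X. B x x \<noteq> 0" "\<forall>x\<in>X. \<forall>y\<in>X. x \<noteq> y \<longrightarrow> B x y = 0"
    "image_mset (\<lambda>x. B x x) (mset_set X) = image_mset real_of_int (add_mset a A)"
    "\<forall>y\<in>S. (\<forall>x\<in>X. B x y = 0) \<longrightarrow> y = 0"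
    by (rule diagonalizesD)+
  have "real_of_int a \<in># image_mset (\<lambda>x. B x x) (mset_set X)" unfolding X(5) by simp
  then obtain x where x: "x \<in> X" "B x x = of_int a" using X(1) by (auto simp del: image_mset_add_mset)
  have "mset_set X = add_mset x (mset_set (X - {x}))"
    using X(1) x(1) by (rule mset_set.remove)
  then have "image_mset (\<lambda>x. B x x) (mset_set (X - {x})) = image_mset real_of_int A"
    using X(5) x(2) by simp
  moreover have "y = 0" if "y \<in> orth S x" "\<forall>z\<in>X - {x}. B z y = 0" for y
    using that X(6) unfolding orth_def by blast
  moreover have "X - {x} \<subseteq> orth S x" using X(2,4) x(1) by (auto simp: orth_def)
  ultimately have "diagonalizes (X - {x}) (orth S x) A"
    unfolding diagonalizes_def using X(1,3,4) by simp
  then show "a \<noteq> 0 \<and> (\<exists>x\<in>S. B x x = of_int a \<and> diagonal (orth S x) A)"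
  proof (intro conjI bexI[of _ x])
    show "a \<noteq> 0" using X(3) x by fastforce
    show "diagonal (orth S x) A" using \<open>diagonalizes (X - {x}) (orth S x) A\<close> unfolding diagonal_def ..
  qed (use X(2) x in auto)
next
  assume "a \<noteq> 0 \<and> (\<exists>x\<in>S. B x x = of_int a \<and> diagonal (orth S x) A)"
  then obtain x X where x: "a \<noteq> 0" "x \<in> S" "B x x = of_int a" and X: "diagonalizes X (orth S x) A"
    unfolding diagonal_def by blast
  have xX: "y \<in> S" "B x y = 0" "B y x = 0" if "y \<in> X" for y
    using diagonalizesD(2)[OF X] that sym[of x y] unfolding orth_def by auto
  have "x \<notin> X" using xX(2)[of x] x by auto
  have "diagonalizes (insert x X) S (add_mset a A)" unfolding diagonalizes_def
  proof (intro conjI)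
    show "image_mset (\<lambda>x. B x x) (mset_set (insert x X)) = image_mset real_of_int (add_mset a A)"
      using diagonalizesD(1,5)[OF X] x \<open>x \<notin> X\<close> by simp
    show "\<forall>y\<in>S. (\<forall>x\<in>insert x X. B x y = 0) \<longrightarrow> y = 0"
      using diagonalizesD(6)[OF X] unfolding orth_def by simp
    show "finite (insert x X)" using diagonalizesD(1)[OF X] by simp
    show "insert x X \<subseteq> S" using x xX by blast
    show "\<forall>y\<in>insert x X. B y y \<noteq> 0" using diagonalizesD(3)[OF X] x by simp
    show "\<forall>y\<in>insert x X. \<forall>z\<in>insert x X. y \<noteq> z \<longrightarrow> B y z = 0"
      using diagonalizesD(4)[OF X] xX by blast
  qed
  then show "diagonal S (add_mset a A)" unfolding diagonal_def by blast
qed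

lemma diagonal_nonzero: "diagonal S A \<Longrightarrow> 0 \<notin># A"
  by (induction A arbitrary: S) (auto simp: diagonal_add_mset)

lemma diagonal_scale:
  fixes r :: real
  assumes S: "rational_subspace S" and d: "diagonal S (add_mset a A)"
    and r: "r \<in> \<rat>" "r \<noteq> 0" "of_int a' = r\<^sup>2 * of_int a"
  shows "diagonal S (add_mset a' A)"
proof -
  obtain x where x: "x \<in> S" "B x x = of_int a" "diagonal (orth S x) A" and "a \<noteq> 0"
    using d by (auto simp: diagonal_add_mset)
  have "orth S (r *\<^sub>R x) = orth S x" using r(2) by (auto simp: orth_def)
  moreover have "B (r *\<^sub>R x) (r *\<^sub>R x) = of_int a'" using x r by (simp add: power2_eq_square)
  moreover have "a' \<noteq> 0" using r \<open>a \<noteq> 0\<close> by (intro notI) simp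
  ultimately show ?thesis using x(3) rational_subspaceD(3)[OF S r(1) x(1)]
    unfolding diagonal_add_mset by (intro conjI bexI[of _ "r *\<^sub>R x"]) simp_all
qed

text \<open>A change of basis inside the plane of two basis vectors. As the determinant is nonzero,
  the new pair has the same orthogonal complement, so the rest of the basis can stay.\<close>

lemma diagonal_pair:
  fixes \<alpha> \<beta> \<gamma> \<delta> :: real
  assumes S: "rational_subspace S" and d: "diagonal S (add_mset a (add_mset b A))"
    and r: "\<alpha> \<in> \<rat>" "\<beta> \<in> \<rat>" "\<gamma> \<in> \<rat>" "\<delta> \<in> \<rat>" "\<alpha> * \<delta> - \<beta> * \<gamma> \<noteq> 0"
    and o: "\<alpha> * \<gamma> * of_int a + \<beta> * \<delta> * of_int b = 0"
    and n: "of_int a' = \<alpha>\<^sup>2 * of_int a + \<beta>\<^sup>2 * of_int b" "of_int b' = \<gamma>\<^sup>2 * of_int a + \<delta>\<^sup>2 * of_int b"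
    and nz: "a' \<noteq> 0" "b' \<noteq> 0"
  shows "diagonal S (add_mset a' (add_mset b' A))"
proof -
  obtain x y where x: "x \<in> S" "B x x = of_int a" and y: "y \<in> S" "B x y = 0" "B y y = of_int b"
    and A: "diagonal (orth (orth S x) y) A"
    using d by (auto simp: diagonal_add_mset orth_def)
  have yx: "B y x = 0" using y(2) sym by simp
  define u v where "u = \<alpha> *\<^sub>R x + \<beta> *\<^sub>R y" and "v = \<gamma> *\<^sub>R x + \<delta> *\<^sub>R y"
  have uv: "u \<in> S" "v \<in> S" using x y r rational_subspaceD[OF S] by (auto simp: u_def v_def)
  have "B u u = of_int a'" "B v v = of_int b'"
    using x y yx n by (simp_all add: u_def v_def algebra_simps power2_eq_square)
  moreover have "B u v = 0"
    using x y yx o by (simp add: u_def v_def algebra_simps)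
  moreover have "orth (orth S u) v = orth (orth S x) y"
  proof -
    have "(\<alpha> * s + \<beta> * t = 0 \<and> \<gamma> * s + \<delta> * t = 0) \<longleftrightarrow> (s = 0 \<and> t = 0)" for s t
    proof
      assume e: "\<alpha> * s + \<beta> * t = 0 \<and> \<gamma> * s + \<delta> * t = 0"
      have "(\<alpha> * \<delta> - \<beta> * \<gamma>) * s = \<delta> * (\<alpha> * s + \<beta> * t) - \<beta> * (\<gamma> * s + \<delta> * t)"
        "(\<alpha> * \<delta> - \<beta> * \<gamma>) * t = \<alpha> * (\<gamma> * s + \<delta> * t) - \<gamma> * (\<alpha> * s + \<beta> * t)"
        by (simp_all add: algebra_simps)
      then have "(\<alpha> * \<delta> - \<beta> * \<gamma>) * s = 0" "(\<alpha> * \<delta> - \<beta> * \<gamma>) * t = 0"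
        by (simp_all only: e mult_zero_right diff_self)
      then show "s = 0 \<and> t = 0" using r(5) by (simp only: mult_eq_0_iff) simp
    qed simp
    then show ?thesis by (auto simp: orth_def u_def v_def)
  qed
  ultimately show ?thesis using uv A nz unfolding diagonal_add_mset
    by (intro conjI bexI[of _ u] bexI[of _ v]) (simp_all add: orth_def)
qed

lemma diag_eq_diagonal:
  assumes "diag_eq A A'" "rational_subspace S" shows "diagonal S A \<longleftrightarrow> diagonal S A'"
  using assms(1)
proof (induction rule: diag_eq.induct)
  case (square a c A)
  show ?case
  proof
    assume "diagonal S (add_mset a A)"
    then show "diagonal S (add_mset (a * c\<^sup>2) A)"
      by (rule diagonal_scale[OF assms(2), where r = "of_int c"]) (use square in auto)
  next
    assume "diagonal S (add_mset (a * c\<^sup>2) A)"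
    then show "diagonal S (add_mset a A)"
      by (rule diagonal_scale[OF assms(2), where r = "1 / of_int c"]) (use square in \<open>auto simp: power_divide\<close>)
  qed
next
  case (plus a b A)
  have ab: "real_of_int a + real_of_int b \<noteq> 0" using plus by (metis of_int_0_eq_iff of_int_add)
  show ?case
  proof
    assume "diagonal S (add_mset a (add_mset b A))"
    \<comment> \<open>The new vectors are x + y and b x - a y; the second has norm
      \<open>a * b\<^sup>2 + a\<^sup>2 * b\<close>, which is \<open>a * b * (a + b)\<close>.\<close>
    then show "diagonal S (add_mset (a + b) (add_mset (a * b * (a + b)) A))"
    proof (rule diagonal_pair[OF assms(2), where \<alpha> = 1 and \<beta> = 1 and \<gamma> = "of_int b" and \<delta> = "- of_int a"])
      show "1 * - real_of_int a - 1 * real_of_int b \<noteq> 0"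
      proof
        assume "1 * - real_of_int a - 1 * real_of_int b = 0"
        then show False using ab by linarith
      qed
      show "real_of_int (a * b * (a + b)) = (real_of_int b)\<^sup>2 * real_of_int a + (- real_of_int a)\<^sup>2 * real_of_int b"
        by (simp add: algebra_simps power2_eq_square)
    qed (use plus in simp_all)
  next
    assume d: "diagonal S (add_mset (a + b) (add_mset (a * b * (a + b)) A))"
    define s where "s = real_of_int (a + b)"
    have s: "s \<noteq> 0" "s \<in> \<rat>" "real_of_int a = s - real_of_int b"
      using ab unfolding s_def by simp_all
    have n: "real_of_int (a + b) = s" "real_of_int (a * b * (a + b)) = (s - real_of_int b) * real_of_int b * s"
      unfolding s(3)[symmetric] by (simp_all add: s_def)
    \<comment> \<open>The coefficients are those of the inverse of the matrix with rows (1, b's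
      partner 1) and (b, - a), whose determinant is - s.\<close>
    show "diagonal S (add_mset a (add_mset b A))"
    proof (rule diagonal_pair[OF assms(2) d, where \<alpha> = "of_int a / s" and \<beta> = "1 / s"
          and \<gamma> = "of_int b / s" and \<delta> = "- 1 / s"])
      show "of_int a / s * (- 1 / s) - 1 / s * (of_int b / s) \<noteq> 0"
        unfolding s(3) using s(1) by (simp add: field_simps)
      show "of_int a / s * (of_int b / s) * of_int (a + b) + 1 / s * (- 1 / s) * of_int (a * b * (a + b)) = 0"
        unfolding n s(3) using s(1) by (simp add: field_simps)
      show "of_int a = (of_int a / s)\<^sup>2 * of_int (a + b) + (1 / s)\<^sup>2 * of_int (a * b * (a + b))"
        unfolding n s(3) using s(1) by (simp add: field_simps power2_eq_square)
      show "of_int b = (of_int b / s)\<^sup>2 * of_int (a + b) + (- 1 / s)\<^sup>2 * of_int (a * b * (a + b))"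
        unfolding n s(3) using s(1) by (simp add: field_simps power2_eq_square)
    qed (use plus s in auto)
  qed
next
  case (hyperbolic a A)
  define r where "r = real_of_int a"
  have r: "r \<noteq> 0" "r \<in> \<rat>" "real_of_int a = r" "real_of_int (- a) = - r" using hyperbolic unfolding r_def by auto
  show ?case
  proof
    assume d: "diagonal S (add_mset a (add_mset (- a) A))"
    \<comment> \<open>Here \<alpha> + \<beta> = 1 and \<alpha> - \<beta> = 1 / r, so that the norm
      \<open>r * (\<alpha>\<^sup>2 - \<beta>\<^sup>2)\<close> equals 1.\<close>
    show "diagonal S (add_mset 1 (add_mset (- 1) A))"
    proof (rule diagonal_pair[OF assms(2) d, where \<alpha> = "(1 + 1 / r) / 2" and \<beta> = "(1 - 1 / r) / 2"
            and \<gamma> = "(1 - 1 / r) / 2" and \<delta> = "(1 + 1 / r) / 2"])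
    qed (use hyperbolic r in \<open>simp_all add: field_simps power2_eq_square\<close>)
  next
    assume d: "diagonal S (add_mset 1 (add_mset (- 1) A))"
    \<comment> \<open>Conversely \<alpha> + \<beta> = r and \<alpha> - \<beta> = 1, so that
      \<open>\<alpha>\<^sup>2 - \<beta>\<^sup>2\<close> equals r.\<close>
    show "diagonal S (add_mset a (add_mset (- a) A))"
    proof (rule diagonal_pair[OF assms(2) d, where \<alpha> = "(r + 1) / 2" and \<beta> = "(r - 1) / 2"
            and \<gamma> = "(r - 1) / 2" and \<delta> = "(r + 1) / 2"])
    qed (use hyperbolic r in \<open>simp_all add: field_simps power2_eq_square\<close>)
  qed
qed auto

section \<open>Reflections and Witt cancellation\<close>

definition reflection :: "'v \<Rightarrow> 'v \<Rightarrow> 'v" where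
  "reflection d y = y - (2 * B d y / B d d) *\<^sub>R d"

lemma reflection_isometry: "B d d \<noteq> 0 \<Longrightarrow> B (reflection d x) (reflection d y) = B x y"
  by (simp add: reflection_def sym[of x d] field_simps)

lemma reflection_involution:
  assumes "B d d \<noteq> 0" shows "reflection d (reflection d x) = x"
proof -
  have "B d (reflection d x) = - B d x" using assms by (simp add: reflection_def)
  then show ?thesis unfolding reflection_def[of d "reflection d x"] by (simp add: reflection_def)
qed

lemma reflection_mem: "rational_subspace S \<Longrightarrow> d \<in> S \<Longrightarrow> x \<in> S \<Longrightarrow> reflection d x \<in> S"
  unfolding reflection_def by (intro rational_subspaceD(3,5) Rats_divide Rats_mult) (auto intro: rational_subspaceD)

lemma diagonal_isometry:
  assumes "diagonal S A" "\<And>x y. B (f x) (f y) = B x y" "\<And>x. x \<in> T \<Longrightarrow> f x \<in> S" "\<And>x. x \<in> S \<Longrightarrow> f x \<in> T"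
    "\<And>x. f (f x) = x" "f 0 = 0"
  shows "diagonal T A"
proof -
  obtain X where X: "diagonalizes X S A" using assms(1) by (auto simp: diagonal_def)
  have inj: "inj_on f X" by (metis assms(5) inj_onI)
  have "image_mset (\<lambda>x. B x x) (mset_set (f ` X)) = image_mset (\<lambda>x. B x x) (mset_set X)"
    by (simp add: image_mset_mset_set[OF inj, symmetric] multiset.map_comp comp_def assms(2))
  moreover have "y = 0" if "y \<in> T" "\<forall>x\<in>X. B (f x) y = 0" for y
  proof -
    have "\<forall>x\<in>X. B x (f y) = 0" using that(2) assms(2,5) by metis
    then have "f y = 0" using diagonalizesD(6)[OF X] assms(3)[OF that(1)] by blast
    then show ?thesis using assms(5,6) by metis
  qed
  ultimately have "diagonalizes (f ` X) T A"
    using diagonalizesD[OF X] assms(2-5) unfolding diagonalizes_def by auto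
  then show ?thesis by (auto simp: diagonal_def)
qed

text \<open>Witt cancellation. For x and y of the same norm a, the norms of x - y and x + y add up
  to 4 a, so one of the two is anisotropic. The reflection in it takes x to y or - y and exchanges
  the orthogonal complements.\<close>

lemma diagonal_cancel:
  assumes S: "rational_subspace S" and d: "diagonal S (add_mset a A)" and x: "x \<in> S" "B x x = of_int a"
  shows "diagonal (orth S x) A"
proof -
  obtain y where y: "y \<in> S" "B y y = of_int a" "diagonal (orth S y) A" and a: "a \<noteq> 0"
    using d by (auto simp: diagonal_add_mset)
  have "B (x - y) (x - y) + B (x + y) (x + y) = 4 * of_int a"
    using x y sym[of x y] by simp
  then have "B (x - y) (x - y) \<noteq> 0 \<or> B (x + y) (x + y) \<noteq> 0" using a by auto
  then obtain s where s: "s = 1 \<or> s = -1" "B (x - s *\<^sub>R y) (x - s *\<^sub>R y) \<noteq> 0"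
  proof
    assume "B (x - y) (x - y) \<noteq> 0" then show thesis using that[of 1] by simp
  next
    assume "B (x + y) (x + y) \<noteq> 0" then show thesis using that[of "-1"] by simp
  qed
  define e where "e = x - s *\<^sub>R y"
  have e: "e \<in> S" "B e e \<noteq> 0"
    using s x y rational_subspaceD[OF S] by (auto simp: e_def)
  have "2 * B e x = B e e" using s x y sym[of x y] by (auto simp: e_def)
  then have rx: "reflection e x = s *\<^sub>R y" using e by (simp add: reflection_def) (simp add: e_def)
  have ry: "B x (reflection e z) = s * B y z" for z
    using reflection_isometry[OF e(2), of "s *\<^sub>R y" z] reflection_involution[OF e(2), of x] rx
    by simp
  have "s \<noteq> 0" using s by auto
  show ?thesis
  proof (rule diagonal_isometry[OF y(3)])
    fix z assume "z \<in> orth S x"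
    then have z: "z \<in> S" "B x z = 0" by (auto simp: orth_def)
    then have "s * B y (reflection e z) = 0"
      using ry[of "reflection e z"] reflection_involution[OF e(2)] by simp
    then show "reflection e z \<in> orth S y"
      using z \<open>s \<noteq> 0\<close> reflection_mem[OF S e(1)] by (auto simp: orth_def)
  next
    fix z assume "z \<in> orth S y"
    then show "reflection e z \<in> orth S x"
      using ry reflection_mem[OF S e(1)] by (auto simp: orth_def)
  qed (use e in \<open>auto simp: reflection_isometry reflection_involution\<close>, simp add: reflection_def)
qed

text \<open>\<open>S\<close> is the rational space of the lattice \<open>L\<close>; neither has to span the type, and the form may be
  degenerate outside \<open>S\<close>.\<close>

definition unimodular_in :: "'v set \<Rightarrow> 'v set \<Rightarrow> bool" where
  "unimodular_in S L \<longleftrightarrow> 0 \<in> L \<and> L \<subseteq> S \<and> (\<forall>x\<in>L. \<forall>y\<in>L. x - y \<in> L) \<and> (\<forall>x\<in>S. \<exists>k>0. of_int k *\<^sub>R x \<in> L) \<and>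
     (\<forall>x\<in>L. \<forall>y\<in>L. B x y \<in> \<int>) \<and> (\<forall>x\<in>S. (\<forall>y\<in>L. B x y \<in> \<int>) \<longrightarrow> x \<in> L)"

lemma unimodular_inD:
  assumes "unimodular_in S L"
  shows "0 \<in> L" "\<And>x. x \<in> L \<Longrightarrow> x \<in> S" "\<And>x y. x \<in> L \<Longrightarrow> y \<in> L \<Longrightarrow> x - y \<in> L"
    "\<And>x. x \<in> S \<Longrightarrow> \<exists>k>0. of_int k *\<^sub>R x \<in> L" "\<And>x y. x \<in> L \<Longrightarrow> y \<in> L \<Longrightarrow> B x y \<in> \<int>"
    "\<And>x. x \<in> S \<Longrightarrow> (\<And>y. y \<in> L \<Longrightarrow> B x y \<in> \<int>) \<Longrightarrow> x \<in> L"
    "\<And>x. x \<in> L \<Longrightarrow> - x \<in> L" "\<And>x y. x \<in> L \<Longrightarrow> y \<in> L \<Longrightarrow> x + y \<in> L"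
    "\<And>k x. x \<in> L \<Longrightarrow> of_int k *\<^sub>R x \<in> L"
proof -
  show 1: "0 \<in> L" "\<And>x. x \<in> L \<Longrightarrow> x \<in> S" "\<And>x y. x \<in> L \<Longrightarrow> y \<in> L \<Longrightarrow> x - y \<in> L"
    "\<And>x. x \<in> S \<Longrightarrow> \<exists>k>0. of_int k *\<^sub>R x \<in> L" "\<And>x y. x \<in> L \<Longrightarrow> y \<in> L \<Longrightarrow> B x y \<in> \<int>"
    "\<And>x. x \<in> S \<Longrightarrow> (\<And>y. y \<in> L \<Longrightarrow> B x y \<in> \<int>) \<Longrightarrow> x \<in> L"
    using assms by (auto simp: unimodular_in_def)
  show 2: "- x \<in> L" if "x \<in> L" for x using 1(3)[OF 1(1) that] by simp
  show 3: "x + y \<in> L" if "x \<in> L" "y \<in> L" for x y using 1(3)[OF that(1) 2[OF that(2)]] by simp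
  have n: "real k *\<^sub>R x \<in> L" if x: "x \<in> L" for k :: nat and x
  proof (induction k)
    case (Suc k)
    have "real (Suc k) *\<^sub>R x = x + real k *\<^sub>R x" by (simp add: scaleR_left_distrib)
    then show ?case using 3[OF x Suc] by (simp only:)
  qed (simp add: 1(1))
  show "of_int k *\<^sub>R x \<in> L" if "x \<in> L" for k x
  proof (cases "k \<ge> 0")
    case True
    then have "real_of_int k = real (nat k)" by simp
    then show ?thesis using n[OF that] by (simp only:)
  next
    case False
    then have "real_of_int k *\<^sub>R x = - (real (nat (- k)) *\<^sub>R x)" by simp
    then show ?thesis using 2[OF n[OF that]] by (simp only:)
  qed
qed

text \<open>A vector of \<open>M\<close> pairs integrally with \<open>L\<close>, hence lies in the
  dual of \<open>L\<close>, which is \<open>L\<close>. Equality with a unimodular lattice is thus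
  reduced to one inclusion.\<close>

lemma unimodular_in_maximal:
  assumes "unimodular_in S L" "L \<subseteq> M" "M \<subseteq> S" "\<And>x y. x \<in> M \<Longrightarrow> y \<in> M \<Longrightarrow> B x y \<in> \<int>"
  shows "L = M"
  using assms unimodular_inD(6)[OF assms(1)] by blast

section \<open>Kneser neighbours\<close>

text \<open>Kneser's neighbour, parametrized by the vector \<open>w\<close> that is adjoined. The
  prime p does not occur: it enters through the condition that \<open>p w\<close> but not
  \<open>w\<close> lies in \<open>L\<close>. The set depends on \<open>w\<close> itself, not just on
  its class modulo \<open>L\<close>; see \<open>neighbour_cong\<close>.\<close>

definition neighbour :: "'v set \<Rightarrow> 'v \<Rightarrow> 'v set" where
  "neighbour L w = {x + of_int j *\<^sub>R w | x j. x \<in> L \<and> B x w \<in> \<int>}"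

lemma neighbour_mem: "x \<in> L \<Longrightarrow> B x w \<in> \<int> \<Longrightarrow> x \<in> neighbour L w"
  unfolding neighbour_def by (rule CollectI, rule exI[of _ x], rule exI[of _ 0]) simp

lemma neighbour_self: "0 \<in> L \<Longrightarrow> w \<in> neighbour L w"
  unfolding neighbour_def by (rule CollectI, rule exI[of _ 0], rule exI[of _ 1]) simp

text \<open>Some \<open>s1\<close> in \<open>L\<close> satisfies \<open>B s1 w\<close> = 1 / p
  modulo integers. Subtracting multiples of \<open>s1\<close> moves any vector of \<open>L\<close>
  into the sublattice integral with \<open>w\<close>, and subtracting a multiple of \<open>w\<close>
  makes a vector dual to the neighbour integral on \<open>s1\<close>. Together they show that this
  corrected vector is dual to \<open>L\<close>, so it lies in \<open>L\<close>.\<close>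

lemma neighbour_unimodular:
  assumes S: "rational_subspace S" and L: "unimodular_in S L" and p: "prime p"
    and w: "w \<in> S" "of_int p *\<^sub>R w \<in> L" "w \<notin> L" "B w w \<in> \<int>"
  shows "unimodular_in S (neighbour L w)"
proof -
  note LD = unimodular_inD[OF L] and SD = rational_subspaceD[OF S]
  have p0: "p > 0" using p prime_gt_0_int by blast
  have pB: "of_int p * B x w \<in> \<int>" if "x \<in> L" for x
    using LD(5)[OF that w(2)] by simp
  obtain s0 where s0: "s0 \<in> L" "B w s0 \<notin> \<int>" using LD(6)[OF w(1)] w(3) by blast
  obtain c where c: "of_int p * B s0 w = of_int c" using pB[OF s0(1)] by (auto elim: Ints_cases)
  have "\<not> p dvd c"
  proof
    assume "p dvd c"
    then obtain k where "c = p * k" by blast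
    then have "B s0 w = of_int k" using c p0 by simp
    then show False using s0(2) sym by auto
  qed
  then have "coprime c p" using prime_imp_coprime[OF p] by (simp add: coprime_commute)
  then obtain c' where c': "[c * c' = 1] (mod p)" using cong_solve_coprime_int by blast
  define s1 where "s1 = of_int c' *\<^sub>R s0"
  have s1: "s1 \<in> L" using LD(9) s0 by (simp add: s1_def)
  have "p dvd c * c' - 1" using c' by (simp add: cong_iff_dvd_diff)
  then obtain t where "c * c' - 1 = p * t" by (rule dvdE)
  then have t: "c * c' = 1 + p * t" by simp
  have s1w: "B s1 w = 1 / of_int p + of_int t"
  proof -
    have "of_int p * B s1 w = of_int (c * c')" using c by (simp add: s1_def algebra_simps)
    also have "real_of_int (c * c') = 1 + of_int p * of_int t" by (simp only: t of_int_add of_int_mult of_int_1)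
    finally show ?thesis using p0 by (simp add: field_simps)
  qed
  have closed: "x - y \<in> neighbour L w" if xy: "x \<in> neighbour L w" "y \<in> neighbour L w" for x y
  proof -
    obtain x1 i y1 j where x1: "x = x1 + of_int i *\<^sub>R w" "x1 \<in> L" "B x1 w \<in> \<int>"
      and y1: "y = y1 + of_int j *\<^sub>R w" "y1 \<in> L" "B y1 w \<in> \<int>"
      using xy unfolding neighbour_def by blast
    then have "x - y = (x1 - y1) + of_int (i - j) *\<^sub>R w" by (simp add: algebra_simps)
    then show ?thesis using x1 y1 LD(3) unfolding neighbour_def by fastforce
  qed
  have integral: "B x y \<in> \<int>" if xy: "x \<in> neighbour L w" "y \<in> neighbour L w" for x y
  proof -
    obtain x1 i y1 j where x1: "x = x1 + of_int i *\<^sub>R w" "x1 \<in> L" "B x1 w \<in> \<int>"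
      and y1: "y = y1 + of_int j *\<^sub>R w" "y1 \<in> L" "B y1 w \<in> \<int>"
      using xy unfolding neighbour_def by blast
    then show ?thesis using LD(5)[OF x1(2) y1(2)] w(4) sym[of w y1] by (auto intro!: Ints_add Ints_mult)
  qed
  show ?thesis unfolding unimodular_in_def
  proof (intro conjI ballI impI)
    show "0 \<in> neighbour L w" using LD(1) by (rule neighbour_mem) simp
    show "neighbour L w \<subseteq> S" using LD(2) w(1) SD unfolding neighbour_def by auto
    show "\<exists>k>0. of_int k *\<^sub>R x \<in> neighbour L w" if x: "x \<in> S" for x
    proof -
      obtain k where k: "k > 0" "of_int k *\<^sub>R x \<in> L" using LD(4)[OF x] by blast
      have "of_int p *\<^sub>R (of_int k *\<^sub>R x) \<in> neighbour L w"
        using LD(9)[OF k(2)] pB[OF k(2)] by (intro neighbour_mem) (auto simp: mult.assoc)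
      then show ?thesis using k p0 by (intro exI[of _ "p * k"]) auto
    qed
    show "x \<in> neighbour L w" if x: "x \<in> S" "\<forall>y\<in>neighbour L w. B x y \<in> \<int>" for x
    proof -
      have xL: "B x y \<in> \<int>" if "y \<in> L" "B y w \<in> \<int>" for y using neighbour_mem that x(2) by blast
      have xw: "B x w \<in> \<int>" using neighbour_self LD(1) x(2) by blast
      have "B x (of_int p *\<^sub>R s1) \<in> \<int>" using pB s1 LD(9) by (intro xL) auto
      then obtain j where j: "of_int p * B x s1 = of_int j" by (auto elim: Ints_cases)
      define l where "l = x - of_int j *\<^sub>R w"
      have lS: "l \<in> S" using x(1) w(1) SD by (auto simp: l_def)
      have "B x s1 = of_int j / of_int p" using j p0 by (simp add: field_simps)
      then have ls: "B l s1 = - of_int j * of_int t" using s1w sym[of w s1] by (simp add: l_def algebra_simps)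
      have "B l y \<in> \<int>" if y: "y \<in> L" for y
      proof -
        obtain d where d: "of_int p * B y w = of_int d" using pB[OF y] by (auto elim: Ints_cases)
        define y1 where "y1 = y - of_int d *\<^sub>R s1"
        have y1L: "y1 \<in> L" using LD y s1 by (auto simp: y1_def)
        have "B y w = of_int d / of_int p" using d p0 by (simp add: field_simps)
        then have "B y1 w = - of_int d * of_int t" using s1w by (simp add: y1_def algebra_simps)
        then have y1w: "B y1 w \<in> \<int>" by simp
        have "B l y = B x y1 - of_int j * B y1 w + of_int d * B l s1"
          using sym[of w y] sym[of w s1] by (simp add: l_def y1_def algebra_simps)
        then show ?thesis using xL[OF y1L y1w] y1w ls by auto
      qed
      then have lL: "l \<in> L" using LD(6)[OF lS] by blast
      have "B l w \<in> \<int>" using xw w(4) by (auto simp: l_def)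
      then have "l + of_int j *\<^sub>R w \<in> neighbour L w" using lL unfolding neighbour_def by blast
      then show ?thesis by (simp add: l_def)
    qed
  qed (use closed integral in auto)
qed

definition even_in :: "'v set \<Rightarrow> bool" where
  "even_in L \<longleftrightarrow> (\<forall>x\<in>L. B x x / 2 \<in> \<int>)"

text \<open>If k t lies in the lattice, neighbours in the directions j t strip the prime factors
  from k until t itself is reached. \<open>P\<close> is an invariant of the chain; the lemma serves
  both for enlarging lattices and for carrying an isometry along.\<close>

lemma unimodular_generate:
  assumes step: "\<And>L p j. P L \<Longrightarrow> unimodular_in S L \<Longrightarrow> prime p \<Longrightarrow> of_int p *\<^sub>R (of_int j *\<^sub>R t) \<in> L \<Longrightarrow>
      of_int j *\<^sub>R t \<notin> L \<Longrightarrow> P (neighbour L (of_int j *\<^sub>R t)) \<and> unimodular_in S (neighbour L (of_int j *\<^sub>R t))"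
    and L: "P L" "unimodular_in S L" and t: "t \<in> S"
  shows "\<exists>L'. P L' \<and> unimodular_in S L' \<and> t \<in> L'"
proof -
  have *: "\<exists>L'. P L' \<and> unimodular_in S L' \<and> t \<in> L'"
    if "P L" "unimodular_in S L" "of_int (int k) *\<^sub>R t \<in> L" "k > 0" for k L
    using that
  proof (induction k arbitrary: L rule: less_induct)
    case (less k L)
    show ?case
    proof (cases "k = 1")
      case True
      then show ?thesis using less.prems by auto
    next
      case False
      then obtain p where p: "prime p" "p dvd k" using prime_factor_nat by blast
      then obtain j where j: "k = p * j" by (elim dvdE)
      have j': "j < k" "j > 0" using j less.prems(4) prime_gt_1_nat[OF p(1)] by auto
      have pw: "of_int (int p) *\<^sub>R (of_int (int j) *\<^sub>R t) \<in> L" using less.prems(3) by (simp add: j)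
      show ?thesis
      proof (cases "of_int (int j) *\<^sub>R t \<in> L")
        case True
        then show ?thesis by (intro less.IH[OF j'(1) less.prems(1,2) _ j'(2)])
      next
        case False
        have "prime (int p)" using p by simp
        from step[OF less.prems(1,2) this pw False]
        show ?thesis
          by (intro less.IH[OF j'(1) _ _ neighbour_self j'(2)])
            (auto intro: unimodular_inD(1)[OF less.prems(2)])
      qed
    qed
  qed
  obtain k :: int where "k > 0" "of_int k *\<^sub>R t \<in> L" using unimodular_inD(4)[OF L(2) t] by blast
  then show ?thesis using *[OF L, of "nat k"] by simp
qed

lemma unimodular_enlarge:
  assumes S: "rational_subspace S" and L: "unimodular_in S L" and t: "t \<in> S" "B t t \<in> \<int>"
  shows "\<exists>L'. unimodular_in S L' \<and> t \<in> L' \<and> (\<forall>x\<in>L. B x t \<in> \<int> \<longrightarrow> x \<in> L')"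
proof -
  define P where "P M \<longleftrightarrow> (\<forall>x\<in>L. B x t \<in> \<int> \<longrightarrow> x \<in> M)" for M
  have "\<exists>L'. P L' \<and> unimodular_in S L' \<and> t \<in> L'"
  proof (rule unimodular_generate[OF _ _ L t(1)])
    fix M p j assume M: "P M" "unimodular_in S M" "prime p" "of_int p *\<^sub>R (of_int j *\<^sub>R t) \<in> M" "of_int j *\<^sub>R t \<notin> M"
    show "P (neighbour M (of_int j *\<^sub>R t)) \<and> unimodular_in S (neighbour M (of_int j *\<^sub>R t))"
    proof
      show "P (neighbour M (of_int j *\<^sub>R t))"
        using M(1) unfolding P_def by (auto intro!: neighbour_mem)
      show "unimodular_in S (neighbour M (of_int j *\<^sub>R t))"
        using t M by (intro neighbour_unimodular[OF S M(2,3)]) (auto intro: rational_subspaceD[OF S])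
    qed
  qed (simp add: P_def)
  then obtain L' where "P L'" "unimodular_in S L'" "t \<in> L'" by blast
  then show ?thesis by (intro exI[of _ L']) (simp add: P_def)
qed

text \<open>Puts a whole orthogonal basis with integral norms into a unimodular lattice. A vector
  adjoined earlier is not lost, since it is orthogonal, hence integral, to the new one.\<close>

lemma unimodular_enlarge_orthogonal:
  assumes S: "rational_subspace S" and L: "unimodular_in S L" and X: "finite X" "X \<subseteq> S"
    "\<And>x. x \<in> X \<Longrightarrow> B x x \<in> \<int>" "\<And>x y. x \<in> X \<Longrightarrow> y \<in> X \<Longrightarrow> x \<noteq> y \<Longrightarrow> B x y = 0"
  shows "\<exists>L'. unimodular_in S L' \<and> X \<subseteq> L'"
  using X
proof (induction X)
  case empty
  then show ?case using L by auto
next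
  case (insert t X)
  then obtain L1 where L1: "unimodular_in S L1" "X \<subseteq> L1" by auto
  obtain L2 where L2: "unimodular_in S L2" "t \<in> L2" "\<forall>x\<in>L1. B x t \<in> \<int> \<longrightarrow> x \<in> L2"
    using unimodular_enlarge[OF S L1(1), of t] insert.prems by auto
  have "x \<in> L2" if "x \<in> X" for x
  proof -
    have "B x t = 0" using insert.hyps(2) insert.prems(3)[of x t] that by auto
    then show ?thesis using L1(2) L2(3) that by auto
  qed
  then show ?case using L2 by auto
qed

lemma orth_sum_expand:
  assumes S: "rational_subspace S" and d: "diagonalizes X S A" and y: "y \<in> S"
  shows "y = (\<Sum>x\<in>X. (B x y / B x x) *\<^sub>R x)"
proof -
  note D = diagonalizesD[OF d]
  have mem: "(\<Sum>x\<in>Y. (B x y / B x x) *\<^sub>R x) \<in> S" if "finite Y" "Y \<subseteq> X" for Y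
    using that
  proof (induction Y)
    case (insert x Y)
    have "x \<in> S" using insert D(2) by auto
    then have "(B x y / B x x) *\<^sub>R x \<in> S" using y by (intro rational_subspaceD(3)[OF S] Rats_divide rational_subspaceD(4)[OF S])
    then show ?case using insert by (auto intro: rational_subspaceD[OF S])
  qed (use rational_subspaceD[OF S] in simp)
  have "B z (y - (\<Sum>x\<in>X. (B x y / B x x) *\<^sub>R x)) = 0" if z: "z \<in> X" for z
  proof -
    have "B z (\<Sum>x\<in>X. (B x y / B x x) *\<^sub>R x) = (\<Sum>x\<in>X. (B x y / B x x) * B z x)"
      by (simp add: form_sum_right)
    also have "\<dots> = (\<Sum>x\<in>X. if x = z then B z y else 0)"
      using D(3,4) z by (intro sum.cong) auto
    also have "\<dots> = B z y" using z D(1) by simp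
    finally show ?thesis by simp
  qed
  moreover have "y - (\<Sum>x\<in>X. (B x y / B x x) *\<^sub>R x) \<in> S"
    using y mem[OF D(1)] rational_subspaceD[OF S] by simp
  ultimately have "y - (\<Sum>x\<in>X. (B x y / B x x) *\<^sub>R x) = 0" using D(6) by blast
  then show ?thesis by (simp only: right_minus_eq)
qed

end

section \<open>Unimodular lattices and diagonal forms\<close>

context symmetric_form
begin

lemma diagonalizes_remove:
  assumes "diagonalizes X S C" "t \<in> X"
  shows "image_mset (\<lambda>x. B x x) (mset_set X) = add_mset (B t t) (image_mset (\<lambda>x. B x x) (mset_set (X - {t})))"
  using mset_set.remove[OF diagonalizesD(1)[OF assms(1)] assms(2)] by simp

text \<open>The witness is the product of the norms of \<open>Y\<close>. It clears all denominators
  and is prime to p, so this part of the norm of \<open>y\<close> is p-integral.\<close>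

lemma unimodular_integral_part:
  assumes S: "rational_subspace S" and L: "unimodular_in S L" and d: "diagonalizes X S C" and X: "X \<subseteq> L"
    and p: "prime p" and t: "t \<in> X" "B t t = of_int (p * b)" "\<not> p dvd b" and y: "y \<in> L"
    and Y: "Y \<subseteq> X" "\<And>x. x \<in> Y \<Longrightarrow> \<exists>a. B x x = of_int a \<and> \<not> p dvd a"
  shows "\<exists>P. \<not> p dvd P \<and> of_int P * (\<Sum>x\<in>Y. (B x y)\<^sup>2 / B x x) \<in> \<int>"
proof -
  have "finite Y" using diagonalizesD(1)[OF d] Y(1) finite_subset by blast
  then show ?thesis using Y
  proof (induction Y)
    case empty
    then show ?case using p not_prime_unit by (intro exI[of _ 1]) auto
  next
    case (insert x Y)
    then obtain P where P: "\<not> p dvd P" "of_int P * (\<Sum>x\<in>Y. (B x y)\<^sup>2 / B x x) \<in> \<int>" by auto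
    obtain a where a: "B x x = of_int a" "\<not> p dvd a" using insert by blast
    obtain n where n: "B x y = of_int n" using unimodular_inD(5)[OF L _ y, of x] X insert.prems by (auto elim: Ints_cases)
    have a0: "a \<noteq> 0" using a by auto
    have "of_int (P * a) * (\<Sum>x\<in>insert x Y. (B x y)\<^sup>2 / B x x) =
        of_int a * (of_int P * (\<Sum>x\<in>Y. (B x y)\<^sup>2 / B x x)) + of_int (P * n\<^sup>2)"
      using insert.hyps a a0 n by (simp add: field_simps)
    also have "\<dots> \<in> \<int>" by (intro Ints_add Ints_mult[OF Ints_of_int P(2)] Ints_of_int)
    finally show ?case using P a p by (intro exI[of _ "P * a"]) (simp add: prime_dvd_mult_iff)
  qed
qed

text \<open>If p divided all pairings of \<open>t\<close>, unimodularity would put t / p into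
  \<open>L\<close>; but its norm b / p is not an integer.\<close>

lemma unimodular_residue:
  assumes S: "rational_subspace S" and L: "unimodular_in S L" and X: "t \<in> L"
    and p: "prime p" and t: "B t t = of_int (p * b)" "\<not> p dvd b"
  shows "\<exists>y n. y \<in> L \<and> B t y = of_int n \<and> \<not> p dvd n"
proof (rule ccontr)
  assume c: "\<not> ?thesis"
  have p0: "p > 0" using p prime_gt_0_int by blast
  define u where "u = (1 / of_int p) *\<^sub>R t"
  have "B u y \<in> \<int>" if y: "y \<in> L" for y
  proof -
    obtain n where n: "B t y = of_int n" using unimodular_inD(5)[OF L X y] by (auto elim: Ints_cases)
    then have "p dvd n" using c y by blast
    then obtain k where "n = p * k" by (rule dvdE)
    then have "B u y = of_int k" using n p0 by (simp add: u_def)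
    then show ?thesis by simp
  qed
  moreover have "u \<in> S" unfolding u_def using unimodular_inD(2)[OF L X] by (intro rational_subspaceD(3)[OF S]) auto
  ultimately have u: "u \<in> L" using unimodular_inD(6)[OF L] by blast
  then obtain k where k: "B u u = of_int k" using unimodular_inD(5)[OF L u u] by (auto elim: Ints_cases)
  have "of_int p * of_int k = real_of_int b" using k t p0 by (simp add: u_def field_simps)
  then have "b = p * k" by (metis of_int_eq_iff of_int_mult)
  then show False using t by simp
qed

lemma norm_expand:
  assumes S: "rational_subspace S" and d: "diagonalizes X S C" and y: "y \<in> S"
  shows "B y y = (\<Sum>x\<in>X. (B x y)\<^sup>2 / B x x)"
proof -
  have "B y y = B (\<Sum>x\<in>X. (B x y / B x x) *\<^sub>R x) y" using orth_sum_expand[OF S d y] by simp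
  also have "\<dots> = (\<Sum>x\<in>X. (B x y)\<^sup>2 / B x x)" by (simp add: form_sum_left power2_eq_square)
  finally show ?thesis .
qed

text \<open>With the basis inside the lattice, take y whose pairing n with \<open>t\<close> is prime
  to p and expand its norm along the basis. All terms with norm prime to p are p-integral, hence so
  is the rest. A rest \<open>n\<^sup>2 / (p * b)\<close> never is; a rest with two terms yields the
  isotropic vector of the residue form, whose component n is prime to p.\<close>

lemma unimodular_locally_ok:
  assumes S: "rational_subspace S" and L0: "unimodular_in S L0" and C: "diagonal S C"
  shows "locally_ok C"
proof -
  obtain X where d: "diagonalizes X S C" using C unfolding diagonal_def ..
  note D = diagonalizesD[OF d]
  have int: "\<exists>a. B x x = of_int a \<and> a \<in># C" if "x \<in> X" for x
  proof -
    have "B x x \<in># image_mset (\<lambda>x. B x x) (mset_set X)" using that D(1) by simp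
    then have "B x x \<in># image_mset real_of_int C" by (simp only: D(5))
    then show ?thesis by auto
  qed
  have "B x x \<in> \<int>" if "x \<in> X" for x using int[OF that] by auto
  then obtain L where L: "unimodular_in S L" "X \<subseteq> L"
    using unimodular_enlarge_orthogonal[OF S L0 D(1,2)] D(4) by blast
  show ?thesis unfolding locally_ok_def
  proof (intro conjI allI impI)
    fix p b A assume p: "prime p" and CA: "C = add_mset (p * b) A" and b: "\<not> p dvd b"
    have p0: "p > 0" using p prime_gt_0_int by blast
    show "\<exists>a\<in>#A. p dvd a"
    proof (rule ccontr)
      assume nd: "\<not> (\<exists>a\<in>#A. p dvd a)"
      have "real_of_int (p * b) \<in># image_mset (\<lambda>x. B x x) (mset_set X)" unfolding D(5) CA by simp
      then obtain t where t: "t \<in> X" "B t t = of_int (p * b)" using D(1) by auto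
      have A: "image_mset (\<lambda>x. B x x) (mset_set (X - {t})) = image_mset real_of_int A"
        using diagonalizes_remove[OF d t(1)] D(5) t(2) unfolding CA by simp
      obtain y n where y: "y \<in> L" "B t y = of_int n" "\<not> p dvd n"
        using unimodular_residue[OF S L(1) _ p t(2) b] L(2) t(1) by blast
      have "\<exists>a. B x x = of_int a \<and> \<not> p dvd a" if "x \<in> X - {t}" for x
      proof -
        have "B x x \<in># image_mset (\<lambda>x. B x x) (mset_set (X - {t}))" using that D(1) by simp
        then show ?thesis unfolding A using nd by auto
      qed
      then have "\<exists>P. \<not> p dvd P \<and> of_int P * (\<Sum>x\<in>X - {t}. (B x y)\<^sup>2 / B x x) \<in> \<int>"
        by (intro unimodular_integral_part[OF S L(1) d L(2) p t b y(1)]) auto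
      then obtain P where P: "\<not> p dvd P" "of_int P * (\<Sum>x\<in>X - {t}. (B x y)\<^sup>2 / B x x) \<in> \<int>" by blast
      have b0: "b \<noteq> 0" using b by auto
      have "B y y = (B t y)\<^sup>2 / B t t + (\<Sum>x\<in>X - {t}. (B x y)\<^sup>2 / B x x)"
        using norm_expand[OF S d unimodular_inD(2)[OF L(1) y(1)]] sum.remove[OF D(1) t(1)] by simp
      then have "of_int P * ((B t y)\<^sup>2 / B t t) = of_int P * B y y - of_int P * (\<Sum>x\<in>X - {t}. (B x y)\<^sup>2 / B x x)"
        by (simp add: algebra_simps)
      also have "\<dots> \<in> \<int>" 
        by (intro Ints_diff Ints_mult[OF Ints_of_int unimodular_inD(5)[OF L(1) y(1) y(1)]] P(2))
      finally obtain k where "of_int P * ((B t y)\<^sup>2 / B t t) = of_int k" by (auto elim: Ints_cases)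
      then have "real_of_int (P * n\<^sup>2) = of_int (k * (p * b))" using t y b0 p0 by (simp add: field_simps)
      then have "P * n\<^sup>2 = p * (k * b)" by (simp only: of_int_eq_iff) (simp add: mult_ac)
      then have "p dvd P * n\<^sup>2" by simp
      then show False using P y p by (simp add: prime_dvd_mult_iff prime_dvd_power_iff)
    qed
  next
    fix p b c A assume p: "prime p" and CA: "C = add_mset (p * b) (add_mset (p * c) A)" and b: "\<not> p dvd b" "\<not> p dvd c"
      and nd: "\<forall>a\<in>#A. \<not> p dvd a"
    have p0: "p > 0" using p prime_gt_0_int by blast
    have "real_of_int (p * b) \<in># image_mset (\<lambda>x. B x x) (mset_set X)" unfolding D(5) CA by simp
    then obtain t where t: "t \<in> X" "B t t = of_int (p * b)" using D(1) by auto
    have A1: "image_mset (\<lambda>x. B x x) (mset_set (X - {t})) = image_mset real_of_int (add_mset (p * c) A)"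
      using diagonalizes_remove[OF d t(1)] D(5) t(2) unfolding CA by simp
    have "real_of_int (p * c) \<in># image_mset (\<lambda>x. B x x) (mset_set (X - {t}))" unfolding A1 by simp
    then obtain s where s': "s \<in> X - {t}" "real_of_int (p * c) = B s s"
      using D(1) by (auto simp del: of_int_mult)
    then have s: "s \<in> X" "s \<noteq> t" "B s s = of_int (p * c)" by simp_all
    have A: "image_mset (\<lambda>x. B x x) (mset_set (X - {t} - {s})) = image_mset real_of_int A"
      using mset_set.remove[of "X - {t}" s] D(1) s A1 by simp
    obtain y n where y: "y \<in> L" "B t y = of_int n" "\<not> p dvd n"
      using unimodular_residue[OF S L(1) _ p t(2) b(1)] L(2) t(1) by blast
    obtain n' where n': "B s y = of_int n'" using unimodular_inD(5)[OF L(1) _ y(1), of s] L(2) s by (auto elim: Ints_cases)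
    have "\<exists>a. B x x = of_int a \<and> \<not> p dvd a" if "x \<in> X - {t} - {s}" for x
    proof -
      have "B x x \<in># image_mset (\<lambda>x. B x x) (mset_set (X - {t} - {s}))" using that D(1) by simp
      then show ?thesis unfolding A using nd by auto
    qed
    then have "\<exists>P. \<not> p dvd P \<and> of_int P * (\<Sum>x\<in>X - {t} - {s}. (B x y)\<^sup>2 / B x x) \<in> \<int>"
      by (intro unimodular_integral_part[OF S L(1) d L(2) p t b(1) y(1)]) auto
    then obtain P where P: "\<not> p dvd P" "of_int P * (\<Sum>x\<in>X - {t} - {s}. (B x y)\<^sup>2 / B x x) \<in> \<int>" by blast
    have b0: "b \<noteq> 0" "c \<noteq> 0" using b by auto
    have "B y y = (B t y)\<^sup>2 / B t t + ((B s y)\<^sup>2 / B s s + (\<Sum>x\<in>X - {t} - {s}. (B x y)\<^sup>2 / B x x))"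
    proof -
      have "sum g X = g t + (g s + sum g (X - {t} - {s}))" for g :: "'v \<Rightarrow> real"
        using sum.remove[OF D(1) t(1), of g] sum.remove[of "X - {t}" s g] D(1) s by simp
      then show ?thesis using norm_expand[OF S d unimodular_inD(2)[OF L(1) y(1)]] by (simp only:)
    qed
    then have "of_int P * ((B t y)\<^sup>2 / B t t + (B s y)\<^sup>2 / B s s) =
        of_int P * B y y - of_int P * (\<Sum>x\<in>X - {t} - {s}. (B x y)\<^sup>2 / B x x)"
      by (simp add: algebra_simps)
    also have "\<dots> \<in> \<int>" 
        by (intro Ints_diff Ints_mult[OF Ints_of_int unimodular_inD(5)[OF L(1) y(1) y(1)]] P(2))
    finally obtain k where "of_int P * ((B t y)\<^sup>2 / B t t + (B s y)\<^sup>2 / B s s) = of_int k" by (auto elim: Ints_cases)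
    then have "real_of_int (P * (b * n'\<^sup>2 + c * n\<^sup>2)) = of_int (p * (k * b * c))"
      using t s n' y b0 p0 by (simp add: field_simps)
    then have "P * (b * n'\<^sup>2 + c * n\<^sup>2) = p * (k * b * c)" by (simp only: of_int_eq_iff)
    then have "p dvd P * (b * n'\<^sup>2 + c * n\<^sup>2)" by simp
    then have "p dvd b * n'\<^sup>2 + c * n\<^sup>2" using P p by (simp add: prime_dvd_mult_iff)
    then show "\<exists>x y. \<not> p dvd x \<and> p dvd b * y\<^sup>2 + c * x\<^sup>2" using y(3) by blast
  qed
qed

definition orths :: "'v set \<Rightarrow> 'v set \<Rightarrow> 'v set" where
  "orths S H = {y\<in>S. \<forall>h\<in>H. B h y = 0}"

lemma diagonal_orths:
  assumes "finite I" "rational_subspace S" "\<And>i. i \<in> I \<Longrightarrow> h i \<in> S"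
    "\<And>i. i \<in> I \<Longrightarrow> B (h i) (h i) = of_int (a i)" "\<And>i. i \<in> I \<Longrightarrow> a i \<noteq> 0"
    "\<And>i j. i \<in> I \<Longrightarrow> j \<in> I \<Longrightarrow> i \<noteq> j \<Longrightarrow> B (h i) (h j) = 0"
  shows "diagonal S (image_mset a (mset_set I) + A) \<longleftrightarrow> diagonal (orths S (h ` I)) A"
  using assms
proof (induction I arbitrary: S)
  case empty
  then show ?case by (simp add: orths_def)
next
  case (insert i I)
  have hi: "h i \<in> S" "B (h i) (h i) = of_int (a i)" "a i \<noteq> 0" using insert.prems by auto
  have "diagonal S (image_mset a (mset_set (insert i I)) + A) \<longleftrightarrow>
      diagonal S (add_mset (a i) (image_mset a (mset_set I) + A))"
    using insert.hyps by simp
  also have "\<dots> \<longleftrightarrow> diagonal (orth S (h i)) (image_mset a (mset_set I) + A)"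
    using diagonal_cancel[OF insert.prems(1) _ hi(1,2)] hi by (auto simp: diagonal_add_mset)
  also have "\<dots> \<longleftrightarrow> diagonal (orths (orth S (h i)) (h ` I)) A"
  proof (rule insert.IH)
    show "h j \<in> orth S (h i)" if "j \<in> I" for j
    proof -
      have "B (h i) (h j) = 0" using that insert.hyps(2) by (intro insert.prems(5)) auto
      then show ?thesis using that insert.prems(2) by (simp add: orth_def)
    qed
  qed (use insert.prems rational_subspace_orth in auto)
  also have "orths (orth S (h i)) (h ` I) = orths S (h ` insert i I)" by (auto simp: orths_def orth_def)
  finally show ?case .
qed

end

section \<open>Adjoining hyperbolic planes\<close>

lemma lookup_scaleR [simp]: "Poly_Mapping.lookup (r *\<^sub>R f) i = r *\<^sub>R Poly_Mapping.lookup f i"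
proof -
  have "finite {i. r *\<^sub>R Poly_Mapping.lookup f i \<noteq> 0}"
    by (rule finite_subset[OF _ finite_lookup[of f]]) auto
  then show ?thesis by (simp add: scaleR_poly_mapping_def)
qed

text \<open>Hyperbolic planes are adjoined in the space \<open>nat \<Rightarrow>\<^sub>0 real\<close>, whose first \<open>k\<close>
  unit vectors get norm \<open>1\<close> and whose next \<open>k\<close> unit vectors get norm \<open>- 1\<close>.\<close>

definition stabilize :: "('v \<Rightarrow> 'v \<Rightarrow> real) \<Rightarrow> nat \<Rightarrow> 'v \<times> (nat \<Rightarrow>\<^sub>0 real) \<Rightarrow> 'v \<times> (nat \<Rightarrow>\<^sub>0 real) \<Rightarrow> real" where
  "stabilize B k x y = B (fst x) (fst y) + (\<Sum>i<2*k. (if i < k then 1 else - 1) *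
     (Poly_Mapping.lookup (snd x) i * Poly_Mapping.lookup (snd y) i))"

text \<open>One definition for the enlarged space and the enlarged lattice: \<open>R\<close> is
  \<rat> for the space and \<int> for the lattice, which is \<open>L\<close> plus an orthogonal sum
  of k lines of norm 1 and k lines of norm - 1.\<close>

definition stable_set :: "'v set \<Rightarrow> real set \<Rightarrow> nat \<Rightarrow> ('v \<times> (nat \<Rightarrow>\<^sub>0 real)) set" where
  "stable_set S R k = {x. fst x \<in> S \<and> (\<forall>i. Poly_Mapping.lookup (snd x) i \<in> R) \<and> (\<forall>i\<ge>2*k. Poly_Mapping.lookup (snd x) i = 0)}"

lemma common_denominator:
  fixes f :: "'i \<Rightarrow> real"
  assumes "finite I" "\<And>i. i \<in> I \<Longrightarrow> f i \<in> \<rat>"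
  shows "\<exists>K>0. \<forall>i\<in>I. of_int K * f i \<in> \<int>"
  using assms
proof (induction I)
  case empty
  show ?case by (intro exI[of _ 1]) simp
next
  case (insert j I)
  then obtain K where K: "K > 0" "\<forall>i\<in>I. of_int K * f i \<in> \<int>" by auto
  obtain a b where ab: "b > 0" "f j = of_int a / of_int b"
    using Rats_cases'[of "f j"] insert.prems by (metis insertI1)
  have "of_int (K * b) * f i \<in> \<int>" if "i \<in> insert j I" for i
  proof (cases "i = j")
    case True
    then have "of_int (K * b) * f i = of_int (K * a)" using ab by (simp add: field_simps)
    then show ?thesis by (simp only: Ints_of_int)
  next
    case False
    then have "of_int K * f i \<in> \<int>" using K(2) that by simp
    from Ints_mult[OF Ints_of_int this, of b] show ?thesis by (simp add: mult_ac)
  qed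
  then show ?case using K ab by (intro exI[of _ "K * b"]) auto
qed

context symmetric_form
begin

lemma symmetric_form_stabilize: "symmetric_form (stabilize B k)"
proof
  show "bilinear (stabilize B k)"
    unfolding bilinear_def stabilize_def
    by (intro conjI allI linearI)
      (simp_all add: lookup_add algebra_simps sum.distrib sum_distrib_left)
  show "stabilize B k x y = stabilize B k y x" for x y
    by (simp add: stabilize_def sym[of "fst x"] mult.commute)
qed

interpretation stable: symmetric_form "stabilize B k" for k
  by (rule symmetric_form_stabilize)

lemma stabilize_single:
  assumes "i < 2 * k"
  shows "stabilize B k (0, Poly_Mapping.single i 1) y = (if i < k then 1 else - 1) * Poly_Mapping.lookup (snd y) i"
proof -
  have "(\<Sum>j<2*k. (if j < k then 1 else - 1) * (Poly_Mapping.lookup (Poly_Mapping.single i (1::real)) j * Poly_Mapping.lookup (snd y) j))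
    = (\<Sum>j<2*k. if j = i then (if i < k then 1 else - 1) * Poly_Mapping.lookup (snd y) i else 0)"
    by (intro sum.cong) (auto simp: lookup_single when_def)
  also have "\<dots> = (if i < k then 1 else - 1) * Poly_Mapping.lookup (snd y) i" using assms by (simp add: sum.delta)
  finally show ?thesis by (simp add: stabilize_def)
qed

lemma rational_subspace_stable:
  assumes "rational_subspace S" shows "stable.rational_subspace k (stable_set S \<rat> k)"
proof -
  have "stabilize B k x y \<in> \<rat>" if "x \<in> stable_set S \<rat> k" "y \<in> stable_set S \<rat> k" for x y
    unfolding stabilize_def
  proof (rule Rats_add)
    show "B (fst x) (fst y) \<in> \<rat>" using that rational_subspaceD(4)[OF assms] by (simp add: stable_set_def)
    show "(\<Sum>i<2*k. (if i < k then 1 else - 1) * (Poly_Mapping.lookup (snd x) i * Poly_Mapping.lookup (snd y) i)) \<in> \<rat>"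
      using that by (intro Rats_sum Rats_mult) (auto simp: stable_set_def)
  qed
  then show ?thesis
    using rational_subspaceD[OF assms] unfolding stable.rational_subspace_def
    by (auto simp: stable_set_def lookup_add)
qed

lemma unimodular_stable:
  assumes S: "rational_subspace S" and L: "unimodular_in S L"
  shows "stable.unimodular_in k (stable_set S \<rat> k) (stable_set L \<int> k)"
  unfolding stable.unimodular_in_def
proof (intro conjI ballI impI)
  note LD = unimodular_inD[OF L]
  show "0 \<in> stable_set L \<int> k" using LD(1) by (simp add: stable_set_def)
  show "stable_set L \<int> k \<subseteq> stable_set S \<rat> k" using LD(2) Ints_subset_Rats by (auto simp: stable_set_def)
  show "x - y \<in> stable_set L \<int> k" if "x \<in> stable_set L \<int> k" "y \<in> stable_set L \<int> k" for x y
    using that LD(3) by (auto simp: stable_set_def lookup_minus)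
  show "\<exists>K>0. of_int K *\<^sub>R x \<in> stable_set L \<int> k" if x: "x \<in> stable_set S \<rat> k" for x
  proof -
    obtain K1 where K1: "K1 > 0" "of_int K1 *\<^sub>R fst x \<in> L" using LD(4)[of "fst x"] x by (auto simp: stable_set_def)
    obtain K2 where K2: "K2 > 0" "\<forall>i\<in>{..<2*k}. of_int K2 * Poly_Mapping.lookup (snd x) i \<in> \<int>"
      using common_denominator[of "{..<2*k}" "Poly_Mapping.lookup (snd x)"] x by (auto simp: stable_set_def)
    have "of_int (K2 * K1) *\<^sub>R fst x \<in> L" using LD(9)[OF K1(2), of K2] by simp
    moreover have "of_int (K2 * K1) * Poly_Mapping.lookup (snd x) i \<in> \<int>" for i
    proof (cases "i < 2 * k")
      case True
      then have "of_int K2 * Poly_Mapping.lookup (snd x) i \<in> \<int>" using K2(2) by simp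
      from Ints_mult[OF Ints_of_int this, of K1] show ?thesis by (simp add: mult_ac)
    next
      case False
      then show ?thesis using x by (simp add: stable_set_def)
    qed
    ultimately have "of_int (K2 * K1) *\<^sub>R x \<in> stable_set L \<int> k" using x by (simp add: stable_set_def)
    then show ?thesis using K1 K2 by (intro exI[of _ "K2 * K1"]) simp
  qed
  show "stabilize B k x y \<in> \<int>" if "x \<in> stable_set L \<int> k" "y \<in> stable_set L \<int> k" for x y
    unfolding stabilize_def
  proof (rule Ints_add)
    show "B (fst x) (fst y) \<in> \<int>" using that LD(5) by (simp add: stable_set_def)
    show "(\<Sum>i<2*k. (if i < k then 1 else - 1) * (Poly_Mapping.lookup (snd x) i * Poly_Mapping.lookup (snd y) i)) \<in> \<int>"
      using that by (intro Ints_sum Ints_mult) (auto simp: stable_set_def)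
  qed
  show "x \<in> stable_set L \<int> k" if x: "x \<in> stable_set S \<rat> k" "\<forall>y\<in>stable_set L \<int> k. stabilize B k x y \<in> \<int>" for x
  proof -
    have "fst x \<in> L"
    proof (rule LD(6))
      show "fst x \<in> S" using x by (simp add: stable_set_def)
      fix y assume "y \<in> L"
      then have "(y, 0) \<in> stable_set L \<int> k" by (simp add: stable_set_def)
      then have "stabilize B k x (y, 0) \<in> \<int>" using x by blast
      then show "B (fst x) y \<in> \<int>" by (simp add: stabilize_def)
    qed
    moreover have "Poly_Mapping.lookup (snd x) i \<in> \<int>" for i
    proof (cases "i < 2 * k")
      case True
      have "(0, Poly_Mapping.single i 1) \<in> stable_set L \<int> k"
        using True LD(1) by (auto simp: stable_set_def lookup_single when_def)
      then have "stabilize B k x (0, Poly_Mapping.single i 1) \<in> \<int>" using x by blast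
      then have "(if i < k then 1 else - 1) * Poly_Mapping.lookup (snd x) i \<in> \<int>"
        using stabilize_single[OF True, of x] stable.sym[of k x] by simp
      then show ?thesis by (auto split: if_splits)
    next
      case False
      then show ?thesis using x by (simp add: stable_set_def)
    qed
    ultimately show ?thesis using x by (simp add: stable_set_def)
  qed
qed

lemma diagonal_embed:
  "stable.diagonal k (S \<times> {0 :: nat \<Rightarrow>\<^sub>0 real}) A \<longleftrightarrow> diagonal S A"
proof -
  have B: "stabilize B k (x, 0) (y, 0) = B x y" for x y by (simp add: stabilize_def)
  have *: "stable.diagonalizes k (X \<times> {0 :: nat \<Rightarrow>\<^sub>0 real}) (S \<times> {0 :: nat \<Rightarrow>\<^sub>0 real}) A \<longleftrightarrow> diagonalizes X S A" for X
  proof -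
    have "X \<times> {0 :: nat \<Rightarrow>\<^sub>0 real} = (\<lambda>x. (x, 0)) ` X" by auto
    then have "mset_set (X \<times> {0 :: nat \<Rightarrow>\<^sub>0 real}) = image_mset (\<lambda>x. (x, 0)) (mset_set X)"
      by (simp add: image_mset_mset_set inj_on_def)
    then have "image_mset (\<lambda>x. stabilize B k x x) (mset_set (X \<times> {0 :: nat \<Rightarrow>\<^sub>0 real})) = image_mset (\<lambda>x. B x x) (mset_set X)"
      by (simp add: multiset.map_comp comp_def B)
    moreover have "finite (X \<times> {0 :: nat \<Rightarrow>\<^sub>0 real}) \<longleftrightarrow> finite X"
      using finite_cartesian_productD1[of X "{0 :: nat \<Rightarrow>\<^sub>0 real}"] by auto
    ultimately show ?thesis
      unfolding stable.diagonalizes_def diagonalizes_def by (auto simp: B zero_prod_def)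
  qed
  show ?thesis
  proof
    assume "stable.diagonal k (S \<times> {0 :: nat \<Rightarrow>\<^sub>0 real}) A"
    then obtain Y where Y: "stable.diagonalizes k Y (S \<times> {0 :: nat \<Rightarrow>\<^sub>0 real}) A" unfolding stable.diagonal_def ..
    have "Y = fst ` Y \<times> {0 :: nat \<Rightarrow>\<^sub>0 real}" using stable.diagonalizesD(2)[OF Y] by force
    then show "diagonal S A" using * Y unfolding diagonal_def by metis
  next
    assume "diagonal S A"
    then show "stable.diagonal k (S \<times> {0 :: nat \<Rightarrow>\<^sub>0 real}) A" using * unfolding diagonal_def stable.diagonal_def by blast
  qed
qed

text \<open>From right to left the planes are added, which makes room for a \<open>diag_eq\<close>
  between stabilized multisets; from left to right Witt cancellation removes them again.\<close>

lemma diagonal_stable: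
  assumes "rational_subspace S"
  shows "stable.diagonal k (stable_set S \<rat> k) (hyp k + A) \<longleftrightarrow> diagonal S A"
proof -
  define h :: "nat \<Rightarrow> 'v \<times> (nat \<Rightarrow>\<^sub>0 real)" where "h i = (0, Poly_Mapping.single i 1)" for i
  define a :: "nat \<Rightarrow> int" where "a i = (if i < k then 1 else - 1)" for i
  have split: "{..<2*k} = {..<k} \<union> {k..<2*k}" by auto
  have "image_mset a (mset_set {..<2*k}) = image_mset a (mset_set {..<k}) + image_mset a (mset_set {k..<2*k})"
    unfolding split by (subst mset_set_Union) auto
  also have "image_mset a (mset_set {..<k}) = image_mset (\<lambda>_. 1) (mset_set {..<k})"
    by (intro image_mset_cong) (auto simp: a_def)
  also have "image_mset a (mset_set {k..<2*k}) = image_mset (\<lambda>_. - 1) (mset_set {k..<2*k})"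
    by (intro image_mset_cong) (auto simp: a_def)
  finally have hyp: "image_mset a (mset_set {..<2*k}) = hyp k"
    by (simp add: hyp_def image_mset_const_eq)
  have "stable.diagonal k (stable_set S \<rat> k) (image_mset a (mset_set {..<2*k}) + A) \<longleftrightarrow>
      stable.diagonal k (stable.orths k (stable_set S \<rat> k) (h ` {..<2*k})) A"
  proof (rule stable.diagonal_orths)
    show "stable.rational_subspace k (stable_set S \<rat> k)" by (rule rational_subspace_stable[OF assms])
  qed (auto simp: h_def a_def stable_set_def stabilize_single lookup_single when_def rational_subspaceD[OF assms])
  also have "stable.orths k (stable_set S \<rat> k) (h ` {..<2*k}) = S \<times> {0 :: nat \<Rightarrow>\<^sub>0 real}"
  proof (rule subset_antisym; rule subsetI)
    fix x :: "'v \<times> (nat \<Rightarrow>\<^sub>0 real)" assume x: "x \<in> stable.orths k (stable_set S \<rat> k) (h ` {..<2*k})"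
    have "Poly_Mapping.lookup (snd x) i = 0" for i
    proof (cases "i < 2 * k")
      case True
      then have "stabilize B k (h i) x = 0" using x by (auto simp: stable.orths_def)
      then show ?thesis using stabilize_single[OF True, of x] by (simp add: h_def split: if_splits)
    next
      case False
      then show ?thesis using x by (simp add: stable.orths_def stable_set_def)
    qed
    then have "snd x = 0" by (intro poly_mapping_eqI) simp
    then show "x \<in> S \<times> {0 :: nat \<Rightarrow>\<^sub>0 real}" using x by (cases x) (auto simp: stable.orths_def stable_set_def)
  next
    fix x :: "'v \<times> (nat \<Rightarrow>\<^sub>0 real)" assume "x \<in> S \<times> {0 :: nat \<Rightarrow>\<^sub>0 real}"
    then show "x \<in> stable.orths k (stable_set S \<rat> k) (h ` {..<2*k})"
      by (auto simp: stable.orths_def stable_set_def stabilize_single h_def)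
  qed
  finally show ?thesis unfolding hyp diagonal_embed .
qed

lemma unit_mset:
  assumes "set_mset D \<subseteq> {1, - 1 :: int}"
  shows "D = replicate_mset (npos D) 1 + replicate_mset (size D - npos D) (- 1)"
  using assms
proof (induction D)
  case (add d D)
  have "npos D \<le> size D" unfolding npos_def by (rule size_filter_mset_lesseq)
  then show ?case using add by (auto simp: npos_def Suc_diff_le)
qed (simp add: npos_def)

lemma locally_ok_add_hyp: 
  assumes "locally_ok (C + hyp k)" shows "locally_ok C"
proof -
  have u: "\<not> p dvd a" if "prime p" "a \<in># hyp k" for p a :: int
    using that not_prime_unit by (auto simp: hyp_def split: if_splits)
  note l = assms[unfolded locally_ok_def]
  show ?thesis unfolding locally_ok_def
  proof (intro conjI allI impI)
    fix p b A assume *: "prime p" "C = add_mset (p * b) A" "\<not> p dvd b"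
    have "\<exists>a\<in>#A + hyp k. p dvd a"
      by (rule l[THEN conjunct1, rule_format, OF *(1) _ *(3)]) (simp add: *(2))
    then show "\<exists>a\<in>#A. p dvd a" using u[OF *(1)] by auto
  next
    fix p b c A assume *: "prime p" "C = add_mset (p * b) (add_mset (p * c) A)" "\<not> p dvd b" "\<not> p dvd c"
      "\<forall>a\<in>#A. \<not> p dvd a"
    show "\<exists>x y. \<not> p dvd x \<and> p dvd b * y\<^sup>2 + c * x\<^sup>2"
    proof (rule l[THEN conjunct2, rule_format, OF *(1) _ *(3,4)])
      show "C + hyp k = add_mset (p * b) (add_mset (p * c) (A + hyp k))" by (simp add: *(2))
      show "\<not> p dvd a" if "a \<in># A + hyp k" for a using that *(5) u[OF *(1)] by auto
    qed
  qed
qed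

lemma npos_hyp: "npos (C + hyp k) = npos C + k"
  by (induction k) (auto simp: npos_def hyp_def)

lemma replicate_mset_split: "replicate_mset (j + k) x = replicate_mset j x + replicate_mset k x"
  by (induction j) auto

text \<open>Witt equivalence becomes a genuine change of basis only after planes are added, so both
  the local condition and the final diagonal are obtained in the stabilized space and brought back
  by cancellation.\<close>

theorem unimodular_diagonal_units:
  assumes S: "rational_subspace S" and L: "unimodular_in S L" and A: "diagonal S A"
  shows "diagonal S (replicate_mset (npos A) 1 + replicate_mset (size A - npos A) (- 1))"
proof -
  have "witt_ok A" unfolding witt_ok_def
  proof (intro allI impI)
    fix C assume "witt_eq A C"
    then obtain j k where jk: "diag_eq (A + hyp j) (C + hyp k)" unfolding witt_eq_def by blast
    have "stable.diagonal j (stable_set S \<rat> j) (A + hyp j)"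
      using A diagonal_stable[OF S] by (simp add: union_commute)
    then have "stable.diagonal j (stable_set S \<rat> j) (C + hyp k)"
      using stable.diag_eq_diagonal[OF jk rational_subspace_stable[OF S]] by simp
    then have "locally_ok (C + hyp k)"
      by (rule stable.unimodular_locally_ok[OF rational_subspace_stable[OF S] unimodular_stable[OF S L]])
    then show "locally_ok C" by (rule locally_ok_add_hyp)
  qed
  then obtain C where C: "witt_eq A C" "set_mset C \<subseteq> {1, - 1}"
    using witt_ok_imp_units diagonal_nonzero[OF A] by blast
  then obtain j k where jk: "diag_eq (A + hyp j) (C + hyp k)" unfolding witt_eq_def by blast
  define D where "D = C + hyp k"
  have D: "set_mset D \<subseteq> {1, - 1}" using C by (auto simp: D_def hyp_def)
  have n: "npos D = npos A + j" "size D = size A + 2 * j"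
    using diag_eq_npos[OF jk] diag_eq_size[OF jk] by (simp_all add: D_def npos_hyp) (simp add: hyp_def)
  have "npos A \<le> size A" unfolding npos_def by (rule size_filter_mset_lesseq)
  then have "size D - npos D = (size A - npos A) + j" using n by simp
  \<comment> \<open>The counts show that D contains at least j entries 1 and j entries - 1, so
    exactly the j adjoined planes can be split off.\<close>
  then have "D = hyp j + (replicate_mset (npos A) 1 + replicate_mset (size A - npos A) (- 1))"
    using unit_mset[OF D] n(1) by (simp add: hyp_def replicate_mset_split union_ac)
  moreover have "stable.diagonal j (stable_set S \<rat> j) (A + hyp j)"
    using A diagonal_stable[OF S] by (simp add: union_commute)
  then have "stable.diagonal j (stable_set S \<rat> j) D"
    using stable.diag_eq_diagonal[OF jk rational_subspace_stable[OF S]] by (simp add: D_def)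
  ultimately show ?thesis using diagonal_stable[OF S] by simp
qed

end

section \<open>Isometries fixing a vector\<close>

context symmetric_form
begin

definition isometry :: "('v \<Rightarrow> 'v) \<Rightarrow> bool" where
  "isometry g \<longleftrightarrow> linear g \<and> bij g \<and> (\<forall>x y. B (g x) (g y) = B x y)"

lemma isometryD:
  assumes "isometry g"
  shows "linear g" "bij g" "B (g x) (g y) = B x y" "g (x + y) = g x + g y" "g (x - y) = g x - g y" "g (r *\<^sub>R x) = r *\<^sub>R g x"
  using assms by (auto simp: isometry_def linear_add linear_diff linear_scale)

lemma isometry_id: "isometry id"
  by (simp add: isometry_def linear_id)

lemma isometry_comp: "isometry g \<Longrightarrow> isometry h \<Longrightarrow> isometry (g \<circ> h)"
  by (simp add: isometry_def linear_compose bij_comp)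

lemma isometryI:
  assumes "linear g" "linear h" "\<And>x. g (h x) = x" "\<And>x. h (g x) = x" "\<And>x y. B (g x) (g y) = B x y"
  shows "isometry g"
proof -
  have "bij g" by (rule o_bij[of h]) (auto simp: assms)
  then show ?thesis using assms by (simp add: isometry_def)
qed

lemma isometry_inv:
  assumes "isometry g" shows "isometry (inv_into UNIV g)"
proof -
  note D = isometryD[OF assms]
  have gi: "g (inv_into UNIV g x) = x" and ig: "inv_into UNIV g (g x) = x" for x
    using D(2) by (simp_all add: bij_is_surj bij_is_inj surj_f_inv_f)
  have "linear (inv_into UNIV g)"
    by (rule linearI; rule injD[OF bij_is_inj[OF D(2)]]) (simp_all add: gi D)
  then show ?thesis
    by (rule isometryI[OF _ D(1) ig gi]) (metis D(3) gi)
qed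

lemma unimodular_isometry:
  assumes L: "unimodular_in S L" and g: "isometry g" and M: "g ` L \<subseteq> M" "M \<subseteq> S"
    "\<And>x y. x \<in> M \<Longrightarrow> y \<in> M \<Longrightarrow> B x y \<in> \<int>" and inv: "\<And>x. x \<in> S \<Longrightarrow> inv_into UNIV g x \<in> S"
  shows "g ` L = M"
proof (intro equalityI M(1) subsetI)
  note D = isometryD[OF g]
  have gi: "g (inv_into UNIV g x) = x" for x using D(2) by (simp add: bij_is_surj surj_f_inv_f)
  fix x assume x: "x \<in> M"
  have "inv_into UNIV g x \<in> L"
  proof (rule unimodular_inD(6)[OF L])
    show "inv_into UNIV g x \<in> S" using x M(2) inv by blast
    fix y assume "y \<in> L"
    then have "B x (g y) \<in> \<int>" using M(1,3) x by blast
    then show "B (inv_into UNIV g x) y \<in> \<int>" using D(3)[of "inv_into UNIV g x" y] by (simp add: gi)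
  qed
  then show "x \<in> g ` L" using gi[of x] by (metis imageI)
qed

text \<open>For a hyperbolic pair \<open>e, f\<close> this maps \<open>e\<close> to \<open>e / r\<close> and \<open>f\<close> to \<open>r f\<close>, and fixes the vectors orthogonal
  to both.\<close>

definition dilation :: "'v \<Rightarrow> 'v \<Rightarrow> real \<Rightarrow> 'v \<Rightarrow> 'v" where
  "dilation e f r x = x + ((1 / r - 1) * B f x) *\<^sub>R e + ((r - 1) * B e x) *\<^sub>R f"

lemma dilation_properties:
  assumes ef: "B e e = 0" "B f f = 0" "B e f = 1" and r: "r \<noteq> 0"
  shows "isometry (dilation e f r)" "inv_into UNIV (dilation e f r) = dilation e f (1 / r)"
proof -
  have fe: "B f e = 1" using ef(3) sym by simp
  have lin: "linear (dilation e f s)" for s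
    by (rule linearI) (simp_all add: dilation_def algebra_simps)
  have e: "B e (dilation e f s x) = s * B e x" for s x
    using ef by (simp add: dilation_def algebra_simps)
  have f: "B f (dilation e f s x) = B f x / s" for s x
    using ef fe by (simp add: dilation_def algebra_simps)
  have inv: "dilation e f s (dilation e f (1 / s) x) = x" if "s \<noteq> 0" for s x
  proof -
    have "dilation e f s (dilation e f (1 / s) x) =
        dilation e f (1 / s) x + ((1 / s - 1) * (s * B f x)) *\<^sub>R e + ((s - 1) * (B e x / s)) *\<^sub>R f"
      unfolding dilation_def[of e f s] e f by simp
    also have "\<dots> = x + ((s - 1) * B f x + (1 / s - 1) * (s * B f x)) *\<^sub>R e +
        ((1 / s - 1) * B e x + (s - 1) * (B e x / s)) *\<^sub>R f"
      by (simp add: dilation_def scaleR_left_distrib)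
    also have "(s - 1) * B f x + (1 / s - 1) * (s * B f x) = 0" using that by (simp add: field_simps)
    also have "(1 / s - 1) * B e x + (s - 1) * (B e x / s) = 0" using that by (simp add: field_simps)
    finally show ?thesis by simp
  qed
  have iso: "B (dilation e f r x) (dilation e f r y) = B x y" for x y
  proof -
    define k where "k = 1 / r"
    have "B (dilation e f r x) (dilation e f r y) = B x y + ((k - 1) * B f x) * B e y + ((r - 1) * B e x) * B f y
       + ((k - 1) * B f y) * B e x + ((r - 1) * B e y) * B f x
       + (k - 1) * (r - 1) * (B f x * B e y + B e x * B f y)"
      unfolding dilation_def k_def[symmetric]
      using ef fe sym[of x e] sym[of x f] by (simp add: algebra_simps)
    also have "\<dots> = B x y + ((k - 1) + (r - 1) + (k - 1) * (r - 1)) * (B f x * B e y + B e x * B f y)"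
      by (simp add: algebra_simps)
    also have "(k - 1) + (r - 1) + (k - 1) * (r - 1) = 0" using r by (simp add: k_def field_simps)
    finally show ?thesis by simp
  qed
  have inv2: "dilation e f (1 / r) (dilation e f r x) = x" for x
    using inv[of "1 / r" x] r by simp
  show "isometry (dilation e f r)"
    by (rule isometryI[OF lin lin inv[OF r] inv2 iso])
  show "inv_into UNIV (dilation e f r) = dilation e f (1 / r)"
    by (rule inv_equality[OF inv2 inv[OF r]])
qed

text \<open>The lattice splits as the plane of \<open>e, f\<close> and its complement. The dilation
  replaces the plane by that of e / p and p f and leaves the complement alone, which is what the
  neighbour does.\<close>

lemma neighbour_isotropic:
  assumes S: "rational_subspace S" and L: "unimodular_in S L" and p: "prime p"
    and ef: "e \<in> L" "f \<in> L" "B e e = 0" "B f f = 0" "B e f = 1" and e: "(1 / of_int p) *\<^sub>R e \<notin> L"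
  shows "dilation e f (of_int p) ` L = neighbour L ((1 / of_int p) *\<^sub>R e)"
proof -
  define w where "w = (1 / of_int p) *\<^sub>R e"
  note LD = unimodular_inD[OF L] and SD = rational_subspaceD[OF S]
  have p0: "p > 0" using p prime_gt_0_int by blast
  have wS: "w \<in> S" unfolding w_def using LD(2)[OF ef(1)] by (intro SD(3)) auto
  have pw: "of_int p *\<^sub>R w = e" using p0 by (simp add: w_def)
  have "B w w \<in> \<int>" using ef by (simp add: w_def)
  then have N: "unimodular_in S (neighbour L w)"
    using neighbour_unimodular[OF S L p wS] pw ef(1) e by (simp add: w_def)
  have g: "isometry (dilation e f (of_int p))" "inv_into UNIV (dilation e f (of_int p)) = dilation e f (1 / of_int p)"
    using dilation_properties[OF ef(3-5), of "of_int p"] p0 by simp_all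
  have "dilation e f (of_int p) ` L = neighbour L w"
  proof (rule unimodular_isometry[OF L g(1)])
    show "dilation e f (of_int p) ` L \<subseteq> neighbour L w"
    proof
      fix y assume "y \<in> dilation e f (of_int p) ` L"
      then obtain x where x: "x \<in> L" "y = dilation e f (of_int p) x" by blast
      obtain a b where ab: "B f x = of_int a" "B e x = of_int b"
        using LD(5)[OF ef(1) x(1)] LD(5)[OF ef(2) x(1)] by (auto elim!: Ints_cases)
      define x0 where "x0 = x - of_int a *\<^sub>R e + of_int ((p - 1) * b) *\<^sub>R f"
      have x0: "x0 \<in> L" unfolding x0_def by (intro LD(8,3,9) x(1) ef(1,2))
      have fe: "B f e = 1" using ef(5) sym by simp
      have "B x0 w = of_int b"
        using ef fe ab sym[of x e] p0 by (simp add: x0_def w_def field_simps)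
      then have "x0 + of_int a *\<^sub>R w \<in> neighbour L w" using x0 unfolding neighbour_def by force
      also have "x0 + of_int a *\<^sub>R w = y"
        unfolding x(2) dilation_def ab x0_def w_def by (simp add: algebra_simps)
      finally show "y \<in> neighbour L w" .
    qed
    show "inv_into UNIV (dilation e f (of_int p)) x \<in> S" if "x \<in> S" for x
      unfolding g(2) dilation_def using that LD(2) ef
      by (intro SD(2,3)) (auto intro!: Rats_mult SD(4))
  qed (use unimodular_inD[OF N] in auto)
  then show ?thesis by (simp add: w_def)
qed

text \<open>The crucial point is that \<open>s = u - a w\<close> pairs integrally with
  \<open>w\<close>. As u, s and w have even norms, \<open>a * B s w\<close> is an integer; so is
  \<open>p * B s w\<close>, because p w lies in \<open>L\<close>; and a is prime to p.\<close>

lemma neighbour_cong: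
  assumes S: "rational_subspace S" and L: "unimodular_in S L" and p: "prime p"
    and w: "w \<in> S" "of_int p *\<^sub>R w \<in> L" "w \<notin> L" "B w w \<in> \<int>"
    and u: "u \<in> S" "u - of_int a *\<^sub>R w \<in> L" "\<not> p dvd a"
    and even: "even_in L" "even_in {w}" "even_in {u}"
  shows "neighbour L u = neighbour L w" "u \<notin> L"
proof -
  note LD = unimodular_inD[OF L]
  define s where "s = u - of_int a *\<^sub>R w"
  have s: "s \<in> L" "u = s + of_int a *\<^sub>R w" using u by (auto simp: s_def)
  have p0: "p > 0" using p prime_gt_0_int by blast
  have "coprime a p" using prime_imp_coprime[OF p u(3)] by (simp add: coprime_commute)
  then obtain a' where "[a * a' = 1] (mod p)" using cong_solve_coprime_int by blast
  then have "p dvd a * a' - 1" by (simp add: cong_iff_dvd_diff)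
  then obtain t where "a * a' - 1 = p * t" by (rule dvdE)
  then have t: "1 = a * a' - p * t" by simp
  have cancel: "B x w \<in> \<int>" if "x \<in> L" "of_int a * B x w \<in> \<int>" for x
  proof -
    have "of_int p * B x w \<in> \<int>" using LD(5)[OF that(1) w(2)] by simp
    from Ints_diff[OF Ints_mult[OF Ints_of_int that(2), of a'] Ints_mult[OF Ints_of_int this, of t]]
    have "of_int a' * (of_int a * B x w) - of_int t * (of_int p * B x w) \<in> \<int>" .
    also have "of_int a' * (of_int a * B x w) - of_int t * (of_int p * B x w) = of_int (a * a' - p * t) * B x w"
      by (simp add: algebra_simps)
    finally show ?thesis using t by simp
  qed
  have "B u u / 2 = B s s / 2 + of_int a * B s w + of_int (a * a) * (B w w / 2)"
    using sym[of w s] by (simp add: s(2) algebra_simps)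
  then have "of_int a * B s w = B u u / 2 - B s s / 2 - of_int (a * a) * (B w w / 2)"
    by (simp add: field_simps)
  also have "\<dots> \<in> \<int>" using even s(1) unfolding even_in_def
    by (intro Ints_diff Ints_mult[OF Ints_of_int]) simp_all
  finally have sw: "B s w \<in> \<int>" by (rule cancel[OF s(1)])
  have pu: "of_int p *\<^sub>R u \<in> L" unfolding s(2) using LD(8)[OF LD(9)[OF s(1)] LD(9)[OF w(2)], of p a]
    by (simp add: scaleR_right_distrib mult.commute)
  show unL: "u \<notin> L"
  proof
    assume "u \<in> L"
    then have "of_int a *\<^sub>R w \<in> L" using LD(3)[OF _ s(1)] s(2) by fastforce
    from LD(3)[OF LD(9)[OF this, of a'] LD(9)[OF w(2), of t]]
    have "of_int a' *\<^sub>R (of_int a *\<^sub>R w) - of_int t *\<^sub>R (of_int p *\<^sub>R w) \<in> L" .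
    also have "of_int a' *\<^sub>R (of_int a *\<^sub>R w) - of_int t *\<^sub>R (of_int p *\<^sub>R w) = of_int (a * a' - p * t) *\<^sub>R w"
      by (simp add: algebra_simps)
    finally show False using t w(3) by simp
  qed
  have "B u u = 2 * (B u u / 2)" by simp
  also have "\<dots> \<in> \<int>" using even(3) unfolding even_in_def by (intro Ints_mult) simp_all
  finally have N: "unimodular_in S (neighbour L u)"
    using neighbour_unimodular[OF S L p u(1) pu unL] by simp
  have Nw: "unimodular_in S (neighbour L w)" by (rule neighbour_unimodular[OF S L p w])
  show "neighbour L u = neighbour L w"
  proof (rule unimodular_in_maximal[OF N])
    show "neighbour L u \<subseteq> neighbour L w"
    proof
      fix y assume "y \<in> neighbour L u"
      then obtain x j where x: "y = x + of_int j *\<^sub>R u" "x \<in> L" "B x u \<in> \<int>" unfolding neighbour_def by blast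
      have "of_int a * B x w = B x u - B x s" by (simp add: s(2))
      also have "\<dots> \<in> \<int>" by (intro Ints_diff x(3) LD(5) x(2) s(1))
      finally have "B x w \<in> \<int>" by (rule cancel[OF x(2)])
      then have "B (x + of_int j *\<^sub>R s) w \<in> \<int>" using sw by (auto intro!: Ints_add Ints_mult)
      moreover have "x + of_int j *\<^sub>R s \<in> L" by (intro LD(8,9) x(2) s(1))
      moreover have "y = (x + of_int j *\<^sub>R s) + of_int (j * a) *\<^sub>R w" by (simp add: x(1) s(2) algebra_simps)
      ultimately show "y \<in> neighbour L w" unfolding neighbour_def by blast
    qed
    show "neighbour L w \<subseteq> S" using unimodular_inD(2)[OF Nw] by blast
    show "B x y \<in> \<int>" if "x \<in> neighbour L w" "y \<in> neighbour L w" for x y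
      using unimodular_inD(5)[OF Nw] that by blast
  qed
qed

lemma even_inD: "even_in L \<Longrightarrow> x \<in> L \<Longrightarrow> \<exists>q. B x x = 2 * of_int q"
  unfolding even_in_def by (force elim: Ints_cases simp: field_simps)

lemma project_hyperbolic:
  assumes L: "unimodular_in S L" and ef: "e \<in> L" "f \<in> L" "B e e = 0" "B f f = 0" "B e f = 1" and s: "s \<in> L"
  shows "s - B f s *\<^sub>R e - B e s *\<^sub>R f \<in> L" "B e (s - B f s *\<^sub>R e - B e s *\<^sub>R f) = 0"
    "B f (s - B f s *\<^sub>R e - B e s *\<^sub>R f) = 0"
proof -
  note LD = unimodular_inD[OF L]
  obtain a b where "B f s = of_int a" "B e s = of_int b"
    using LD(5)[OF ef(1) s] LD(5)[OF ef(2) s] by (auto elim!: Ints_cases)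
  then show "s - B f s *\<^sub>R e - B e s *\<^sub>R f \<in> L" using LD(3,9) ef s by simp
  show "B e (s - B f s *\<^sub>R e - B e s *\<^sub>R f) = 0" "B f (s - B f s *\<^sub>R e - B e s *\<^sub>R f) = 0"
    using ef sym[of f e] by simp_all
qed

text \<open>The neighbour is reached by dilating a hyperbolic plane orthogonal to \<open>v\<close> whose isotropic
  vector \<open>z\<close> is congruent to a multiple of \<open>p w\<close>; \<open>z\<close> is obtained from \<open>e\<close> by an
  Eichler transvection. The coefficient of \<open>p w\<close> at \<open>e\<close> has to be prime to \<open>p\<close> for this.\<close>

lemma neighbour_isometric_aux:
  assumes S: "rational_subspace S" and L: "unimodular_in S L" "even_in L"
    and ef: "e \<in> L" "f \<in> L" "B e e = 0" "B f f = 0" "B e f = 1" "B e v = 0" "B f v = 0"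
    and v: "v \<in> L" "y0 \<in> L" "B v y0 = 1"
    and p: "prime p" and w: "w \<in> S" "of_int p *\<^sub>R w \<in> L" "w \<notin> L" "even_in {w}" "B v w \<in> \<int>"
    and a: "of_int p * B f w = of_int a" "\<not> p dvd a"
  shows "\<exists>g. isometry g \<and> g v = v \<and> g ` L = neighbour L w"
proof -
  note LD = unimodular_inD[OF L(1)] and SD = rational_subspaceD[OF S]
  have p0: "p > 0" using p prime_gt_0_int by blast
  have fe: "B f e = 1" using ef(5) sym by simp
  obtain q0 where q0: "B w w = 2 * of_int q0" using even_inD[OF w(4)] by blast
  have "coprime a p" using prime_imp_coprime[OF p a(2)] by (simp add: coprime_commute)
  then obtain a' where "[a * a' = 1] (mod p)" using cong_solve_coprime_int by blast
  then have pa: "p dvd a * a' - 1" by (simp add: cong_iff_dvd_diff)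
  then obtain r where r: "a * a' - 1 = p * r" by (rule dvdE)
  have na': "\<not> p dvd a'"
  proof
    assume "p dvd a'"
    then have "p dvd a * a'" by simp
    then have "p dvd 1" using pa dvd_diff[of p "a * a'" "a * a' - 1"] by simp
    then show False using p not_prime_unit by auto
  qed
  \<comment> \<open>A multiple of p w whose coefficient \<open>a * a'\<close> at \<open>e\<close> is
    1 modulo p, so that W can be congruent to a transvection image of \<open>e\<close>.\<close>
  define W where "W = of_int (p * a') *\<^sub>R w"
  have W: "W \<in> L" using LD(9)[OF w(2), of a'] by (simp add: W_def mult.commute)
  define x where "x = W - B f W *\<^sub>R e - B e W *\<^sub>R f"
  have x: "x \<in> L" "B e x = 0" "B f x = 0"
    unfolding x_def by (rule project_hyperbolic[OF L(1) ef(1-5) W])+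
  define y1 where "y1 = y0 - B f y0 *\<^sub>R e - B e y0 *\<^sub>R f"
  have y1: "y1 \<in> L" "B e y1 = 0" "B f y1 = 0"
    unfolding y1_def by (rule project_hyperbolic[OF L(1) ef(1-5) v(2)])+
  have vy1: "B v y1 = 1" using v(3) ef(6,7) sym[of e v] sym[of f v] by (simp add: y1_def)
  obtain t where t: "B v w = of_int t" using w(5) by (auto elim: Ints_cases)
  \<comment> \<open>Subtracting a multiple of p y1 makes the vector orthogonal to \<open>v\<close>
    without changing it modulo p L.\<close>
  define y where "y = x - of_int (p * a' * t) *\<^sub>R y1"
  have y: "y \<in> L" "B e y = 0" "B f y = 0"
    unfolding y_def by (intro LD(3,9) x(1) y1(1)) (simp_all add: x y1)
  have vx: "B v x = of_int (p * a' * t)"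
    using ef(6,7) sym[of e v] sym[of f v] t by (simp add: x_def W_def)
  then have vy: "B v y = 0" using vy1 by (simp add: y_def)
  obtain q where q: "B y y = 2 * of_int q" using even_inD[OF L(2) y(1)] by blast
  obtain b where b: "B e W = of_int b" using LD(5)[OF ef(1) W] by (auto elim: Ints_cases)
  have fW: "B f W = of_int (a * a')" using a(1) by (simp add: W_def mult_ac)
  define z where "z = e + y - of_int q *\<^sub>R f"
  have z: "z \<in> L" unfolding z_def by (intro LD(3,8,9) ef(1,2) y(1))
  have zz: "B z z = 0" using ef fe y q sym[of y e] sym[of y f] by (simp add: z_def)
  have zf: "B z f = 1" using ef y sym[of y f] by (simp add: z_def)
  have zv: "B z v = 0" using ef vy sym[of y v] by (simp add: z_def)
  \<comment> \<open>The coefficients of z and W at \<open>f\<close> are - q and b. They agree modulo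
    p because half the norm of W is divisible by p: with the coefficient at \<open>e\<close> equal
    to 1 modulo p, this half norm is q + b modulo p.\<close>
  have pbq: "p dvd b + q"
  proof -
    obtain q1 where q1: "B y1 y1 = 2 * of_int q1" using even_inD[OF L(2) y1(1)] by blast
    obtain c where c: "B x y1 = of_int c" using LD(5)[OF x(1) y1(1)] by (auto elim: Ints_cases)
    have Wx: "W = x + of_int (a * a') *\<^sub>R e + of_int b *\<^sub>R f" by (simp add: x_def fW b)
    have "B W W = B x x + 2 * of_int (a * a' * b)"
      unfolding Wx using ef fe x sym[of x e] sym[of x f] by simp
    moreover have "B W W = 2 * of_int ((p * a')\<^sup>2 * q0)" using q0 by (simp add: W_def power2_eq_square)
    moreover have "B x x = B y y + 2 * of_int (p * a' * t) * of_int c - of_int ((p * a' * t)\<^sup>2) * (2 * of_int q1)"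
      unfolding y_def using q1 c sym[of y1 x] by (simp add: algebra_simps power2_eq_square)
    ultimately have "real_of_int ((p * a')\<^sup>2 * q0) = of_int (q + p * a' * t * c - (p * a' * t)\<^sup>2 * q1 + a * a' * b)"
      unfolding q by simp
    then have "(p * a')\<^sup>2 * q0 = q + p * a' * t * c - (p * a' * t)\<^sup>2 * q1 + a * a' * b" by (simp only: of_int_eq_iff)
    then have "b + q = p * (p * a'\<^sup>2 * q0 - a' * t * c + p * (a' * t)\<^sup>2 * q1) - (a * a' - 1) * b"
      by (simp add: algebra_simps power2_eq_square)
    then show ?thesis using pa by (metis dvd_diff dvd_mult2 dvd_triv_left)
  qed
  then obtain d where d: "b + q = p * d" by (rule dvdE)
  define u where "u = (1 / of_int p) *\<^sub>R z"
  have uw: "u - of_int a' *\<^sub>R w \<in> L"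
  proof -
    have "z - W = of_int p *\<^sub>R (- (of_int r *\<^sub>R e) - of_int (a' * t) *\<^sub>R y1 - of_int d *\<^sub>R f)"
    proof -
      have "z - W = (1 - of_int (a * a')) *\<^sub>R e - of_int (p * a' * t) *\<^sub>R y1 - of_int (b + q) *\<^sub>R f"
        by (simp add: z_def y_def x_def fW b algebra_simps)
      also have "1 - real_of_int (a * a') = - of_int (a * a' - 1)" by simp
      finally show ?thesis unfolding r d by (simp add: algebra_simps)
    qed
    moreover have "u - of_int a' *\<^sub>R w = (1 / of_int p) *\<^sub>R (z - W)"
      using p0 by (simp add: u_def W_def scaleR_right_diff_distrib)
    ultimately have "u - of_int a' *\<^sub>R w = - (of_int r *\<^sub>R e) - of_int (a' * t) *\<^sub>R y1 - of_int d *\<^sub>R f"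
      using p0 by simp
    also have "\<dots> \<in> L" by (intro LD(3,7,9) ef(1,2) y1(1))
    finally show ?thesis .
  qed
  have "B w w \<in> \<int>" using q0 by simp
  moreover have "even_in {u}" using zz by (simp add: even_in_def u_def)
  moreover have "u \<in> S" unfolding u_def using LD(2)[OF z] by (intro SD(3)) auto
  ultimately have n: "neighbour L u = neighbour L w" "u \<notin> L"
    using neighbour_cong[OF S L(1) p w(1-3) _ _ uw na' L(2) w(4)] by auto
  have "dilation z f (of_int p) ` L = neighbour L w"
    using neighbour_isotropic[OF S L(1) p z ef(2) zz ef(4) zf] n by (simp add: u_def)
  moreover have "isometry (dilation z f (of_int p))"
    using dilation_properties(1)[OF zz ef(4) zf] p0 by simp
  moreover have "dilation z f (of_int p) v = v" using ef(7) zv by (simp add: dilation_def)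
  ultimately show ?thesis by blast
qed

text \<open>If the coefficient of p w at \<open>e\<close> or at \<open>f\<close> is prime to p, the
  previous lemma applies, with \<open>e\<close> and \<open>f\<close> exchanged in the second case.
  Otherwise \<open>e\<close> is replaced by its transvection image \<open>e'\<close> along some y
  orthogonal to \<open>v\<close>, chosen so that the pairing of p w with \<open>e'\<close> is prime
  to p. Such a y is missing only if w has the direction of \<open>v\<close>.\<close>

lemma neighbour_isometric:
  assumes S: "rational_subspace S" and L: "unimodular_in S L" "even_in L"
    and ef: "e \<in> L" "f \<in> L" "B e e = 0" "B f f = 0" "B e f = 1" "B e v = 0" "B f v = 0"
    and v: "v \<in> L" "y0 \<in> L" "B v y0 = 1"
    and p: "prime p" and w: "w \<in> S" "of_int p *\<^sub>R w \<in> L" "w \<notin> L" "even_in {w}" "B v w \<in> \<int>"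
    and nv: "\<And>j. w - (of_int j / of_int p) *\<^sub>R v \<notin> L"
  shows "\<exists>g. isometry g \<and> g v = v \<and> g ` L = neighbour L w"
proof -
  note LD = unimodular_inD[OF L(1)] and SD = rational_subspaceD[OF S]
  have p0: "p > 0" using p prime_gt_0_int by blast
  have fe: "B f e = 1" using ef(5) sym by simp
  obtain a b where ab: "of_int p * B f w = of_int a" "of_int p * B e w = of_int b"
    using LD(5)[OF ef(1) w(2)] LD(5)[OF ef(2) w(2)] by (auto elim!: Ints_cases)
  consider "\<not> p dvd a" | "\<not> p dvd b" | "p dvd a" "p dvd b" by blast
  then show ?thesis
  proof cases
    case 1
    then show ?thesis by (rule neighbour_isometric_aux[OF S L ef v p w ab(1)])
  next
    case 2
    then show ?thesis by (rule neighbour_isometric_aux[OF S L ef(2,1,4,3) fe ef(7,6) v p w ab(2)])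
  next
    case 3
    define W where "W = of_int p *\<^sub>R w"
    define x where "x = W - B f W *\<^sub>R e - B e W *\<^sub>R f"
    have x: "x \<in> L" "B e x = 0" "B f x = 0"
      unfolding x_def by (rule project_hyperbolic[OF L(1) ef(1-5)]; simp add: W_def w(2))+
    define y1 where "y1 = y0 - B f y0 *\<^sub>R e - B e y0 *\<^sub>R f"
    have y1: "y1 \<in> L" "B e y1 = 0" "B f y1 = 0"
      unfolding y1_def by (rule project_hyperbolic[OF L(1) ef(1-5) v(2)])+
    have vy1: "B v y1 = 1" using v(3) ef(6,7) sym[of e v] sym[of f v] by (simp add: y1_def)
    obtain j where j: "B x y1 = of_int j" using LD(5)[OF x(1) y1(1)] by (auto elim: Ints_cases)
    have "\<exists>y c. y \<in> L \<and> B e y = 0 \<and> B f y = 0 \<and> B v y = 0 \<and> B x y = of_int c \<and> \<not> p dvd c"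
    proof (rule ccontr)
      assume c: "\<not> ?thesis"
      \<comment> \<open>Every vector of \<open>L\<close> is a combination of \<open>e\<close>,
        \<open>f\<close>, \<open>y1\<close> and a vector orthogonal to \<open>e\<close>,
        \<open>f\<close> and \<open>v\<close>. If p divides all pairings of x with the latter, then
        x - j v pairs with all of \<open>L\<close> into multiples of p, and k lies in
        \<open>L\<close>.\<close>
      define k where "k = (1 / of_int p) *\<^sub>R (x - of_int j *\<^sub>R v)"
      have "k \<in> L"
      proof (rule LD(6))
        show "k \<in> S" unfolding k_def using x(1) v(1) LD(2) by (intro SD(3,5)) auto
        fix s assume s: "s \<in> L"
        define s1 where "s1 = s - B f s *\<^sub>R e - B e s *\<^sub>R f"
        have s1: "s1 \<in> L" "B e s1 = 0" "B f s1 = 0"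
          unfolding s1_def by (rule project_hyperbolic[OF L(1) ef(1-5) s])+
        obtain n where n: "B v s = of_int n" using LD(5)[OF v(1) s] by (auto elim: Ints_cases)
        have vs1: "B v s1 = of_int n" using n ef(6,7) sym[of e v] sym[of f v] by (simp add: s1_def)
        define s2 where "s2 = s1 - of_int n *\<^sub>R y1"
        have s2: "s2 \<in> L" "B e s2 = 0" "B f s2 = 0" "B v s2 = 0"
          using LD(3,9) s1 y1 vy1 vs1 by (simp_all add: s2_def)
        obtain c' where c': "B x s2 = of_int c'" using LD(5)[OF x(1) s2(1)] by (auto elim: Ints_cases)
        then have "p dvd c'" using c s2 by blast
        then obtain l where l: "c' = p * l" by (rule dvdE)
        have "B x s = B x s1" using x(2,3) sym[of e x] sym[of f x] by (simp add: s1_def)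
        also have "\<dots> = B x s2 + of_int n * of_int j" using j by (simp add: s2_def)
        finally have "B (x - of_int j *\<^sub>R v) s = of_int (p * l)" using n c' l by simp
        then have "B k s = of_int l" using p0 by (simp add: k_def)
        then show "B k s \<in> \<int>" by simp
      qed
      obtain a1 b1 where ab1: "a = p * a1" "b = p * b1" using 3 by (auto elim!: dvdE)
      have "w - (of_int j / of_int p) *\<^sub>R v = k + of_int a1 *\<^sub>R e + of_int b1 *\<^sub>R f"
      proof -
        have "x = of_int p *\<^sub>R (w - of_int a1 *\<^sub>R e - of_int b1 *\<^sub>R f)"
        proof -
          have "B f w = of_int a1" "B e w = of_int b1" using ab p0 by (simp_all add: ab1)
          then show ?thesis by (simp add: x_def W_def algebra_simps)
        qed
        then show ?thesis using p0 by (simp add: k_def scaleR_right_diff_distrib)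
      qed
      also have "\<dots> \<in> L" by (intro LD(8,9) \<open>k \<in> L\<close> ef(1,2))
      finally show False using nv by blast
    qed
    then obtain y c where y: "y \<in> L" "B e y = 0" "B f y = 0" "B v y = 0" "B x y = of_int c" "\<not> p dvd c" by blast
    obtain q where q: "B y y = 2 * of_int q" using even_inD[OF L(2) y(1)] by blast
    define e' where "e' = e + y - of_int q *\<^sub>R f"
    have e': "e' \<in> L" unfolding e'_def by (intro LD(3,8,9) ef(1,2) y(1))
    have ee: "B e' e' = 0" using ef fe y q sym[of y e] sym[of y f] by (simp add: e'_def)
    have fe': "B f e' = 1" using fe ef y by (simp add: e'_def)
    have ev: "B e' v = 0" using ef y(4) sym[of y v] by (simp add: e'_def)
    have "B y x = B y W" using y(2,3) sym[of y e] sym[of y f] by (simp add: x_def)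
    then have "of_int p * B e' w = of_int (b + c - q * a)"
      using ab y(5) sym[of y x] by (simp add: e'_def W_def algebra_simps)
    moreover have "\<not> p dvd b + c - q * a"
    proof
      assume "p dvd b + c - q * a"
      moreover have "p dvd b - q * a" using 3 by (intro dvd_diff dvd_mult)
      ultimately have "p dvd (b + c - q * a) - (b - q * a)" by (rule dvd_diff)
      then show False using y(6) by simp
    qed
    ultimately show ?thesis by (intro neighbour_isometric_aux[OF S L ef(2) e' ef(4) ee fe' ef(7) ev v p w])
  qed
qed

text \<open>The vector \<open>u\<close> excludes the one bad neighbour, in the direction of \<open>v\<close> itself, at the
  primes dividing \<open>m\<close>; at the other primes that neighbour does not exist.\<close>

lemma isometric_fixing:
  assumes S: "rational_subspace S" and L: "unimodular_in S L" "even_in L" and M: "unimodular_in S M" "even_in M"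
    and ef: "e \<in> M" "f \<in> M" "B e e = 0" "B f f = 0" "B e f = 1" "B e v = 0" "B f v = 0"
    and v: "v \<in> M" "y0 \<in> M" "B v y0 = 1" "v \<in> L" "B v v = 2 * of_int m"
    and u: "u \<in> M" "u \<in> L" "B v u = of_int c" "coprime c m"
    and T: "finite T" "T \<subseteq> L"
  shows "\<exists>g. isometry g \<and> g v = v \<and> unimodular_in S (g ` M) \<and> u \<in> g ` M \<and> T \<subseteq> g ` M"
  using T
proof (induction T)
  case empty
  show ?case by (rule exI[of _ id], intro conjI isometry_id) (simp_all add: M(1) u(1))
next
  case (insert t T)
  \<comment> \<open>The vectors \<open>u\<close> and those of \<open>T\<close> lie in
    \<open>L\<close>, hence pair integrally with each direction \<open>w\<close> taken from
    \<open>L\<close>; this is why no later step loses them.\<close>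
  define P where "P M' \<longleftrightarrow> (\<exists>g. isometry g \<and> g v = v \<and> g ` M = M' \<and> u \<in> M' \<and> T \<subseteq> M')" for M'
  have "\<exists>M'. P M' \<and> unimodular_in S M' \<and> t \<in> M'"
  proof -
    obtain g where g: "isometry g" "g v = v" "unimodular_in S (g ` M)" "u \<in> g ` M" "T \<subseteq> g ` M"
      using insert by auto
    show ?thesis
    proof (rule unimodular_generate[OF _ _ g(3)])
      show "P (g ` M)" unfolding P_def using g by blast
      show "t \<in> S" using insert.prems unimodular_inD(2)[OF L(1)] by auto
      fix M' p j
      assume M': "P M'" "unimodular_in S M'" "prime p" "of_int p *\<^sub>R (of_int j *\<^sub>R t) \<in> M'" "of_int j *\<^sub>R t \<notin> M'"
      define w where "w = of_int j *\<^sub>R t"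
      have p0: "p > 0" using M'(3) prime_gt_0_int by blast
      have wL: "w \<in> L" using unimodular_inD(9)[OF L(1)] insert.prems by (simp add: w_def)
      have wI: "B x w \<in> \<int>" if "x \<in> L" for x using unimodular_inD(5)[OF L(1) that wL] .
      obtain h where h: "isometry h" "h v = v" "h ` M = M'" "u \<in> M'" "T \<subseteq> M'" using M'(1) unfolding P_def by blast
      note hD = isometryD[OF h(1)]
      have ev: "even_in M'" using M(2) hD(3) unfolding even_in_def h(3)[symmetric] by auto
      have evw: "even_in {w}" using L(2) wL by (simp add: even_in_def)
      \<comment> \<open>In the direction of \<open>v\<close>, the integral pairings with
        \<open>u\<close> give that p divides i c, hence c, and the even norms give that p divides
        \<open>i\<^sup>2 * m\<close>, hence m. This contradicts the coprimality of c and m.\<close>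
      have nv: "w - (of_int i / of_int p) *\<^sub>R v \<notin> M'" for i
      proof
        assume y: "w - (of_int i / of_int p) *\<^sub>R v \<in> M'"
        have vM: "v \<in> M'" using h(2,3) v(1) by (metis imageI)
        have ni: "\<not> p dvd i"
        proof
          assume "p dvd i"
          then obtain l where "i = p * l" by (rule dvdE)
          then have "(w - (of_int i / of_int p) *\<^sub>R v) + of_int l *\<^sub>R v = w" using p0 by simp
          moreover have "(w - (of_int i / of_int p) *\<^sub>R v) + of_int l *\<^sub>R v \<in> M'"
            by (intro unimodular_inD(8,9)[OF M'(2)] y vM)
          ultimately have "w \<in> M'" by (simp only:)
          then show False using M'(5) by (simp add: w_def)
        qed
        obtain k1 where k1: "B w u = of_int k1" using wI[OF u(2)] sym by (metis Ints_cases)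
        obtain k2 where k2: "B (w - (of_int i / of_int p) *\<^sub>R v) u = of_int k2"
          using unimodular_inD(5)[OF M'(2) y h(4)] by (auto elim: Ints_cases)
        have "of_int i * of_int c = real_of_int p * (of_int k1 - of_int k2)"
          using k1 k2 u(3) p0 by (simp add: field_simps)
        then have "i * c = p * (k1 - k2)" by (metis of_int_diff of_int_eq_iff of_int_mult)
        then have "p dvd i * c" by simp
        then have pc: "p dvd c" using ni M'(3) prime_dvd_mult_iff by blast
        obtain a where a: "B v w = of_int a" using wI[OF v(4)] by (auto elim: Ints_cases)
        obtain q1 where q1: "B w w = 2 * of_int q1" using even_inD[OF evw] by blast
        obtain q2 where q2: "B (w - (of_int i / of_int p) *\<^sub>R v) (w - (of_int i / of_int p) *\<^sub>R v) = 2 * of_int q2"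
          using even_inD[OF ev y] by blast
        have "2 * real_of_int q2 = 2 * of_int q1 - 2 * (of_int i / of_int p) * of_int a
            + (of_int i / of_int p)\<^sup>2 * (2 * of_int m)"
          using q2 q1 a v(5) sym[of w v] by (simp add: algebra_simps power2_eq_square)
        then have "(of_int p)\<^sup>2 * real_of_int q2 = (of_int p)\<^sup>2 * of_int q1 - of_int p * of_int i * of_int a + (of_int i)\<^sup>2 * of_int m"
          using p0 by (simp add: field_simps power2_eq_square)
        then have "real_of_int (i\<^sup>2 * m) = of_int (p * (p * q2 - p * q1 + i * a))"
          by (simp add: algebra_simps power2_eq_square)
        then have "i\<^sup>2 * m = p * (p * q2 - p * q1 + i * a)" by (simp only: of_int_eq_iff)
        then have "p dvd i\<^sup>2 * m" by simp
        then have "p dvd m" using ni M'(3) by (simp add: prime_dvd_mult_iff prime_dvd_power_iff)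
        then have "p dvd 1" using pc u(4) by (metis coprime_common_divisor)
        then show False using M'(3) not_prime_unit by blast
      qed
      have "\<exists>g. isometry g \<and> g v = v \<and> g ` M' = neighbour M' w"
      proof (rule neighbour_isometric[OF S M'(2) ev _ _ _ _ _ _ _ _ _ _ M'(3)])
        show "h e \<in> M'" "h f \<in> M'" "h y0 \<in> M'" using h(3) ef v by blast+
        show "v \<in> M'" using h(2,3) v(1) by (metis imageI)
        show "B (h e) (h e) = 0" "B (h f) (h f) = 0" "B (h e) (h f) = 1" using hD(3) ef by simp_all
        show "B (h e) v = 0" "B (h f) v = 0" "B v (h y0) = 1" using hD(3)[of _ v] hD(3)[of v] h(2) ef v by simp_all
        show "w \<in> S" using wL unimodular_inD(2)[OF L(1)] by blast
        show "of_int p *\<^sub>R w \<in> M'" "w \<notin> M'" using M'(4,5) by (simp_all add: w_def)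
      qed (use evw wI v nv in auto)
      then obtain g' where g': "isometry g'" "g' v = v" "g' ` M' = neighbour M' w" by blast
      have "isometry (g' \<circ> h)" "(g' \<circ> h) v = v" "(g' \<circ> h) ` M = neighbour M' w"
        using isometry_comp[OF g'(1) h(1)] g'(2,3) h(2,3) by (simp, simp, metis image_comp)
      moreover have "u \<in> neighbour M' w" by (rule neighbour_mem[OF h(4) wI[OF u(2)]])
      moreover have "T \<subseteq> neighbour M' w" using h(5) insert.prems wI by (auto intro!: neighbour_mem)
      ultimately have "P (neighbour M' w)" unfolding P_def by blast
      moreover have "unimodular_in S (neighbour M' w)"
        using unimodular_inD(2)[OF L(1) wL] M' wI[OF wL] by (intro neighbour_unimodular[OF S M'(2,3)]) (simp_all add: w_def)
      ultimately show "P (neighbour M' (of_int j *\<^sub>R t)) \<and> unimodular_in S (neighbour M' (of_int j *\<^sub>R t))"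
        by (simp add: w_def)
    qed
  qed
  then obtain M' where M': "P M'" "unimodular_in S M'" "t \<in> M'" by blast
  then obtain g where "isometry g" "g v = v" "g ` M = M'" "u \<in> M'" "T \<subseteq> M'" unfolding P_def by blast
  then show ?case using M' by (intro exI[of _ g]) auto
qed

end

section \<open>Isotropic vectors and frames\<close>

context symmetric_form
begin

text \<open>The number d is the least positive pairing of x with a lattice vector. By division with
  remainder it divides all pairings, so x / d is in the dual lattice.\<close>

lemma unimodular_divisor:
  assumes S: "rational_subspace S" and L: "unimodular_in S L" and x: "x \<in> L" and y: "y \<in> L" "B x y \<noteq> 0"
  shows "\<exists>d>0. (1 / of_int d) *\<^sub>R x \<in> L \<and> (\<exists>y\<in>L. B x y = of_int d)"
proof -
  note LD = unimodular_inD[OF L]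
  define Q where "Q n \<longleftrightarrow> n > 0 \<and> (\<exists>y\<in>L. B x y = of_nat n)" for n
  obtain k where k: "B x y = of_int k" using LD(5)[OF x y(1)] by (auto elim: Ints_cases)
  have "Q (nat \<bar>k\<bar>)"
  proof (cases "k > 0")
    case True
    then show ?thesis using k y by (auto simp: Q_def)
  next
    case False
    moreover have "k \<noteq> 0" using k y by auto
    ultimately have "B x (- y) = of_nat (nat \<bar>k\<bar>)" "nat \<bar>k\<bar> > 0" using k by simp_all
    then show ?thesis unfolding Q_def using LD(7)[OF y(1)] by blast
  qed
  then have Q: "Q (LEAST n. Q n)" and least: "\<And>n. Q n \<Longrightarrow> (LEAST n. Q n) \<le> n" by (auto intro: LeastI Least_le)
  define d where "d = int (LEAST n. Q n)"
  obtain y1 where d: "d > 0" "y1 \<in> L" "B x y1 = of_int d" using Q by (auto simp: Q_def d_def)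
  have dvd: "d dvd n" if z: "z \<in> L" "B x z = of_int n" for z n
  proof (rule ccontr)
    assume "\<not> d dvd n"
    then have "n mod d \<noteq> 0" by (simp add: dvd_eq_mod_eq_0)
    then have pos: "0 < n mod d" "n mod d < d" 
      using pos_mod_sign[OF d(1), of n] pos_mod_bound[OF d(1), of n] by linarith+
    have "B x (z - of_int (n div d) *\<^sub>R y1) = of_int (n - (n div d) * d)" using z d by simp
    also have "n - (n div d) * d = n mod d" by (simp add: minus_div_mult_eq_mod)
    also have "real_of_int (n mod d) = of_nat (nat (n mod d))" using pos by simp
    finally have "B x (z - of_int (n div d) *\<^sub>R y1) = real (nat (n mod d))" .
    then have "Q (nat (n mod d))" using pos LD(3)[OF z(1) LD(9)[OF d(2), of "n div d"]] unfolding Q_def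
      by (intro conjI bexI[of _ "z - of_int (n div d) *\<^sub>R y1"]) simp_all
    then have "d \<le> n mod d" using least[of "nat (n mod d)"] pos by (simp add: d_def)
    then show False using pos by simp
  qed
  have "(1 / of_int d) *\<^sub>R x \<in> L"
  proof (rule LD(6))
    show "(1 / of_int d) *\<^sub>R x \<in> S" using LD(2)[OF x] by (intro rational_subspaceD(3)[OF S]) auto
    fix z assume z: "z \<in> L"
    then obtain n where n: "B x z = of_int n" using LD(5)[OF x] by (auto elim: Ints_cases)
    then obtain q where "n = d * q" using dvd[OF z] by (auto elim: dvdE)
    then show "B ((1 / of_int d) *\<^sub>R x) z \<in> \<int>" using n d(1) by simp
  qed
  then show ?thesis using d by blast
qed

lemma primitive_pairing:
  assumes S: "rational_subspace S" and L: "unimodular_in S L" and v: "primitive_in L v" "B v v \<noteq> 0"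
  shows "\<exists>y\<in>L. B v y = 1"
proof -
  have vL: "v \<in> L" using v(1) by (simp add: primitive_in_def)
  obtain d :: int and y where d: "d > 0" "(1 / of_int d) *\<^sub>R v \<in> L" "y \<in> L" "B v y = of_int d"
    using unimodular_divisor[OF S L vL vL v(2)] by auto
  have "\<not> d > 1" using v(1) d(2) unfolding primitive_in_def by (metis inverse_eq_divide)
  then have "d = 1" using d(1) by linarith
  then show ?thesis using d by auto
qed

lemma pairing_primitive:
  assumes L: "unimodular_in S L" and v: "v \<in> L" "y \<in> L" "B v y = 1"
  shows "primitive_in L v"
  unfolding primitive_in_def
proof (intro conjI allI impI notI)
  fix k :: int assume k: "1 < k" "v /\<^sub>R of_int k \<in> L"
  then have "B (v /\<^sub>R of_int k) y \<in> \<int>" using unimodular_inD(5)[OF L _ v(2)] by blast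
  then obtain j where "inverse (of_int k) = real_of_int j" using v(3) by (auto elim: Ints_cases)
  then have "real_of_int (k * j) = 1" using k(1) by (simp add: field_simps)
  then have "k * j = 1" by (metis of_int_1 of_int_eq_iff)
  then show False using k(1) zmult_eq_1_iff by fastforce
qed (rule v(1))

text \<open>After clearing denominators and dividing by the least positive pairing, the isotropic
  vector pairs to 1 with some \<open>y1\<close>. The norm of \<open>y1\<close> is even, so an
  integral multiple of \<open>e\<close> makes it isotropic.\<close>

lemma isotropic_pair:
  assumes S: "rational_subspace S" and L: "unimodular_in S L" "even_in L"
    and z: "z \<in> S" "y \<in> S" "B z z = 0" "B z y \<noteq> 0"
  shows "\<exists>e f. e \<in> L \<and> f \<in> L \<and> B e e = 0 \<and> B f f = 0 \<and> B e f = 1"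
proof -
  note LD = unimodular_inD[OF L(1)]
  obtain k l :: int where k: "k > 0" "of_int k *\<^sub>R z \<in> L" and l: "l > 0" "of_int l *\<^sub>R y \<in> L"
    using LD(4)[OF z(1)] LD(4)[OF z(2)] by auto
  have "B (of_int k *\<^sub>R z) (of_int l *\<^sub>R y) \<noteq> 0" using k l z by simp
  from unimodular_divisor[OF S L(1) k(2) l(2) this]
  obtain d :: int and y1 where d: "d > 0" "(1 / of_int d) *\<^sub>R (of_int k *\<^sub>R z) \<in> L" "y1 \<in> L" "B (of_int k *\<^sub>R z) y1 = of_int d"
    by auto
  define e where "e = (1 / of_int d) *\<^sub>R (of_int k *\<^sub>R z)"
  have e: "e \<in> L" "B e e = 0" "B e y1 = 1" using d z by (simp_all add: e_def)
  obtain q where q: "B y1 y1 = 2 * of_int q" using even_inD[OF L(2) d(3)] by blast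
  define f where "f = y1 - of_int q *\<^sub>R e"
  have "f \<in> L" unfolding f_def by (intro LD(3,9) d(3) e(1))
  moreover have "B f f = 0" "B e f = 1" using e q sym[of y1 e] by (simp_all add: f_def)
  ultimately show ?thesis using e by blast
qed

text \<open>The isotropic vectors \<open>k\<^sup>2 f + k y - (y, y)/2 e\<close> with \<open>y\<close> orthogonal to \<open>e, f\<close>; their
  inner product with \<open>v\<close> is a quadratic form in \<open>(k, y)\<close> that vanishes identically modulo no prime.\<close>

definition iso_vec :: "'v \<Rightarrow> 'v \<Rightarrow> real \<Rightarrow> 'v \<Rightarrow> 'v" where
  "iso_vec e f k y = (k\<^sup>2) *\<^sub>R f + k *\<^sub>R y - (B y y / 2) *\<^sub>R e"

lemma iso_vec_isotropic:
  assumes "B e e = 0" "B f f = 0" "B e f = 1" "B e y = 0" "B f y = 0"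
  shows "B (iso_vec e f k y) (iso_vec e f k y) = 0"
  using assms sym[of f e] sym[of y e] sym[of y f]
  by (simp add: iso_vec_def algebra_simps power2_eq_square)

lemma iso_vec_mem:
  assumes L: "unimodular_in S L" "even_in L" and m: "e \<in> L" "f \<in> L" "y \<in> L"
  shows "iso_vec e f (of_int k) y \<in> L"
proof -
  note LD = unimodular_inD[OF L(1)]
  obtain q where q: "B y y = 2 * of_int q" using even_inD[OF L(2) m(3)] by blast
  have "iso_vec e f (of_int k) y = of_int (k\<^sup>2) *\<^sub>R f + of_int k *\<^sub>R y - of_int q *\<^sub>R e"
    by (simp add: iso_vec_def q)
  also have "\<dots> \<in> L" by (intro LD(3,8,9) m)
  finally show ?thesis .
qed

text \<open>The pairing is a quadratic form in (k, y), and the bracket is its polar form. This is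
  what allows solutions at different primes to be combined.\<close>

lemma iso_vec_pairing_combine:
  "B v (iso_vec e f (a * k + b * l) (a *\<^sub>R y + b *\<^sub>R z)) =
     a\<^sup>2 * B v (iso_vec e f k y) + b\<^sup>2 * B v (iso_vec e f l z) +
     a * b * (2 * k * l * B v f + k * B v z + l * B v y - B y z * B v e)"
  using sym[of z y] by (simp add: iso_vec_def algebra_simps power2_eq_square)

text \<open>If p does not divide \<open>B v f\<close>, the vector \<open>f\<close> itself works. If
  it does not divide \<open>B v e\<close>, a multiple of \<open>e\<close> works, given by a y with
  half norm prime to p: such a y is among \<open>Y\<close>, \<open>Y'\<close>,
  \<open>Y + Y'\<close>, whose half norms are q1, q2, q1 + q2 + 1. If p divides both, the component
  of \<open>y0\<close> orthogonal to the plane still pairs to 1 with \<open>v\<close> modulo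
  p.\<close>

lemma iso_vec_prime:
  assumes S: "rational_subspace S" and L: "unimodular_in S L" "even_in L"
    and ef: "e \<in> L" "f \<in> L" "B e e = 0" "B f f = 0" "B e f = 1"
    and v: "v \<in> L" "y0 \<in> L" "B v y0 = 1"
    and Y: "Y \<in> L" "Y' \<in> L" "B e Y = 0" "B f Y = 0" "B e Y' = 0" "B f Y' = 0" "B Y Y' = 1"
    and p: "prime p"
  shows "\<exists>k y c. y \<in> L \<and> B e y = 0 \<and> B f y = 0 \<and> B v (iso_vec e f (of_int k) y) = of_int c \<and> \<not> p dvd c"
proof -
  note LD = unimodular_inD[OF L(1)]
  have p1: "\<not> p dvd 1" using p not_prime_unit by blast
  obtain a b where a: "B v e = of_int a" and b: "B v f = of_int b"
    using LD(5)[OF v(1) ef(1)] LD(5)[OF v(1) ef(2)] by (auto elim!: Ints_cases)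
  consider "\<not> p dvd b" | "\<not> p dvd a" | "p dvd a" "p dvd b" by blast
  then show ?thesis
  proof cases
    case 1
    then show ?thesis using b LD(1)
      by (intro exI[of _ 1] exI[of _ 0] exI[of _ b]) (simp add: iso_vec_def)
  next
    case 2
    have *: ?thesis if y: "y \<in> L" "B e y = 0" "B f y = 0" "B y y = 2 * of_int q" "\<not> p dvd q" for y q
    proof (intro exI conjI)
      show "B v (iso_vec e f (of_int 0) y) = of_int (- q * a)" using y a by (simp add: iso_vec_def)
      show "\<not> p dvd - q * a" using y 2 p by (simp add: prime_dvd_mult_iff)
    qed (use y in auto)
    obtain q1 q2 where q: "B Y Y = 2 * of_int q1" "B Y' Y' = 2 * of_int q2"
      using even_inD[OF L(2) Y(1)] even_inD[OF L(2) Y(2)] by blast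
    have "B (Y + Y') (Y + Y') = 2 * of_int (q1 + q2 + 1)" using q Y(7) sym[of Y' Y] by simp
    moreover have "\<not> p dvd q1 \<or> \<not> p dvd q2 \<or> \<not> p dvd q1 + q2 + 1"
    proof (rule ccontr)
      assume "\<not> ?thesis"
      then have "p dvd (q1 + q2 + 1) - q1 - q2" by (intro dvd_diff) auto
      then show False using p1 by simp
    qed
    ultimately show ?thesis using *[OF Y(1,3,4) q(1)] *[OF Y(2,5,6) q(2)] *[of "Y + Y'" "q1 + q2 + 1"] Y LD(8)
      by auto
  next
    case 3
    define y where "y = y0 - B f y0 *\<^sub>R e - B e y0 *\<^sub>R f"
    have y: "y \<in> L" "B e y = 0" "B f y = 0"
      unfolding y_def by (rule project_hyperbolic[OF L(1) ef v(2)])+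
    obtain i j where ij: "B f y0 = of_int i" "B e y0 = of_int j"
      using LD(5)[OF ef(2) v(2)] LD(5)[OF ef(1) v(2)] by (auto elim!: Ints_cases)
    obtain q where q: "B y y = 2 * of_int q" using even_inD[OF L(2) y(1)] by blast
    have "B v y = of_int (1 - i * a - j * b)" using v(3) a b ij by (simp add: y_def)
    then have e: "B v (iso_vec e f (of_int 1) y) = of_int (b + (1 - i * a - j * b) - q * a)"
      using q a b by (simp add: iso_vec_def)
    have "\<not> p dvd b + (1 - i * a - j * b) - q * a"
    proof
      assume "p dvd b + (1 - i * a - j * b) - q * a"
      moreover have "p dvd b - i * a - j * b - q * a" using 3 by (intro dvd_diff dvd_mult)
      ultimately have "p dvd (b + (1 - i * a - j * b) - q * a) - (b - i * a - j * b - q * a)" by (rule dvd_diff)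
      then show False using p1 by simp
    qed
    then show ?thesis using y e by blast
  qed
qed

text \<open>Chinese remaindering: the old solution is multiplied by the new prime p, and the new one
  by the product R of the old primes. Modulo p only \<open>R\<^sup>2 * d\<close> survives, and
  modulo a prime of Q only \<open>p\<^sup>2 * c\<close>.\<close>

lemma iso_vec_primes:
  assumes S: "rational_subspace S" and L: "unimodular_in S L" "even_in L"
    and ef: "e \<in> L" "f \<in> L" "B e e = 0" "B f f = 0" "B e f = 1"
    and v: "v \<in> L" "y0 \<in> L" "B v y0 = 1"
    and Y: "Y \<in> L" "Y' \<in> L" "B e Y = 0" "B f Y = 0" "B e Y' = 0" "B f Y' = 0" "B Y Y' = 1"
    and Q: "finite Q" "\<And>p. p \<in> Q \<Longrightarrow> prime p"
  shows "\<exists>k y c. y \<in> L \<and> B e y = 0 \<and> B f y = 0 \<and> B v (iso_vec e f (of_int k) y) = of_int c \<and> (\<forall>p\<in>Q. \<not> p dvd c)"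
  using Q
proof (induction Q)
  case empty
  show ?case
    by (rule exI[of _ 0], rule exI[of _ 0], rule exI[of _ 0]) (simp add: iso_vec_def unimodular_inD(1)[OF L(1)])
next
  case (insert p Q)
  note LD = unimodular_inD[OF L(1)]
  obtain k y c where k: "y \<in> L" "B e y = 0" "B f y = 0" "B v (iso_vec e f (of_int k) y) = of_int c" "\<forall>p\<in>Q. \<not> p dvd c"
    using insert by auto
  have p: "prime p" using insert by simp
  from iso_vec_prime[OF S L ef v Y p] obtain l z d
    where l: "z \<in> L" "B e z = 0" "B f z = 0" "B v (iso_vec e f (of_int l) z) = of_int d" "\<not> p dvd d" by blast
  define R where "R = (\<Prod>q\<in>Q. q)"
  obtain g where g: "2 * of_int k * of_int l * B v f + of_int k * B v z + of_int l * B v y - B y z * B v e = of_int g"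
  proof -
    have "2 * of_int k * of_int l * B v f + of_int k * B v z + of_int l * B v y - B y z * B v e \<in> \<int>"
      by (intro Ints_add Ints_diff Ints_mult LD(5) k(1) l(1) v(1) ef(1,2) Ints_of_int Ints_numeral)
    then show ?thesis using that by (auto elim: Ints_cases)
  qed
  have pR: "\<not> p dvd R"
  proof
    assume "p dvd R"
    then obtain q where q: "q \<in> Q" "p dvd q" unfolding R_def using prime_dvd_prod_iff[OF insert.hyps(1) p] by auto
    then have "p = q" using insert.prems p by (metis insertCI primes_dvd_imp_eq)
    then show False using q insert.hyps by simp
  qed
  have "B v (iso_vec e f (of_int (p * k + R * l)) (of_int p *\<^sub>R y + of_int R *\<^sub>R z)) =
      of_int (p\<^sup>2 * c + R\<^sup>2 * d + p * R * g)"
    using iso_vec_pairing_combine[of v e f "of_int p" "of_int k" "of_int R" "of_int l" y z] k(4) l(4) g by simp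
  moreover have "\<not> q dvd p\<^sup>2 * c + R\<^sup>2 * d + p * R * g" if q: "q \<in> insert p Q" for q
  proof (cases "q = p")
    case True
    have "p dvd p\<^sup>2 * c + p * R * g" by (simp add: power2_eq_square)
    moreover have "\<not> p dvd R\<^sup>2 * d" using pR l(5) p by (simp add: prime_dvd_mult_iff prime_dvd_power_iff)
    ultimately have "\<not> p dvd (p\<^sup>2 * c + p * R * g) + R\<^sup>2 * d" by (simp only: dvd_add_right_iff) simp
    then show ?thesis using True by (simp add: algebra_simps)
  next
    case False
    then have qQ: "q \<in> Q" "prime q" using q insert.prems by auto
    have "\<not> q dvd p" using False qQ p primes_dvd_imp_eq by blast
    then have n: "\<not> q dvd p\<^sup>2 * c" using k(5) qQ by (simp add: prime_dvd_mult_iff prime_dvd_power_iff)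
    have "q dvd R" unfolding R_def using insert.hyps(1) qQ(1) by (rule dvd_prodI)
    then have "q dvd R\<^sup>2 * d + p * R * g" by (simp add: power2_eq_square)
    then have "\<not> q dvd (R\<^sup>2 * d + p * R * g) + p\<^sup>2 * c" using n by (simp only: dvd_add_right_iff) simp
    then show ?thesis by (simp add: algebra_simps)
  qed
  moreover have "of_int p *\<^sub>R y + of_int R *\<^sub>R z \<in> L" by (intro LD(8,9) k(1) l(1))
  moreover have "B e (of_int p *\<^sub>R y + of_int R *\<^sub>R z) = 0" "B f (of_int p *\<^sub>R y + of_int R *\<^sub>R z) = 0"
    using k l by simp_all
  ultimately show ?case by blast
qed

section \<open>Frames and the standard lattice\<close>

lemma diagonal_replicate_orthonormal:
  assumes "diagonal S (replicate_mset N 1)"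
  shows "\<exists>E :: nat \<Rightarrow> 'v. (\<forall>i<N. E i \<in> S) \<and> (\<forall>i<N. \<forall>j<N. B (E i) (E j) = (if i = j then 1 else 0)) \<and>
    (\<forall>x\<in>S. (\<forall>i<N. B (E i) x = 0) \<longrightarrow> x = 0)"
proof -
  obtain X where X: "diagonalizes X S (replicate_mset N 1)" using assms unfolding diagonal_def ..
  note D = diagonalizesD[OF X]
  have "size (image_mset (\<lambda>x. B x x) (mset_set X)) = N" unfolding D(5) by simp
  then have "card X = N" by simp
  then obtain E where E: "bij_betw E {..<N} X" using ex_bij_betw_nat_finite[OF D(1)] by (metis atLeast0LessThan)
  have one: "B x x = 1" if "x \<in> X" for x
  proof -
    have "B x x \<in># image_mset (\<lambda>x. B x x) (mset_set X)" using that D(1) by simp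
    then show ?thesis unfolding D(5) by (simp split: if_splits)
  qed
  have EX: "E i \<in> X" if "i < N" for i using that E by (auto simp: bij_betw_def)
  have "B (E i) (E j) = (if i = j then 1 else 0)" if "i < N" "j < N" for i j
  proof (cases "i = j")
    case False
    then have "E i \<noteq> E j" using E that by (auto simp: bij_betw_def dest: inj_onD)
    then show ?thesis using D(4) EX that False by simp
  qed (use one EX that in simp)
  moreover have "x = 0" if "x \<in> S" "\<forall>i<N. B (E i) x = 0" for x
  proof -
    have "X = E ` {..<N}" using E by (simp add: bij_betw_def)
    then have "\<forall>y\<in>X. B y x = 0" using that(2) by simp
    then show ?thesis using D(6) that(1) by blast
  qed
  ultimately show ?thesis using EX D(2) by (intro exI[of _ E]) auto
qed

text \<open>A rational basis adapted to a Witt decomposition. The pair \<open>e, f\<close> only has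
  to lie in the space, not in a given lattice, so that \<open>f\<close> may have a
  denominator.\<close>

definition frame :: "'v set \<Rightarrow> nat \<Rightarrow> 'v \<Rightarrow> 'v \<Rightarrow> (nat \<Rightarrow> 'v) \<Rightarrow> bool" where
  "frame S N e f E \<longleftrightarrow> e \<in> S \<and> f \<in> S \<and> (\<forall>i<N. E i \<in> S) \<and> B e e = 0 \<and> B f f = 0 \<and> B e f = 1 \<and>
     (\<forall>i<N. B e (E i) = 0 \<and> B f (E i) = 0) \<and> (\<forall>i<N. \<forall>j<N. B (E i) (E j) = (if i = j then 1 else 0)) \<and>
     (\<forall>x\<in>S. B e x = 0 \<longrightarrow> B f x = 0 \<longrightarrow> (\<forall>i<N. B (E i) x = 0) \<longrightarrow> x = 0)"

lemma frameD:
  assumes "frame S N e f E"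
  shows "e \<in> S" "f \<in> S" "i < N \<Longrightarrow> E i \<in> S" "B e e = 0" "B f f = 0" "B e f = 1" "B f e = 1"
    "i < N \<Longrightarrow> B e (E i) = 0" "i < N \<Longrightarrow> B f (E i) = 0" "i < N \<Longrightarrow> B (E i) e = 0" "i < N \<Longrightarrow> B (E i) f = 0"
    "i < N \<Longrightarrow> j < N \<Longrightarrow> B (E i) (E j) = (if i = j then 1 else 0)"
    "x \<in> S \<Longrightarrow> B e x = 0 \<Longrightarrow> B f x = 0 \<Longrightarrow> (\<And>i. i < N \<Longrightarrow> B (E i) x = 0) \<Longrightarrow> x = 0"
  using assms sym[of f e] sym[of e "E i"] sym[of f "E i"] unfolding frame_def by auto

text \<open>The plane of \<open>e, f\<close> has the orthogonal basis e + f / 2, e - f / 2 with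
  norms 1 and - 1. Cancelling both from the diagonal leaves unit norms for its complement.\<close>

lemma frame_exists:
  assumes S: "rational_subspace S" and d: "diagonal S (replicate_mset (Suc N) 1 + {#- 1#})"
    and ef: "e \<in> S" "f \<in> S" "B e e = 0" "B f f = 0" "B e f = 1"
  shows "\<exists>E. frame S N e f E"
proof -
  have fe: "B f e = 1" using ef(5) sym by simp
  define x where "x = e + (1 / 2) *\<^sub>R f"
  define y where "y = e - (1 / 2) *\<^sub>R f"
  have xy: "x \<in> S" "y \<in> S" using ef rational_subspaceD[OF S] by (auto simp: x_def y_def)
  have n: "B x x = of_int 1" "B y y = of_int (- 1)" "B x y = 0" using ef fe by (simp_all add: x_def y_def)
  have "diagonal (orth S x) (replicate_mset N 1 + {#- 1#})"
    by (rule diagonal_cancel[OF S _ xy(1) n(1)]) (use d in \<open>simp add: add_mset_commute\<close>)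
  then have "diagonal (orth S x) (add_mset (- 1) (replicate_mset N 1))" by simp
  then have "diagonal (orth (orth S x) y) (replicate_mset N 1)"
    by (rule diagonal_cancel[OF rational_subspace_orth[OF S] _ _ n(2)]) (use xy n in \<open>simp add: orth_def\<close>)
  from diagonal_replicate_orthonormal[OF this]
  obtain E where E: "\<forall>i<N. E i \<in> orth (orth S x) y" "\<forall>i<N. \<forall>j<N. B (E i) (E j) = (if i = j then 1 else 0)"
    "\<forall>z\<in>orth (orth S x) y. (\<forall>i<N. B (E i) z = 0) \<longrightarrow> z = 0"
    by (elim exE conjE) (rule that)
  have *: "z \<in> orth (orth S x) y \<longleftrightarrow> z \<in> S \<and> B e z = 0 \<and> B f z = 0" for z
    by (auto simp: orth_def x_def y_def)
  show ?thesis unfolding frame_def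
  proof (intro exI[of _ E] conjI)
    show "\<forall>z\<in>S. B e z = 0 \<longrightarrow> B f z = 0 \<longrightarrow> (\<forall>i<N. B (E i) z = 0) \<longrightarrow> z = 0"
      using E(3) * by simp
    show "\<forall>i<N. E i \<in> S" "\<forall>i<N. B e (E i) = 0 \<and> B f (E i) = 0" using E(1) * by simp_all
  qed (fact ef E(2))+
qed

lemma frame_expand:
  assumes S: "rational_subspace S" and F: "frame S N e f E" and x: "x \<in> S"
  shows "x = B f x *\<^sub>R e + B e x *\<^sub>R f + (\<Sum>i<N. B (E i) x *\<^sub>R E i)"
proof -
  note D = frameD[OF F] and SD = rational_subspaceD[OF S]
  have mem: "(\<Sum>i<n. B (E i) x *\<^sub>R E i) \<in> S" if "n \<le> N" for n
    using that by (induction n) (auto intro!: SD(1,2,3,4) D(3) x)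
  define z where "z = x - (B f x *\<^sub>R e + B e x *\<^sub>R f + (\<Sum>i<N. B (E i) x *\<^sub>R E i))"
  have "z \<in> S" unfolding z_def by (intro SD(2,3,4,5) mem x D(1,2)) simp
  moreover have "B e z = 0" "B f z = 0" using D by (simp_all add: z_def form_sum_right)
  moreover have "B (E j) z = 0" if j: "j < N" for j
  proof -
    have "(\<Sum>i<N. B (E i) x * B (E j) (E i)) = (\<Sum>i<N. if i = j then B (E j) x else 0)"
      using D(12) j by (intro sum.cong) auto
    also have "\<dots> = B (E j) x" using j by simp
    finally show ?thesis using D(10,11)[OF j] by (simp add: z_def form_sum_right)
  qed
  ultimately have "z = 0" by (intro D(13))
  then show ?thesis by (simp add: z_def)
qed

lemma frame_expand_UNIV:
  assumes S: "rational_subspace S" "span S = UNIV" and F: "frame S N e f E"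
  shows "x = B f x *\<^sub>R e + B e x *\<^sub>R f + (\<Sum>i<N. B (E i) x *\<^sub>R E i)"
proof -
  have "linear (\<lambda>x. B f x *\<^sub>R e + B e x *\<^sub>R f + (\<Sum>i<N. B (E i) x *\<^sub>R E i))"
    by (rule linearI) (simp_all add: algebra_simps sum.distrib scaleR_sum_right)
  from linear_eq_on[OF linear_ident this, of x S] show ?thesis
    using frame_expand[OF S(1) F] S(2) by simp
qed

lemma frame_form:
  assumes S: "rational_subspace S" "span S = UNIV" and F: "frame S N e f E"
  shows "B x y = B f x * B e y + B e x * B f y + (\<Sum>i<N. B (E i) x * B (E i) y)"
proof -
  have "B x y = B (B f x *\<^sub>R e + B e x *\<^sub>R f + (\<Sum>i<N. B (E i) x *\<^sub>R E i)) y"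
    using frame_expand_UNIV[OF S F, of x] by simp
  also have "\<dots> = B f x * B e y + B e x * B f y + (\<Sum>i<N. B (E i) x * B (E i) y)"
    by (simp add: form_sum_left)
  finally show ?thesis .
qed

text \<open>The sum of a hyperbolic plane and the even unimodular lattice \<open>D\<^sub>N\<^sup>+\<close>.\<close>

definition frame_lattice :: "'v set \<Rightarrow> nat \<Rightarrow> 'v \<Rightarrow> 'v \<Rightarrow> (nat \<Rightarrow> 'v) \<Rightarrow> 'v set" where
  "frame_lattice S N e f E = {x\<in>S. B e x \<in> \<int> \<and> B f x \<in> \<int> \<and>
     ((\<forall>i<N. B (E i) x \<in> \<int>) \<or> (\<forall>i<N. B (E i) x - 1 / 2 \<in> \<int>)) \<and> (\<Sum>i<N. B (E i) x) / 2 \<in> \<int>}"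

lemma frame_lattice_diff:
  assumes S: "rational_subspace S" and x: "x \<in> frame_lattice S N e f E" and y: "y \<in> frame_lattice S N e f E"
  shows "x - y \<in> frame_lattice S N e f E"
proof -
  have "(\<forall>i<N. B (E i) (x - y) \<in> \<int>) \<or> (\<forall>i<N. B (E i) (x - y) - 1 / 2 \<in> \<int>)"
  proof -
    consider "\<forall>i<N. B (E i) x \<in> \<int>" "\<forall>i<N. B (E i) y \<in> \<int>"
      | "\<forall>i<N. B (E i) x - 1 / 2 \<in> \<int>" "\<forall>i<N. B (E i) y - 1 / 2 \<in> \<int>"
      | "\<forall>i<N. B (E i) x - 1 / 2 \<in> \<int>" "\<forall>i<N. B (E i) y \<in> \<int>"
      | "\<forall>i<N. B (E i) x \<in> \<int>" "\<forall>i<N. B (E i) y - 1 / 2 \<in> \<int>"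
      using x y unfolding frame_lattice_def by blast
    then show ?thesis
    proof cases
      case 1
      then show ?thesis by auto
    next
      case 2
      have "B (E i) (x - y) \<in> \<int>" if "i < N" for i
      proof -
        have "(B (E i) x - 1 / 2) - (B (E i) y - 1 / 2) \<in> \<int>"
          by (rule Ints_diff[OF 2(1)[rule_format, OF that] 2(2)[rule_format, OF that]])
        then show ?thesis by simp
      qed
      then show ?thesis by (simp del: form_simps)
    next
      case 3
      have "B (E i) (x - y) - 1 / 2 \<in> \<int>" if "i < N" for i
      proof -
        have "(B (E i) x - 1 / 2) - B (E i) y \<in> \<int>"
          by (rule Ints_diff[OF 3(1)[rule_format, OF that] 3(2)[rule_format, OF that]])
        then show ?thesis by (simp add: algebra_simps)
      qed
      then show ?thesis by (simp del: form_simps)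
    next
      case 4
      have "B (E i) (x - y) - 1 / 2 \<in> \<int>" if "i < N" for i
      proof -
        have "B (E i) x - (B (E i) y - 1 / 2) - 1 \<in> \<int>"
          by (rule Ints_diff[OF Ints_diff[OF 4(1)[rule_format, OF that] 4(2)[rule_format, OF that]] Ints_1])
        then show ?thesis by (simp add: algebra_simps)
      qed
      then show ?thesis by (simp del: form_simps)
    qed
  qed
  moreover have "(\<Sum>i<N. B (E i) (x - y)) / 2 \<in> \<int>"
  proof -
    have "(\<Sum>i<N. B (E i) x) / 2 - (\<Sum>i<N. B (E i) y) / 2 \<in> \<int>"
      using x y unfolding frame_lattice_def by (intro Ints_diff) auto
    then show ?thesis by (simp add: sum_subtractf diff_divide_distrib)
  qed
  ultimately show ?thesis using x y rational_subspaceD(5)[OF S] unfolding frame_lattice_def by auto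
qed

lemma pronic_even: "(of_int n * (of_int n + 1) :: real) / 2 \<in> \<int>"
proof -
  have "even (n * (n + 1))" by simp
  then obtain k where "n * (n + 1) = 2 * k" by (rule dvdE)
  then have "real_of_int (n * (n + 1)) = of_int (2 * k)" by (simp only:)
  then have "(of_int n * (of_int n + 1) :: real) / 2 = of_int k" by simp
  then show ?thesis by simp
qed

text \<open>For integral coordinates the sum of squares has the parity of the coordinate sum. For
  half-integral ones each square is 1 / 4 plus an even integer, and the quarters add up to N / 4,
  which is even as 8 divides N.\<close>

lemma frame_lattice_even:
  assumes S: "rational_subspace S" "span S = UNIV" and F: "frame S N e f E" and N: "8 dvd N"
  shows "even_in (frame_lattice S N e f E)"
  unfolding even_in_def
proof
  fix x assume x: "x \<in> frame_lattice S N e f E"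
  then have ef: "B e x \<in> \<int>" "B f x \<in> \<int>" "(\<Sum>i<N. B (E i) x) / 2 \<in> \<int>" unfolding frame_lattice_def by auto
  have "(\<Sum>i<N. B (E i) x * B (E i) x) / 2 \<in> \<int>"
  proof (cases "\<forall>i<N. B (E i) x \<in> \<int>")
    case True
    have "(\<Sum>i<N. B (E i) x * (B (E i) x + 1) / 2) - (\<Sum>i<N. B (E i) x) / 2 \<in> \<int>"
    proof (intro Ints_diff ef(3) Ints_sum)
      fix i assume "i \<in> {..<N}"
      then obtain n where "B (E i) x = of_int n" using True by (auto elim: Ints_cases)
      then show "B (E i) x * (B (E i) x + 1) / 2 \<in> \<int>" using pronic_even[of n] by simp
    qed
    also have "(\<Sum>i<N. B (E i) x * (B (E i) x + 1) / 2) - (\<Sum>i<N. B (E i) x) / 2 = (\<Sum>i<N. B (E i) x * B (E i) x) / 2"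
      by (simp add: sum_divide_distrib sum_subtractf[symmetric]) (simp add: field_simps)
    finally show ?thesis .
  next
    case False
    then have h: "\<forall>i<N. B (E i) x - 1 / 2 \<in> \<int>" using x unfolding frame_lattice_def by auto
    obtain k where k: "N = 8 * k" using N by (rule dvdE)
    have "(\<Sum>i<N. (B (E i) x * B (E i) x - 1 / 4) / 2) + of_nat k \<in> \<int>"
    proof (intro Ints_add Ints_sum)
      fix i assume "i \<in> {..<N}"
      then have "B (E i) x - 1 / 2 \<in> \<int>" using h by auto
      then obtain n where "B (E i) x - 1 / 2 = of_int n" by (auto elim: Ints_cases)
      then have n: "B (E i) x = of_int n + 1 / 2" by simp
      show "(B (E i) x * B (E i) x - 1 / 4) / 2 \<in> \<int>" using pronic_even[of n] unfolding n by (simp add: algebra_simps)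
    qed simp
    also have "(\<Sum>i<N. (B (E i) x * B (E i) x - 1 / 4) / 2) + of_nat k = (\<Sum>i<N. B (E i) x * B (E i) x) / 2"
      using k by (simp add: sum_divide_distrib[symmetric] sum_subtractf diff_divide_distrib)
    finally show ?thesis .
  qed
  then have "B f x * B e x + (\<Sum>i<N. B (E i) x * B (E i) x) / 2 \<in> \<int>" using ef by (intro Ints_add Ints_mult)
  also have "B f x * B e x + (\<Sum>i<N. B (E i) x * B (E i) x) / 2 = B x x / 2"
    using frame_form[OF S F, of x x] by simp
  finally show "B x x / 2 \<in> \<int>" .
qed

text \<open>Integrality follows from evenness by polarization. A dual vector is tested on
  \<open>E i + E j\<close> and \<open>E i - E j\<close>, which makes its coordinates all integral or
  all half-integral, and on half the sum of all \<open>E i\<close>, which gives the condition on the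
  coordinate sum.\<close>

lemma frame_lattice_unimodular:
  assumes S: "rational_subspace S" "span S = UNIV" and F: "frame S N e f E" and N: "8 dvd N" "N > 0"
  shows "unimodular_in S (frame_lattice S N e f E)"
proof -
  note D = frameD[OF F] and SD = rational_subspaceD[OF S(1)]
  let ?M = "frame_lattice S N e f E"
  have N8: "N \<ge> 8" using N by (simp add: dvd_imp_le)
  have zero: "0 \<in> ?M" using SD(1) by (simp add: frame_lattice_def)
  have diff: "x - y \<in> ?M" if "x \<in> ?M" "y \<in> ?M" for x y using that by (rule frame_lattice_diff[OF S(1)])
  have add: "x + y \<in> ?M" if "x \<in> ?M" "y \<in> ?M" for x y
    using diff[OF that(1) diff[OF zero that(2)]] by simp
  have even: "B x x / 2 \<in> \<int>" if "x \<in> ?M" for x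
    using frame_lattice_even[OF S F N(1)] that unfolding even_in_def by blast
  have sumE: "(\<Sum>i<N. B (E i) (E j)) = 1" if "j < N" for j
  proof -
    have "(\<Sum>i<N. B (E i) (E j)) = (\<Sum>i<N. if i = j then 1 else 0)" using D(12) that by (intro sum.cong) auto
    then show ?thesis using that by simp
  qed
  have eM: "e \<in> ?M" "f \<in> ?M" using D by (simp_all add: frame_lattice_def)
  have EE: "E i + E j \<in> ?M" "E i - E j \<in> ?M" if "i < N" "j < N" for i j
    using D that sumE SD(2,5) by (auto simp: frame_lattice_def sum.distrib sum_subtractf)
  have h: "(1 / 2) *\<^sub>R (\<Sum>i<N. E i) \<in> ?M"
  proof -
    have "(\<Sum>i<n. E i) \<in> S" if "n \<le> N" for n
      using that by (induction n) (simp_all add: SD(1) SD(2) D(3))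
    then have "(1 / 2) *\<^sub>R (\<Sum>i<N. E i) \<in> S" by (intro SD(3)) auto
    moreover have c: "B (E j) ((1 / 2) *\<^sub>R (\<Sum>i<N. E i)) = 1 / 2" if "j < N" for j
    proof -
      have "(\<Sum>i<N. B (E j) (E i)) = (\<Sum>i<N. if i = j then 1 else 0)" using D(12) that by (intro sum.cong) auto
      then show ?thesis using that by (simp add: form_sum_right)
    qed
    moreover have "(\<Sum>j<N. B (E j) ((1 / 2) *\<^sub>R (\<Sum>i<N. E i))) / 2 \<in> \<int>"
    proof -
      obtain k where k: "N = 8 * k" using N(1) by (rule dvdE)
      have "(\<Sum>j<N. B (E j) ((1 / 2) *\<^sub>R (\<Sum>i<N. E i))) = (\<Sum>j<N. 1 / 2)" using c by (intro sum.cong) auto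
      then have "(\<Sum>j<N. B (E j) ((1 / 2) *\<^sub>R (\<Sum>i<N. E i))) / 2 = of_nat (2 * k)" using k by simp
      then show ?thesis by (simp only: Ints_of_nat)
    qed
    moreover have "B e ((1 / 2) *\<^sub>R (\<Sum>i<N. E i)) = 0" "B f ((1 / 2) *\<^sub>R (\<Sum>i<N. E i)) = 0"
      using D(8,9) by (simp_all add: form_sum_right)
    moreover have "\<forall>j<N. B (E j) ((1 / 2) *\<^sub>R (\<Sum>i<N. E i)) - 1 / 2 \<in> \<int>"
    proof (intro allI impI)
      fix j assume "j < N"
      show "B (E j) ((1 / 2) *\<^sub>R (\<Sum>i<N. E i)) - 1 / 2 \<in> \<int>" unfolding c[OF \<open>j < N\<close>] by simp
    qed
    ultimately show ?thesis unfolding frame_lattice_def by (simp del: form_simps)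
  qed
  show ?thesis unfolding unimodular_in_def
  proof (intro conjI ballI impI)
    show "?M \<subseteq> S" by (auto simp: frame_lattice_def)
    show "\<exists>k>0. of_int k *\<^sub>R x \<in> ?M" if x: "x \<in> S" for x
    proof -
      obtain K where K: "K > 0" "\<forall>i\<in>{..<N}. of_int K * B (E i) x \<in> \<int>"
        using common_denominator[of "{..<N}" "\<lambda>i. B (E i) x"] SD(4) D(3) x by auto
      obtain K' where K': "K' > 0" "\<forall>i\<in>{e, f}. of_int K' * B i x \<in> \<int>"
        using common_denominator[of "{e, f}" "\<lambda>i. B i x"] SD(4) D(1,2) x by auto
      \<comment> \<open>The factor 2 serves the condition on half the coordinate sum.\<close>
      define k where "k = 2 * K * K'"
      have i: "B (E i) (of_int k *\<^sub>R x) = 2 * (of_int K' * (of_int K * B (E i) x))" for i by (simp add: k_def)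
      have i': "of_int K' * (of_int K * B (E i) x) \<in> \<int>" if "i < N" for i
      proof -
        have "of_int K * B (E i) x \<in> \<int>" using K(2) that by blast
        then show ?thesis by (rule Ints_mult[OF Ints_of_int])
      qed
      then have "\<forall>i<N. B (E i) (of_int k *\<^sub>R x) \<in> \<int>" unfolding i by (auto intro: Ints_mult[OF Ints_numeral])
      moreover have "(\<Sum>i<N. B (E i) (of_int k *\<^sub>R x)) / 2 \<in> \<int>"
      proof -
        have "(\<Sum>i<N. of_int K' * (of_int K * B (E i) x)) \<in> \<int>" using i' by (intro Ints_sum) simp
        also have "(\<Sum>i<N. of_int K' * (of_int K * B (E i) x)) = (\<Sum>i<N. B (E i) (of_int k *\<^sub>R x)) / 2"
          unfolding i sum_distrib_left[symmetric] by simp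
        finally show ?thesis .
      qed
      moreover have "of_int (2 * K) * (of_int K' * B j x) \<in> \<int>" if "j \<in> {e, f}" for j
      proof -
        have "of_int K' * B j x \<in> \<int>" using K'(2) that by blast
        then show ?thesis by (rule Ints_mult[OF Ints_of_int])
      qed
      then have "B e (of_int k *\<^sub>R x) \<in> \<int>" "B f (of_int k *\<^sub>R x) \<in> \<int>" by (simp_all add: k_def mult.assoc)
      moreover have "of_int k *\<^sub>R x \<in> S" using x by (intro SD(3)) auto
      ultimately have "of_int k *\<^sub>R x \<in> ?M" unfolding frame_lattice_def by blast
      then show ?thesis using K K' by (intro exI[of _ k]) (simp add: k_def)
    qed
    show "B x y \<in> \<int>" if "x \<in> ?M" "y \<in> ?M" for x y
    proof -
      have "B (x + y) (x + y) / 2 - B x x / 2 - B y y / 2 \<in> \<int>" using that add by (intro Ints_diff even)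
      then show ?thesis using sym[of y x] by (simp add: field_simps)
    qed
    show "x \<in> ?M" if x: "x \<in> S" "\<forall>y\<in>?M. B x y \<in> \<int>" for x
    proof -
      have ef: "B e x \<in> \<int>" "B f x \<in> \<int>" using x(2) eM sym by metis+
      have pm: "B (E i) x + B (E j) x \<in> \<int>" "B (E i) x - B (E j) x \<in> \<int>" if "i < N" "j < N" for i j
        using x(2)[rule_format, OF EE(1)[OF that]] x(2)[rule_format, OF EE(2)[OF that]] sym[of x] by simp_all
      have "B x ((1 / 2) *\<^sub>R (\<Sum>i<N. E i)) \<in> \<int>" using x(2) h by blast
      then have s: "(\<Sum>i<N. B (E i) x) / 2 \<in> \<int>" using sym[of x] by (simp add: form_sum_right)
      have N0: "0 < N" "1 < N" using N8 by auto
      have "(B (E 0) x + B (E 1) x) + (B (E 0) x - B (E 1) x) \<in> \<int>" using pm[OF N0] by (rule Ints_add)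
      then obtain n where n: "2 * B (E 0) x = of_int n" by (auto elim: Ints_cases)
      have "(\<forall>i<N. B (E i) x \<in> \<int>) \<or> (\<forall>i<N. B (E i) x - 1 / 2 \<in> \<int>)"
      proof (cases "even n")
        case True
        then obtain l where "n = 2 * l" by (rule dvdE)
        then have "B (E 0) x = of_int l" using n by simp
        then have "B (E i) x \<in> \<int>" if "i < N" for i
          using Ints_add[OF pm(2)[OF that N0(1)] Ints_of_int[of l]] by simp
        then show ?thesis by simp
      next
        case False
        then obtain l where "n = 2 * l + 1" by (rule oddE)
        then have "B (E 0) x = of_int l + 1 / 2" using n by simp
        then have "B (E i) x - 1 / 2 \<in> \<int>" if "i < N" for i
          using Ints_add[OF pm(2)[OF that N0(1)] Ints_of_int[of l]] by (simp add: algebra_simps)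
        then show ?thesis by simp
      qed
      then show ?thesis using x(1) ef s unfolding frame_lattice_def by blast
    qed
  qed (use zero diff in auto)
qed

end

section \<open>Sums of four squares\<close>

definition four_squares :: "int \<Rightarrow> bool" where
  "four_squares n \<longleftrightarrow> (\<exists>a b c d. n = a\<^sup>2 + b\<^sup>2 + c\<^sup>2 + d\<^sup>2)"

lemma euler_four_squares:
  fixes a b c d x y z w :: int
  shows "(a\<^sup>2 + b\<^sup>2 + c\<^sup>2 + d\<^sup>2) * (x\<^sup>2 + y\<^sup>2 + z\<^sup>2 + w\<^sup>2) =
    (a * x + b * y + c * z + d * w)\<^sup>2 + (a * y - b * x + c * w - d * z)\<^sup>2 +
    (a * z - b * w - c * x + d * y)\<^sup>2 + (a * w + b * z - c * y - d * x)\<^sup>2"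
  by (simp add: algebra_simps power2_eq_square)

lemma four_squares_mult: "four_squares m \<Longrightarrow> four_squares n \<Longrightarrow> four_squares (m * n)"
  unfolding four_squares_def by (elim exE) (simp only: euler_four_squares, blast)

lemma centered_residue:
  fixes m x :: int
  assumes "m > 0" shows "\<exists>t. 2 * \<bar>x - m * t\<bar> \<le> m"
proof (cases "2 * (x mod m) \<le> m")
  case True
  have "x - m * (x div m) = x mod m" by (simp add: minus_mult_div_eq_mod)
  then show ?thesis using True pos_mod_sign[OF assms, of x] by (intro exI[of _ "x div m"]) simp
next
  case False
  have "x - m * (x div m + 1) = x mod m - m" by (simp add: algebra_simps minus_mult_div_eq_mod)
  then show ?thesis using False pos_mod_bound[OF assms, of x] by (intro exI[of _ "x div m + 1"]) simp
qed

lemma square_le_quarter: "2 * \<bar>y\<bar> \<le> m \<Longrightarrow> 4 * y\<^sup>2 \<le> m\<^sup>2" for y m :: int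
  using power_mono[of "2 * \<bar>y\<bar>" m 2] by (simp add: power_mult_distrib)

text \<open>Lagrange's descent. The centered residues modulo m have square sum m r with r \<le> m.
  Both r = 0 and r = m, where all residues are m / 2 up to sign, would make m divide p. In Euler's
  product formula all four terms are divisible by m, so m can be cancelled twice.\<close>

lemma four_squares_descent:
  assumes p: "prime p" and m: "1 < m" "m < p" and s: "four_squares (m * p)"
  shows "\<exists>r. 0 < r \<and> r < m \<and> four_squares (r * p)"
proof -
  obtain a b c d where abcd: "m * p = a\<^sup>2 + b\<^sup>2 + c\<^sup>2 + d\<^sup>2" using s unfolding four_squares_def by blast
  have m0: "m > 0" using m by simp
  obtain ta tb tc td where t: "2 * \<bar>a - m * ta\<bar> \<le> m" "2 * \<bar>b - m * tb\<bar> \<le> m" "2 * \<bar>c - m * tc\<bar> \<le> m" "2 * \<bar>d - m * td\<bar> \<le> m"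
    using centered_residue[OF m0] by metis
  define x y z w where "x = a - m * ta" and "y = b - m * tb" and "z = c - m * tc" and "w = d - m * td"
  have abcd': "a = x + m * ta" "b = y + m * tb" "c = z + m * tc" "d = w + m * td"
    by (simp_all add: x_def y_def z_def w_def)
  have le: "4 * x\<^sup>2 \<le> m\<^sup>2" "4 * y\<^sup>2 \<le> m\<^sup>2" "4 * z\<^sup>2 \<le> m\<^sup>2" "4 * w\<^sup>2 \<le> m\<^sup>2"
    using t by (simp_all add: x_def y_def z_def w_def square_le_quarter)
  have mp: "\<not> m dvd p"
  proof
    assume "m dvd p"
    moreover have "0 \<le> m" using m by simp
    ultimately have "m = 1 \<or> m = p" using p unfolding prime_int_iff by blast
    then show False using m by auto
  qed
  have "x\<^sup>2 + y\<^sup>2 + z\<^sup>2 + w\<^sup>2 = m * (p - 2 * (x * ta + y * tb + z * tc + w * td) - m * (ta\<^sup>2 + tb\<^sup>2 + tc\<^sup>2 + td\<^sup>2))"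
    using abcd unfolding abcd' by (simp add: algebra_simps power2_eq_square)
  then obtain r where r: "x\<^sup>2 + y\<^sup>2 + z\<^sup>2 + w\<^sup>2 = m * r" by blast
  have "0 \<le> m * r" unfolding r[symmetric] by simp
  then have r0: "0 \<le> r" using m0 by (simp add: zero_le_mult_iff)
  have "m * r \<le> m * m" unfolding r[symmetric] using le by (simp add: power2_eq_square)
  then have rm: "r \<le> m" using m0 by simp
  have "r \<noteq> 0"
  proof
    assume "r = 0"
    then have "x = 0 \<and> y = 0 \<and> z = 0 \<and> w = 0" using r by (simp add: add_nonneg_eq_0_iff)
    then have "m * p = m * (m * (ta\<^sup>2 + tb\<^sup>2 + tc\<^sup>2 + td\<^sup>2))" using abcd unfolding abcd'
      by (simp add: algebra_simps power2_eq_square)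
    then have "p = m * (ta\<^sup>2 + tb\<^sup>2 + tc\<^sup>2 + td\<^sup>2)" using m0 by simp
    then show False using mp by simp
  qed
  moreover have "r \<noteq> m"
  proof
    assume "r = m"
    then have "4 * x\<^sup>2 = m\<^sup>2" "4 * y\<^sup>2 = m\<^sup>2" "4 * z\<^sup>2 = m\<^sup>2" "4 * w\<^sup>2 = m\<^sup>2"
      using r le by (simp_all add: power2_eq_square)
    then have "(2 * x)\<^sup>2 = m\<^sup>2" "(2 * y)\<^sup>2 = m\<^sup>2" "(2 * z)\<^sup>2 = m\<^sup>2" "(2 * w)\<^sup>2 = m\<^sup>2"
      by (simp_all add: power_mult_distrib)
    then have "m dvd 2 * x" "m dvd 2 * y" "m dvd 2 * z" "m dvd 2 * w"
      by (metis dvd_minus_iff dvd_refl power2_eq_iff minus_minus)+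
    then obtain sx sy sz sw where "2 * x = m * sx" "2 * y = m * sy" "2 * z = m * sz" "2 * w = m * sw"
      by (elim dvdE)
    moreover have "m * p = (x\<^sup>2 + y\<^sup>2 + z\<^sup>2 + w\<^sup>2) + m * ((2 * x) * ta + (2 * y) * tb + (2 * z) * tc + (2 * w) * td) +
        m * m * (ta\<^sup>2 + tb\<^sup>2 + tc\<^sup>2 + td\<^sup>2)"
      using abcd unfolding abcd' by (simp add: algebra_simps power2_eq_square)
    ultimately have "m * p = m * m + m * (m * sx * ta + m * sy * tb + m * sz * tc + m * sw * td) +
        m * m * (ta\<^sup>2 + tb\<^sup>2 + tc\<^sup>2 + td\<^sup>2)"
      by (simp only: r \<open>r = m\<close>)
    also have "\<dots> = m * (m * (1 + (sx * ta + sy * tb + sz * tc + sw * td) + (ta\<^sup>2 + tb\<^sup>2 + tc\<^sup>2 + td\<^sup>2)))"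
      by (simp add: algebra_simps)
    finally have "p = m * (1 + (sx * ta + sy * tb + sz * tc + sw * td) + (ta\<^sup>2 + tb\<^sup>2 + tc\<^sup>2 + td\<^sup>2))"
      using m0 by simp
    then show False using mp by simp
  qed
  moreover have "four_squares (r * p)"
  proof -
    define A where "A = r + ta * x + tb * y + tc * z + td * w"
    define F where "F = ta * y - tb * x + tc * w - td * z"
    define C where "C = ta * z - tb * w - tc * x + td * y"
    define D where "D = ta * w + tb * z - tc * y - td * x"
    have "a * x + b * y + c * z + d * w = m * A"
      using r unfolding abcd' A_def by (simp add: algebra_simps power2_eq_square)
    moreover have "a * y - b * x + c * w - d * z = m * F" unfolding abcd' F_def by (simp add: algebra_simps)
    moreover have "a * z - b * w - c * x + d * y = m * C" unfolding abcd' C_def by (simp add: algebra_simps)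
    moreover have "a * w + b * z - c * y - d * x = m * D" unfolding abcd' D_def by (simp add: algebra_simps)
    ultimately have "(m * p) * (m * r) = (m * A)\<^sup>2 + (m * F)\<^sup>2 + (m * C)\<^sup>2 + (m * D)\<^sup>2"
      using euler_four_squares[of a b c d x y z w] abcd r by simp
    then have "(m * m) * (r * p) = (m * m) * (A\<^sup>2 + F\<^sup>2 + C\<^sup>2 + D\<^sup>2)"
      by (simp add: algebra_simps power2_eq_square)
    then have "r * p = A\<^sup>2 + F\<^sup>2 + C\<^sup>2 + D\<^sup>2" using m0 by simp
    then show ?thesis unfolding four_squares_def by blast
  qed
  ultimately show ?thesis using r0 rm by (intro exI[of _ r]) auto
qed

text \<open>The descent starts from \<open>u\<^sup>2 + v\<^sup>2 + 1 = p * m\<close> with u, v at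
  most p / 2 in absolute value, which forces m < p.\<close>

lemma four_squares_prime:
  assumes p: "prime p" shows "four_squares p"
proof -
  have p2: "p \<ge> 2" using p prime_ge_2_int by blast
  have "\<not> p dvd 1" using p not_prime_unit by blast
  then obtain x y where xy: "p dvd 1 * x\<^sup>2 + 1 * y\<^sup>2 + 1" using quadratic_residue_pigeonhole[OF p] by blast
  obtain s t where st: "2 * \<bar>x - p * s\<bar> \<le> p" "2 * \<bar>y - p * t\<bar> \<le> p" using centered_residue[of p] p2 by fastforce
  define u v where "u = x - p * s" and "v = y - p * t"
  have uv: "u\<^sup>2 + v\<^sup>2 + 1 = (1 * x\<^sup>2 + 1 * y\<^sup>2 + 1) + p * (p * s\<^sup>2 + p * t\<^sup>2 - 2 * x * s - 2 * y * t)"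
    unfolding u_def v_def by (simp add: algebra_simps power2_eq_square)
  have "p dvd u\<^sup>2 + v\<^sup>2 + 1" unfolding uv by (rule dvd_add[OF xy dvd_triv_left])
  then obtain m where m: "u\<^sup>2 + v\<^sup>2 + 1 = p * m" by (rule dvdE)
  have "4 * u\<^sup>2 \<le> p\<^sup>2" "4 * v\<^sup>2 \<le> p\<^sup>2" using st by (simp_all add: u_def v_def square_le_quarter)
  moreover have "p\<^sup>2 \<ge> 4" using power_mono[OF p2, of 2] by simp
  ultimately have "p * m < p * p" using m by (simp add: power2_eq_square)
  then have mp: "m < p" using p2 by simp
  have "0 < p * m" unfolding m[symmetric] by (simp add: add_nonneg_pos)
  then have m0: "0 < m" using p2 by (simp add: zero_less_mult_iff)
  have fs: "four_squares (m * p)"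
    unfolding four_squares_def 
    by (rule exI[of _ u], rule exI[of _ v], rule exI[of _ 1], rule exI[of _ 0]) (simp add: m mult.commute[of m p])
  have "\<forall>m. 0 < m \<longrightarrow> m < p \<longrightarrow> nat m = k \<longrightarrow> four_squares (m * p) \<longrightarrow> four_squares p" for k
  proof (induction k rule: less_induct)
    case (less k)
    show ?case
    proof (intro allI impI)
      fix m assume m: "0 < m" "m < p" "nat m = k" "four_squares (m * p)"
      show "four_squares p"
      proof (cases "m = 1")
        case False
        then have "1 < m" using m by simp
        from four_squares_descent[OF p this m(2,4)] obtain r where "0 < r" "r < m" "four_squares (r * p)" by blast
        then show ?thesis using less[of "nat r"] m by auto
      qed (use m in simp)
    qed
  qed
  then show ?thesis using m0 mp fs by blast
qed

theorem lagrange_four_squares: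
  assumes "n > 0" shows "four_squares (int n)"
  using assms
proof (induction n rule: less_induct)
  case (less n)
  show ?case
  proof (cases "n = 1")
    case True
    then show ?thesis unfolding four_squares_def by (intro exI[of _ 1] exI[of _ 0]) simp
  next
    case False
    then obtain p where p: "prime p" "p dvd n" using prime_factor_nat by blast
    then obtain k where k: "n = p * k" by (elim dvdE)
    then have "k > 0" "k < n" using less.prems prime_gt_1_nat[OF p(1)] by auto
    then have "four_squares (int k)" by (intro less.IH)
    moreover have "four_squares (int p)" using p(1) by (intro four_squares_prime) simp
    ultimately have "four_squares (int p * int k)" by (intro four_squares_mult)
    then show ?thesis by (simp add: k)
  qed
qed

section \<open>Transitivity on primitive vectors\<close>

context symmetric_form
begin

lemma frame_map:
  assumes S: "rational_subspace S" "span S = UNIV" and F: "frame S N e f E" and F': "frame S N e' f' E'"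
  shows "\<exists>h. isometry h \<and> h e = e' \<and> h f = f' \<and> h ` frame_lattice S N e f E = frame_lattice S N e' f' E'"
proof -
  \<comment> \<open>Both frames are arguments, so the inverse map is given by the same formula with
    the frames exchanged.\<close>
  define T where "T e f E e' f' E' x = B f x *\<^sub>R e' + B e x *\<^sub>R f' + (\<Sum>i<N. B (E i) x *\<^sub>R E' i)"
    for e f and E :: "nat \<Rightarrow> 'v" and e' f' and E' :: "nat \<Rightarrow> 'v" and x
  have lin: "linear (T e f E e' f' E')" for e f E e' f' E'
    by (rule linearI) (simp_all add: T_def algebra_simps sum.distrib scaleR_sum_right)
  have c: "B e' (T e f E e' f' E' x) = B e x" "B f' (T e f E e' f' E' x) = B f x"
    if F': "frame S N e' f' E'" for e f E e' f' E' x
    using frameD[OF F'] by (simp_all add: T_def form_sum_right)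
  have cE: "B (E' j) (T e f E e' f' E' x) = B (E j) x"
    if F': "frame S N e' f' E'" and j: "j < N" for e f E e' f' E' x j
  proof -
    have "(\<Sum>i<N. B (E i) x * B (E' j) (E' i)) = (\<Sum>i<N. if i = j then B (E j) x else 0)"
      using frameD(12)[OF F'] j by (intro sum.cong) auto
    also have "\<dots> = B (E j) x" using j by simp
    finally show ?thesis using frameD(10,11)[OF F'] j by (simp add: T_def form_sum_right)
  qed
  have inv: "T e' f' E' e f E (T e f E e' f' E' x) = x"
    if F: "frame S N e f E" and F': "frame S N e' f' E'" for e f E e' f' E' x
  proof -
    have "T e' f' E' e f E (T e f E e' f' E' x) = B f x *\<^sub>R e + B e x *\<^sub>R f + (\<Sum>i<N. B (E i) x *\<^sub>R E i)"
      unfolding T_def[of e' f' E' e f E] by (simp add: c[OF F'] cE[OF F'])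
    then show ?thesis using frame_expand_UNIV[OF S F, of x] by simp
  qed
  have iso: "B (T e f E e' f' E' x) (T e f E e' f' E' y) = B x y" for x y
    using frame_form[OF S F', of "T e f E e' f' E' x" "T e f E e' f' E' y"] frame_form[OF S F, of x y]
    by (simp add: c[OF F'] cE[OF F'])
  have mem: "T e f E e' f' E' x \<in> frame_lattice S N e' f' E'"
    if F: "frame S N e f E" and F': "frame S N e' f' E'" and x: "x \<in> frame_lattice S N e f E" for e f E e' f' E' x
  proof -
    note SD = rational_subspaceD[OF S(1)]
    have xS: "x \<in> S" using x by (simp add: frame_lattice_def)
    have "(\<Sum>i<n. B (E i) x *\<^sub>R E' i) \<in> S" if "n \<le> N" for n
      using that by (induction n) (auto intro!: SD(1,2,3,4) frameD(3)[OF F] frameD(3)[OF F'] xS)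
    then have "T e f E e' f' E' x \<in> S" unfolding T_def
      by (intro SD(2,3,4) frameD(1,2)[OF F] frameD(1,2)[OF F'] xS) simp
    then show ?thesis using x unfolding frame_lattice_def by (simp add: c[OF F'] cE[OF F'])
  qed
  define h where "h = T e f E e' f' E'"
  have "isometry h" unfolding h_def
    by (rule isometryI[OF lin lin inv[OF F' F] inv[OF F F'] iso])
  moreover have "h e = e'" "h f = f'" using frameD[OF F] by (simp_all add: h_def T_def)
  moreover have "h ` frame_lattice S N e f E = frame_lattice S N e' f' E'"
  proof (intro equalityI subsetI)
    fix x assume "x \<in> frame_lattice S N e' f' E'"
    then have "T e' f' E' e f E x \<in> frame_lattice S N e f E" by (rule mem[OF F' F])
    then show "x \<in> h ` frame_lattice S N e f E" using inv[OF F' F, of x] unfolding h_def by (metis imageI)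
  qed (use mem[OF F F'] h_def in auto)
  ultimately show ?thesis by blast
qed

text \<open>The vector e - m f is orthogonal to e + m f and has norm - 2 m, so y must have norm 2 m.
  The coefficient 1 at \<open>E 4\<close> leaves 2 m - 1 to four squares; as this is odd, the
  coordinate sum of y is even. \<open>E 4\<close> also gives \<open>y' = E 4 + E 5\<close> the
  pairing 1 with z, and since y' has norm 2, the difference y' - z is isotropic. \<open>N\<close> is
  at least 8, so these \<open>E i\<close> exist.\<close>

lemma frame_lattice_hyperbolic:
  assumes S: "rational_subspace S" "span S = UNIV" and F: "frame S N e f E" and N: "8 dvd N" "N > 0" and m: "m \<ge> 1"
  shows "\<exists>z z'. z \<in> frame_lattice S N e f E \<and> z' \<in> frame_lattice S N e f E \<and> B z z = 0 \<and> B z' z' = 0 \<and> B z z' = 1 \<and>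
    B z (e + of_nat m *\<^sub>R f) = 0 \<and> B z' (e + of_nat m *\<^sub>R f) = 0"
proof -
  note D = frameD[OF F] and SD = rational_subspaceD[OF S(1)]
  let ?M = "frame_lattice S N e f E"
  have N8: "N \<ge> 8" using N by (simp add: dvd_imp_le)
  have "four_squares (int (2 * m - 1))" using m by (intro lagrange_four_squares) simp
  then obtain a b c d where "int (2 * m - 1) = a\<^sup>2 + b\<^sup>2 + c\<^sup>2 + d\<^sup>2" unfolding four_squares_def by blast
  then have abcd: "a\<^sup>2 + b\<^sup>2 + c\<^sup>2 + d\<^sup>2 = 2 * int m - 1" using m by simp
  have ev: "even (a + b + c + d + 1)"
  proof -
    have "odd (a\<^sup>2 + b\<^sup>2 + c\<^sup>2 + d\<^sup>2)" unfolding abcd by simp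
    then show ?thesis by simp
  qed
  define y where "y = of_int a *\<^sub>R E 0 + of_int b *\<^sub>R E 1 + of_int c *\<^sub>R E 2 + of_int d *\<^sub>R E 3 + E 4"
  define y' where "y' = E 4 + E 5"
  define z where "z = e - of_nat m *\<^sub>R f + y"
  define z' where "z' = y' - z"
  have EE: "B (E i) (E j) = (if i = j then 1 else 0)" if "i < 8" "j < 8" for i j
    using D(12) that N8 by simp
  have eE: "B e (E i) = 0" "B f (E i) = 0" "B (E i) e = 0" "B (E i) f = 0" "E i \<in> S" if "i < 8" for i
    using D(3,8-11) that N8 by simp_all
  have sumE: "(\<Sum>i<N. B (E i) (E j)) = 1" if "j < 8" for j
  proof -
    have "(\<Sum>i<N. B (E i) (E j)) = (\<Sum>i<N. if i = j then 1 else 0)" using D(12) that N8 by (intro sum.cong) auto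
    then show ?thesis using that N8 by simp
  qed
  have EZ: "B (E i) (E j) \<in> \<int>" if "i < N" "j < 8" for i j using D(12)[of i j] that N8 by simp
  have ysum: "(\<Sum>i<N. B (E i) y) = of_int (a + b + c + d + 1)"
    by (simp add: y_def sum.distrib sum_distrib_left[symmetric] sumE)
  have "z \<in> ?M" unfolding frame_lattice_def
  proof (intro CollectI conjI disjI1 allI impI)
    show "z \<in> S" unfolding z_def y_def by (intro SD(2,3,5) D(1,2) eE(5)) simp_all
    show "B e z \<in> \<int>" "B f z \<in> \<int>" using D(4-7) by (simp_all add: z_def y_def eE)
    show "B (E i) z \<in> \<int>" if "i < N" for i
      using D(10,11)[OF that] EZ[OF that] by (simp add: z_def y_def Ints_add Ints_mult)
    have "(\<Sum>i<N. B (E i) z) = (\<Sum>i<N. B (E i) y)" using D(10,11) by (intro sum.cong) (simp_all add: z_def)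
    moreover obtain k where "a + b + c + d + 1 = 2 * k" using ev by (rule dvdE)
    ultimately have "(\<Sum>i<N. B (E i) z) / 2 = of_int k" using ysum by simp
    then show "(\<Sum>i<N. B (E i) z) / 2 \<in> \<int>" by simp
  qed
  moreover have "y' \<in> ?M" unfolding frame_lattice_def
  proof (intro CollectI conjI disjI1 allI impI)
    show "y' \<in> S" unfolding y'_def by (intro SD(2) eE(5)) simp_all
    show "B e y' \<in> \<int>" "B f y' \<in> \<int>" by (simp_all add: y'_def eE)
    show "B (E i) y' \<in> \<int>" if "i < N" for i using EZ[OF that] by (simp add: y'_def)
    show "(\<Sum>i<N. B (E i) y') / 2 \<in> \<int>" by (simp add: y'_def sum.distrib sumE)
  qed
  then have "z' \<in> ?M" unfolding z'_def using \<open>z \<in> ?M\<close> by (rule frame_lattice_diff[OF S(1)])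
  moreover have yy: "B y y = 2 * of_nat m"
  proof -
    have "B y y = of_int (a\<^sup>2 + b\<^sup>2 + c\<^sup>2 + d\<^sup>2) + 1" by (simp add: y_def EE power2_eq_square)
    then show ?thesis unfolding abcd by simp
  qed
  have yef: "B e y = 0" "B f y = 0" "B y e = 0" "B y f = 0" by (simp_all add: y_def eE)
  have yef': "B e y' = 0" "B f y' = 0" "B y' e = 0" "B y' f = 0" by (simp_all add: y'_def eE)
  have y': "B y' y' = 2" "B y y' = 1" "B y' y = 1" by (simp_all add: y_def y'_def EE)
  have "B z z = 0" using D(4-7) yef yy by (simp add: z_def)
  moreover have zy': "B z y' = 1" "B y' z = 1" using yef' y' by (simp_all add: z_def)
  have "B z z' = 1" "B z' z' = 0" using \<open>B z z = 0\<close> zy' y'(1) by (simp_all add: z'_def)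
  moreover have "B z (e + of_nat m *\<^sub>R f) = 0" using D(4-7) yef by (simp add: z_def)
  moreover have "B z' (e + of_nat m *\<^sub>R f) = 0" using \<open>B z (e + of_nat m *\<^sub>R f) = 0\<close> yef' by (simp add: z'_def)
  ultimately show ?thesis by blast
qed

lemma normal_form:
  assumes S: "rational_subspace S" "span S = UNIV" and L: "unimodular_in S L" "even_in L"
    and T: "finite T" "T \<subseteq> L" "\<And>M. unimodular_in S M \<Longrightarrow> T \<subseteq> M \<Longrightarrow> L \<subseteq> M"
    and d: "diagonal S (replicate_mset (Suc N) 1 + {#- 1#})" and N: "8 dvd N" "N > 0"
    and m: "m \<ge> 1" and v: "primitive_in L v" "B v v = 2 * of_nat m"
    and ef0: "e0 \<in> L" "f0 \<in> L" "B e0 e0 = 0" "B f0 f0 = 0" "B e0 f0 = 1"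
  shows "\<exists>e f E g. frame S N e f E \<and> v = e + of_nat m *\<^sub>R f \<and> isometry g \<and> g v = v \<and> g ` frame_lattice S N e f E = L"
proof -
  note LD = unimodular_inD[OF L(1)] and SD = rational_subspaceD[OF S(1)]
  have vL: "v \<in> L" using v(1) by (simp add: primitive_in_def)
  obtain y0 where y0: "y0 \<in> L" "B v y0 = 1" using primitive_pairing[OF S(1) L(1) v(1)] v(2) m by auto
  obtain E0 where F0: "frame S N e0 f0 E0" using frame_exists[OF S(1) d LD(2)[OF ef0(1)] LD(2)[OF ef0(2)] ef0(3-5)] by blast
  \<comment> \<open>A multiple \<open>Y\<close> of \<open>E0 0\<close> and a partner
    \<open>Y'\<close> with pairing 1, both in \<open>L\<close> and orthogonal to
    \<open>e0, f0\<close>, are prepared for \<open>iso_vec_primes\<close>.\<close>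
  obtain k :: int where k: "k > 0" "of_int k *\<^sub>R E0 0 \<in> L" using LD(4)[OF frameD(3)[OF F0 N(2)]] by blast
  have "B (of_int k *\<^sub>R E0 0) (of_int k *\<^sub>R E0 0) \<noteq> 0" using k(1) frameD(12)[OF F0 N(2) N(2)] by simp
  from unimodular_divisor[OF S(1) L(1) k(2) k(2) this]
  obtain d1 :: int and y1 where d1: "d1 > 0" "(1 / of_int d1) *\<^sub>R (of_int k *\<^sub>R E0 0) \<in> L" "y1 \<in> L" "B (of_int k *\<^sub>R E0 0) y1 = of_int d1"
    by auto
  define Y where "Y = (1 / of_int d1) *\<^sub>R (of_int k *\<^sub>R E0 0)"
  define Y' where "Y' = y1 - B f0 y1 *\<^sub>R e0 - B e0 y1 *\<^sub>R f0"
  have Y: "Y \<in> L" "B e0 Y = 0" "B f0 Y = 0" using d1 frameD(8,9)[OF F0 N(2)] by (simp_all add: Y_def)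
  have Y': "Y' \<in> L" "B e0 Y' = 0" "B f0 Y' = 0"
    unfolding Y'_def by (rule project_hyperbolic[OF L(1) ef0 d1(3)])+
  have "B Y y1 = 1" using d1(1,4) by (simp add: Y_def)
  then have YY': "B Y Y' = 1" using Y(2,3) sym[of Y e0] sym[of Y f0] by (simp add: Y'_def)
  define Q where "Q = {p :: int. prime p \<and> p dvd 2 * int m}"
  have "Q \<subseteq> {0..2 * int m}"
  proof
    fix p assume "p \<in> Q"
    then have "prime p" "p dvd 2 * int m" by (auto simp: Q_def)
    then show "p \<in> {0..2 * int m}" using zdvd_imp_le[of p "2 * int m"] m prime_ge_0_int[of p] by simp
  qed
  then have Q: "finite Q" "\<And>p. p \<in> Q \<Longrightarrow> prime p" by (auto simp: Q_def finite_subset)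
  from iso_vec_primes[OF S(1) L ef0 vL y0 Y(1) Y'(1) Y(2,3) Y'(2,3) YY' Q]
  obtain k1 y c where y: "y \<in> L" "B e0 y = 0" "B f0 y = 0" "B v (iso_vec e0 f0 (of_int k1) y) = of_int c" "\<forall>p\<in>Q. \<not> p dvd c"
    by blast
  define f1 where "f1 = iso_vec e0 f0 (of_int k1) y"
  have f1: "f1 \<in> L" "B f1 f1 = 0" "B v f1 = of_int c"
    using iso_vec_mem[OF L ef0(1,2) y(1)] iso_vec_isotropic[OF ef0(3-5) y(2,3)] y(4) by (simp_all add: f1_def)
  \<comment> \<open>Because 2 is always among the primes, c is nonzero even for m = 1 and may serve
    as a denominator.\<close>
  have "2 \<in> Q" by (simp add: Q_def)
  then have c0: "c \<noteq> 0" using y(5) by auto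
  have cm: "coprime c (int m)"
  proof (rule ccontr)
    assume "\<not> coprime c (int m)"
    then have "\<not> is_unit (gcd c (int m))" by (simp add: coprime_iff_gcd_eq_1)
    moreover have "gcd c (int m) \<noteq> 0" using c0 by simp
    ultimately obtain p where p: "prime p" "p dvd gcd c (int m)" using prime_divisor_exists by blast
    then have "p \<in> Q" "p dvd c" by (auto simp: Q_def)
    then show False using y(5) by blast
  qed
  define f where "f = (1 / of_int c) *\<^sub>R f1"
  \<comment> \<open>Isotropic since \<open>v\<close> has norm 2 m and pairs to 1 with
    \<open>f\<close>. The multiple \<open>f1 = c f\<close> lies in \<open>L\<close> and in the frame
    lattice.\<close>
  define e where "e = v - of_nat m *\<^sub>R f"
  have f: "f \<in> S" "B f f = 0" "B v f = 1" "B f v = 1"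
    using f1 c0 LD(2)[OF f1(1)] sym[of f1 v] by (auto simp: f_def intro: SD(3))
  have e: "e \<in> S" "B e e = 0" "B e f = 1"
    using f LD(2)[OF vL] v(2) by (auto simp: e_def intro!: SD(3,5))
  have ve: "v = e + of_nat m *\<^sub>R f" by (simp add: e_def)
  obtain E where F: "frame S N e f E" using frame_exists[OF S(1) d e(1) f(1) e(2) f(2) e(3)] by blast
  let ?M = "frame_lattice S N e f E"
  have M: "unimodular_in S ?M" "even_in ?M"
    using frame_lattice_unimodular[OF S F N] frame_lattice_even[OF S F N(1)] by auto
  have eM: "e \<in> ?M" "f \<in> ?M" using frameD[OF F] by (simp_all add: frame_lattice_def)
  have vM: "v \<in> ?M" unfolding ve using unimodular_inD(8,9)[OF M(1)] eM by (metis of_int_of_nat_eq)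
  have fM: "f1 \<in> ?M" using unimodular_inD(9)[OF M(1) eM(2), of c] c0 by (simp add: f_def)
  from frame_lattice_hyperbolic[OF S F N m] obtain z z' where z: "z \<in> ?M" "z' \<in> ?M" "B z z = 0" "B z' z' = 0" "B z z' = 1"
    "B z v = 0" "B z' v = 0" unfolding ve[symmetric] by blast
  have "B v v = 2 * of_int (int m)" using v(2) by simp
  from isometric_fixing[OF S(1) L M z vM eM(2) f(3) vL this fM f1(1) f1(3) cm T(1,2)]
  obtain g where g: "isometry g" "g v = v" "unimodular_in S (g ` ?M)" "T \<subseteq> g ` ?M" by blast
  have "L = g ` ?M"
    using unimodular_in_maximal[OF L(1) T(3)[OF g(3,4)]] unimodular_inD[OF g(3)] by blast
  then show ?thesis using F ve g by blast
qed

section \<open>Orthogonal families and Sylvester's law of inertia\<close>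

lemma orth_family_expand:
  assumes X: "finite X" "\<And>x. x \<in> X \<Longrightarrow> B x x \<noteq> 0" "\<And>x y. x \<in> X \<Longrightarrow> y \<in> X \<Longrightarrow> x \<noteq> y \<Longrightarrow> B x y = 0"
    and y: "y \<in> span X"
  shows "y = (\<Sum>x\<in>X. (B x y / B x x) *\<^sub>R x)" "B y y = (\<Sum>x\<in>X. (B x y)\<^sup>2 / B x x)"
proof -
  obtain c where c: "y = (\<Sum>x\<in>X. c x *\<^sub>R x)" using y span_finite[OF X(1)] by auto
  have "B x y = c x * B x x" if x: "x \<in> X" for x
  proof -
    have "B x y = (\<Sum>z\<in>X. c z * B x z)" by (simp add: c form_sum_right)
    also have "\<dots> = (\<Sum>z\<in>X. if z = x then c x * B x x else 0)" using X(3)[OF x] by (intro sum.cong) auto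
    finally show ?thesis using x X(1) by simp
  qed
  then have "(\<Sum>x\<in>X. (B x y / B x x) *\<^sub>R x) = (\<Sum>x\<in>X. c x *\<^sub>R x)" using X(2) by (intro sum.cong) auto
  then show e: "y = (\<Sum>x\<in>X. (B x y / B x x) *\<^sub>R x)" using c by simp
  have "B y y = B (\<Sum>x\<in>X. (B x y / B x x) *\<^sub>R x) y" using e by simp
  also have "\<dots> = (\<Sum>x\<in>X. (B x y)\<^sup>2 / B x x)" by (simp add: form_sum_left power2_eq_square)
  finally show "B y y = (\<Sum>x\<in>X. (B x y)\<^sup>2 / B x x)" .
qed

lemma orth_family_independent:
  assumes X: "finite X" "\<And>x. x \<in> X \<Longrightarrow> B x x \<noteq> 0" "\<And>x y. x \<in> X \<Longrightarrow> y \<in> X \<Longrightarrow> x \<noteq> y \<Longrightarrow> B x y = 0"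
  shows "independent X"
proof (rule independent_if_scalars_zero[OF X(1)])
  fix f x assume s: "(\<Sum>x\<in>X. f x *\<^sub>R x) = 0" and x: "x \<in> X"
  have "0 = B x (\<Sum>z\<in>X. f z *\<^sub>R z)" using s by simp
  also have "\<dots> = (\<Sum>z\<in>X. f z * B x z)" by (simp add: form_sum_right)
  also have "\<dots> = (\<Sum>z\<in>X. if z = x then f x * B x x else 0)" using X(3)[OF x] by (intro sum.cong) auto
  also have "\<dots> = f x * B x x" using x X(1) by simp
  finally show "f x = 0" using X(2)[OF x] by simp
qed

lemma signature_orth_family:
  assumes "has_signature B p q"
  obtains P N where "finite P" "finite N" "card P = p" "card N = q" "span (P \<union> N) = UNIV" "P \<inter> N = {}"
    "\<And>x. x \<in> P \<Longrightarrow> B x x > 0" "\<And>x. x \<in> N \<Longrightarrow> B x x < 0"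
    "\<And>x y. x \<in> P \<union> N \<Longrightarrow> y \<in> P \<union> N \<Longrightarrow> x \<noteq> y \<Longrightarrow> B x y = 0"
proof -
  obtain P N where PN: "finite P" "finite N" "card P = p" "card N = q" "span (P \<union> N) = UNIV"
    "\<forall>x\<in>P \<union> N. \<forall>y\<in>P \<union> N. x \<noteq> y \<longrightarrow> B x y = 0" "\<forall>x\<in>P. B x x > 0" "\<forall>x\<in>N. B x x < 0"
    using assms unfolding has_signature_def by (elim exE conjE) (rule that)
  show thesis by (rule that[of P N]) (use PN in force)+
qed

lemma signature_nondegenerate:
  assumes "has_signature B p q" "\<And>y. B x y = 0" shows "x = 0"
proof -
  obtain P N where PN: "finite P" "finite N" "span (P \<union> N) = UNIV" "\<And>x. x \<in> P \<Longrightarrow> B x x > 0" "\<And>x. x \<in> N \<Longrightarrow> B x x < 0"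
    "\<And>x y. x \<in> P \<union> N \<Longrightarrow> y \<in> P \<union> N \<Longrightarrow> x \<noteq> y \<Longrightarrow> B x y = 0"
    using signature_orth_family[OF assms(1)] by metis
  have nz: "B y y \<noteq> 0" if "y \<in> P \<union> N" for y using that PN(4,5)[of y] by auto
  have "x = (\<Sum>y\<in>P \<union> N. (B y x / B y y) *\<^sub>R y)"
    by (rule orth_family_expand(1)) (use PN nz in auto)
  also have "\<dots> = 0" using assms(2) sym by (intro sum.neutral) simp
  finally show ?thesis .
qed

text \<open>Sylvester's law for one negative square. The complement of the negative basis vector
  \<open>n\<close> is nonnegative. Of two orthogonal negative vectors x, y, a combination w is
  orthogonal to \<open>n\<close>; its norm is a sum of nonpositive terms, so these vanish, and then
  x would itself be orthogonal to \<open>n\<close>.\<close>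

lemma lorentzian_orth_family:
  assumes sig: "has_signature B p 1" and X: "finite X" "span X = UNIV" "\<And>x. x \<in> X \<Longrightarrow> B x x \<noteq> 0"
    "\<And>x y. x \<in> X \<Longrightarrow> y \<in> X \<Longrightarrow> x \<noteq> y \<Longrightarrow> B x y = 0"
  shows "card {x\<in>X. B x x < 0} = 1" "card X = p + 1"
proof -
  obtain P N where PN: "finite P" "finite N" "card P = p" "card N = 1" "span (P \<union> N) = UNIV" "P \<inter> N = {}"
    "\<And>x. x \<in> P \<Longrightarrow> B x x > 0" "\<And>x. x \<in> N \<Longrightarrow> B x x < 0"
    "\<And>x y. x \<in> P \<union> N \<Longrightarrow> y \<in> P \<union> N \<Longrightarrow> x \<noteq> y \<Longrightarrow> B x y = 0"
    using signature_orth_family[OF sig] by metis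
  have nz: "B y y \<noteq> 0" if "y \<in> P \<union> N" for y using that PN(7,8)[of y] by auto
  have ind: "independent (P \<union> N)" by (rule orth_family_independent) (use PN nz in auto)
  have indX: "independent X" by (rule orth_family_independent) (use X in auto)
  have "card X \<le> card (P \<union> N)" using independent_span_bound[of "P \<union> N" X] PN indX by auto
  moreover have "card (P \<union> N) \<le> card X" using independent_span_bound[of X "P \<union> N"] X ind by auto
  ultimately show "card X = p + 1" using card_Un_disjoint[OF PN(1,2,6)] PN by simp
  obtain n where n: "N = {n}" using PN(4) by (auto simp: card_1_singleton_iff)
  have nn: "B n n < 0" using PN(8) n by simp
  have pos: "B y y \<ge> 0" if y: "B n y = 0" for y
  proof -
    have "B y y = (\<Sum>x\<in>P \<union> N. (B x y)\<^sup>2 / B x x)"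
      by (rule orth_family_expand(2)) (use PN nz in auto)
    also have "\<dots> \<ge> 0"
    proof (rule sum_nonneg)
      fix x assume "x \<in> P \<union> N"
      then show "0 \<le> (B x y)\<^sup>2 / B x x" using y n PN(7)[of x] by auto
    qed
    finally show ?thesis .
  qed
  have "{x\<in>X. B x x < 0} \<noteq> {}"
  proof
    assume e: "{x\<in>X. B x x < 0} = {}"
    have "B n n = (\<Sum>x\<in>X. (B x n)\<^sup>2 / B x x)" by (rule orth_family_expand(2)) (use X in auto)
    also have "\<dots> \<ge> 0" using e by (intro sum_nonneg divide_nonneg_nonneg) (auto simp: not_less)
    finally show False using nn by simp
  qed
  then obtain x where x: "x \<in> X" "B x x < 0" by blast
  have "y = x" if y: "y \<in> X" "B y y < 0" for y
  proof (rule ccontr)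
    assume "y \<noteq> x"
    then have xy: "B x y = 0" "B y x = 0" using X(4) x y by auto
    define w where "w = B n y *\<^sub>R x - B n x *\<^sub>R y"
    have "B n w = 0" by (simp add: w_def)
    from pos[OF this] have ge: "(B n y)\<^sup>2 * B x x + (B n x)\<^sup>2 * B y y \<ge> 0"
      using xy by (simp add: w_def power2_eq_square algebra_simps)
    have le: "(B n y)\<^sup>2 * B x x \<le> 0" "(B n x)\<^sup>2 * B y y \<le> 0"
      using x y by (simp_all add: mult_nonneg_nonpos)
    then have "(B n x)\<^sup>2 * B y y = 0" using ge by linarith
    then have "B n x = 0" using y by auto
    then show False using pos x by fastforce
  qed
  then have "{x\<in>X. B x x < 0} = {x}" using x by blast
  then show "card {x\<in>X. B x x < 0} = 1" by simp
qed

definition rational_hull :: "'v set \<Rightarrow> 'v set" where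
  "rational_hull L = {x. \<exists>k>0. of_int k *\<^sub>R x \<in> L}"

lemma int_span_generated:
  assumes "finite X" "0 \<in> M" "\<And>x y. x \<in> M \<Longrightarrow> y \<in> M \<Longrightarrow> x + y \<in> M" "\<And>k x. x \<in> M \<Longrightarrow> of_int k *\<^sub>R x \<in> M" "X \<subseteq> M"
  shows "int_span X \<subseteq> M"
proof
  fix x assume "x \<in> int_span X"
  then obtain c where x: "x = (\<Sum>s\<in>X. of_int (c s) *\<^sub>R s)" unfolding int_span_def by blast
  have "(\<Sum>s\<in>X. of_int (c s) *\<^sub>R s) \<in> M" using assms(1,5)
    by (induction X) (auto intro: assms(2-4))
  then show "x \<in> M" using x by simp
qed

end

lemma int_span_closed:
  shows "0 \<in> int_span X" "x \<in> int_span X \<Longrightarrow> y \<in> int_span X \<Longrightarrow> x - y \<in> int_span X"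
    "finite X \<Longrightarrow> X \<subseteq> int_span X"
proof -
  show "0 \<in> int_span X" unfolding int_span_def by (rule CollectI, rule exI[of _ "\<lambda>_. 0"]) simp
  show "x - y \<in> int_span X" if xy: "x \<in> int_span X" "y \<in> int_span X"
  proof -
    obtain c d where "x = (\<Sum>s\<in>X. of_int (c s) *\<^sub>R s)" "y = (\<Sum>s\<in>X. of_int (d s) *\<^sub>R s)"
      using xy unfolding int_span_def by blast
    then have "x - y = (\<Sum>s\<in>X. of_int (c s - d s) *\<^sub>R s)" by (simp add: sum_subtractf scaleR_left_diff_distrib)
    then show ?thesis unfolding int_span_def by (intro CollectI exI[of _ "\<lambda>s. c s - d s"]) simp
  qed
  show "X \<subseteq> int_span X" if X: "finite X"
  proof
    fix x assume x: "x \<in> X"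
    have "(\<Sum>s\<in>X. of_int (if s = x then 1 else 0) *\<^sub>R s) = (\<Sum>s\<in>X. if s = x then x else 0)"
      by (intro sum.cong) auto
    then have "x = (\<Sum>s\<in>X. of_int (if s = x then 1 else 0) *\<^sub>R s)" using x X by simp
    then show "x \<in> int_span X" unfolding int_span_def
      by (intro CollectI exI[of _ "\<lambda>s. if s = x then 1 else 0"]) simp
  qed
qed

section \<open>The rational hull of the given lattice and its automorphisms\<close>

locale even_unimodular = symmetric_form B for B :: "'v::real_vector \<Rightarrow> 'v \<Rightarrow> real" +
  fixes L :: "'v set" and n :: nat
  assumes n: "n \<ge> 1" and lattice: "is_lattice B L" and even: "even_lattice B L"
    and unimodular: "unimodular_lattice B L" and signature: "has_signature B (8 * n + 1) 1"
begin

abbreviation S where "S \<equiv> rational_hull L"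

lemma generators: "\<exists>X. finite X \<and> X \<subseteq> L \<and> span X = UNIV \<and> L = int_span X"
proof -
  obtain X where "finite X" "span X = UNIV" "L = int_span X" using lattice unfolding is_lattice_def by blast
  then show ?thesis using int_span_closed(3)[of X] by (intro exI[of _ X]) simp
qed

lemma lattice_closed: "0 \<in> L" "x \<in> L \<Longrightarrow> y \<in> L \<Longrightarrow> x - y \<in> L"
  using generators int_span_closed by auto

lemma lattice_integral: "x \<in> L \<Longrightarrow> y \<in> L \<Longrightarrow> B x y \<in> \<int>"
  using unimodular unfolding unimodular_lattice_def dual_lattice_def by blast

lemma lattice_add: "x \<in> L \<Longrightarrow> y \<in> L \<Longrightarrow> x + y \<in> L"
  using lattice_closed(2)[of x "- y"] lattice_closed(2)[of 0 y] lattice_closed(1) by simp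

lemma lattice_scale: "x \<in> L \<Longrightarrow> of_int k *\<^sub>R x \<in> L"
proof -
  assume x: "x \<in> L"
  have "B (of_int k *\<^sub>R x) y \<in> \<int>" if "y \<in> L" for y
    using lattice_integral[OF x that] by (simp add: Ints_mult)
  then show ?thesis using unimodular unfolding unimodular_lattice_def dual_lattice_def by blast
qed

lemma lattice_subset_hull: "L \<subseteq> S"
  unfolding rational_hull_def by (auto intro: exI[of _ 1])

lemma rational_subspace_hull: "rational_subspace S"
  unfolding rational_subspace_def
proof (intro conjI ballI)
  show "0 \<in> S" using lattice_subset_hull lattice_closed by blast
next
  fix x y assume "x \<in> S" "y \<in> S"
  then obtain k l :: int where k: "k > 0" "of_int k *\<^sub>R x \<in> L" and l: "l > 0" "of_int l *\<^sub>R y \<in> L"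
    unfolding rational_hull_def by blast
  have "of_int (k * l) *\<^sub>R (x + y) = of_int l *\<^sub>R (of_int k *\<^sub>R x) + of_int k *\<^sub>R (of_int l *\<^sub>R y)"
    by (simp add: algebra_simps)
  also have "\<dots> \<in> L" by (intro lattice_add lattice_scale k l)
  finally show "x + y \<in> S" using k l unfolding rational_hull_def by (intro CollectI exI[of _ "k * l"]) simp
  have "of_int (k * l) * B x y = B (of_int k *\<^sub>R x) (of_int l *\<^sub>R y)" by simp
  also obtain j where "\<dots> = of_int j" using lattice_integral[OF k(2) l(2)] by (auto elim: Ints_cases)
  finally have "B x y = of_int j / of_int (k * l)" using k l by (simp add: field_simps)
  then show "B x y \<in> \<rat>" by simp
next
  fix r x assume r: "(r::real) \<in> \<rat>" and "x \<in> S"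
  then obtain k :: int where k: "k > 0" "of_int k *\<^sub>R x \<in> L" unfolding rational_hull_def by blast
  obtain a b :: int where ab: "b > 0" "r = of_int a / of_int b" using Rats_cases'[OF r] by metis
  have "of_int (b * k) *\<^sub>R (r *\<^sub>R x) = of_int a *\<^sub>R (of_int k *\<^sub>R x)" using ab by simp
  also have "\<dots> \<in> L" by (intro lattice_scale k)
  finally show "r *\<^sub>R x \<in> S" using k ab unfolding rational_hull_def by (intro CollectI exI[of _ "b * k"]) simp
qed

lemma unimodular_in_hull: "unimodular_in S L"
  unfolding unimodular_in_def
proof (intro conjI ballI impI)
  show "x \<in> L" if "\<forall>y\<in>L. B x y \<in> \<int>" for x
    using that unimodular unfolding unimodular_lattice_def dual_lattice_def by blast
  show "\<exists>k>0. of_int k *\<^sub>R x \<in> L" if "x \<in> S" for x using that unfolding rational_hull_def by blast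
qed (use lattice_closed lattice_integral lattice_subset_hull in auto)

lemma even_in_lattice: "even_in L"
  unfolding even_in_def
proof
  fix x assume "x \<in> L"
  then obtain k :: int where "B x x = 2 * of_int k" using even unfolding even_lattice_def by blast
  then show "B x x / 2 \<in> \<int>" by simp
qed

lemma span_hull: "span S = UNIV"
proof -
  obtain X where X: "X \<subseteq> L" "span X = UNIV" using generators by blast
  then have "span X \<subseteq> span S" using lattice_subset_hull by (intro span_mono) blast
  then show ?thesis using X by blast
qed

lemma hull_nondegenerate:
  assumes "\<And>y. y \<in> S \<Longrightarrow> B x y = 0" shows "x = 0"
proof (rule signature_nondegenerate[OF signature])
  fix y
  have "linear (B x)" "linear (\<lambda>_. 0 :: real)" using bilin by (simp_all add: bilinear_def linear_zero)
  from linear_eq_on[OF this, of y S] show "B x y = 0" using assms span_hull by simp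
qed

text \<open>A largest orthogonal family of anisotropic lattice vectors, whose size is bounded by
  that of a generating set. Its complement \<open>T\<close> in the hull has only isotropic vectors;
  by polarization the form vanishes on it, and nondegeneracy makes it zero.\<close>

lemma diagonal_exists: "\<exists>A. diagonal S A \<and> size A = 8 * n + 2 \<and> npos A = 8 * n + 1"
proof -
  define good where "good X \<longleftrightarrow> finite X \<and> X \<subseteq> L \<and> (\<forall>x\<in>X. B x x \<noteq> 0) \<and> (\<forall>x\<in>X. \<forall>y\<in>X. x \<noteq> y \<longrightarrow> B x y = 0)" for X
  obtain G :: "'v set" where G: "finite G" "span G = UNIV" using generators by blast
  have bound: "card X \<le> card G" if "good X" for X
  proof -
    have "independent X" by (rule orth_family_independent) (use that in \<open>auto simp: good_def\<close>)
    then show ?thesis using independent_span_bound[of G X] G by auto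
  qed
  have "good {}" by (simp add: good_def)
  then obtain X where X: "good X" and max: "\<And>Y. good Y \<Longrightarrow> card Y \<le> card X"
    using ex_has_greatest_nat[of good "{}" card "Suc (card G)"] bound by (metis le_imp_less_Suc)
  have Xf: "finite X" "X \<subseteq> L" "\<And>x. x \<in> X \<Longrightarrow> B x x \<noteq> 0" "\<And>x y. x \<in> X \<Longrightarrow> y \<in> X \<Longrightarrow> x \<noteq> y \<Longrightarrow> B x y = 0"
    using X by (auto simp: good_def)
  note SD = rational_subspaceD[OF rational_subspace_hull]
  have XS: "x \<in> S" if "x \<in> X" for x using that Xf(2) lattice_subset_hull by blast
  define T where "T = {y\<in>S. \<forall>x\<in>X. B x y = 0}"
  have T0: "B y y = 0" if y: "y \<in> T" for y
  proof (rule ccontr)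
    assume nz: "B y y \<noteq> 0"
    obtain k :: int where k: "k > 0" "of_int k *\<^sub>R y \<in> L" using y unfolding T_def rational_hull_def by blast
    define z where "z = of_int k *\<^sub>R y"
    have z: "B z z \<noteq> 0" "z \<in> L" using nz k by (simp_all add: z_def)
    have zX: "B x z = 0" "B z x = 0" if "x \<in> X" for x
      using y that sym[of z x] by (simp_all add: z_def T_def)
    then have "z \<notin> X" using Xf(3) by blast
    have "good (insert z X)" unfolding good_def using Xf z zX by auto
    then have "card (insert z X) \<le> card X" by (rule max)
    then show False using \<open>z \<notin> X\<close> Xf(1) by simp
  qed
  have proj: "s - (\<Sum>x\<in>X. (B x s / B x x) *\<^sub>R x) \<in> T" if s: "s \<in> S" for s
  proof -
    have "(\<Sum>x\<in>Y. (B x s / B x x) *\<^sub>R x) \<in> S" if "finite Y" "Y \<subseteq> X" for Y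
      using that
    proof (induction Y)
      case (insert x Y)
      then have "(B x s / B x x) *\<^sub>R x \<in> S" using XS s by (intro SD(3) Rats_divide SD(4)) auto
      then show ?case using insert SD(2) by auto
    qed (use SD in simp)
    then have "(\<Sum>x\<in>X. (B x s / B x x) *\<^sub>R x) \<in> S" using Xf(1) by blast
    moreover have "B z (\<Sum>x\<in>X. (B x s / B x x) *\<^sub>R x) = B z s" if z: "z \<in> X" for z
    proof -
      have "B z (\<Sum>x\<in>X. (B x s / B x x) *\<^sub>R x) = (\<Sum>x\<in>X. (B x s / B x x) * B z x)" by (simp add: form_sum_right)
      also have "\<dots> = (\<Sum>x\<in>X. if x = z then B z s else 0)" using Xf(3,4) z by (intro sum.cong) auto
      finally show ?thesis using z Xf(1) by simp
    qed
    ultimately show ?thesis using s SD(5) unfolding T_def by simp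
  qed
  have complete: "y = 0" if y: "y \<in> S" "\<forall>x\<in>X. B x y = 0" for y
  proof (rule hull_nondegenerate)
    fix s assume s: "s \<in> S"
    define t where "t = s - (\<Sum>x\<in>X. (B x s / B x x) *\<^sub>R x)"
    have t: "t \<in> T" unfolding t_def by (rule proj[OF s])
    have yT: "y \<in> T" using y by (simp add: T_def)
    have "y + t \<in> T" using t yT SD(2) by (auto simp: T_def)
    from T0[OF this] have "2 * B y t = 0" using T0[OF t] T0[OF yT] sym[of t y] by simp
    moreover have "B y (\<Sum>x\<in>X. (B x s / B x x) *\<^sub>R x) = 0"
      using y(2) sym[of y] by (simp add: form_sum_right)
    ultimately show "B y s = 0" by (simp add: t_def)
  qed
  \<comment> \<open>The floor is exact, as norms of lattice vectors are integers; it only changes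
    the type of the entries.\<close>
  define A where "A = image_mset (\<lambda>x. \<lfloor>B x x\<rfloor>) (mset_set X)"
  have fl: "real_of_int \<lfloor>B x x\<rfloor> = B x x" if "x \<in> X" for x
    using lattice_integral[of x x] that Xf(2) by (auto elim: Ints_cases)
  have "diagonalizes X S A" unfolding diagonalizes_def
  proof (intro conjI)
    show "image_mset (\<lambda>x. B x x) (mset_set X) = image_mset real_of_int A"
      unfolding A_def multiset.map_comp
      using fl by (intro image_mset_cong) (simp only: comp_def finite_set_mset_mset_set[OF Xf(1)])
    show "\<forall>y\<in>S. (\<forall>x\<in>X. B x y = 0) \<longrightarrow> y = 0" using complete by simp
  qed (use Xf XS in auto)
  then have d: "diagonal S A" unfolding diagonal_def by blast
  have "S \<subseteq> span X"
  proof
    fix s assume "s \<in> S"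
    then have "s = (\<Sum>x\<in>X. (B x s / B x x) *\<^sub>R x)"
      by (rule orth_sum_expand[OF rational_subspace_hull \<open>diagonalizes X S A\<close>])
    also have "\<dots> \<in> span X" by (intro span_sum span_scale span_base)
    finally show "s \<in> span X" .
  qed
  then have "span X = UNIV" using span_hull span_minimal[OF _ subspace_span, of S X] by blast
  note lor = lorentzian_orth_family[OF signature Xf(1) this Xf(3,4)]
  have "size A = 8 * n + 2" using lor(2) by (simp add: A_def)
  moreover have "npos A = 8 * n + 1"
  proof -
    have "npos A = card {x\<in>X. 0 < \<lfloor>B x x\<rfloor>}"
      unfolding npos_def A_def by (simp add: filter_mset_image_mset comp_def Xf(1) filter_mset_mset_set)
    also have "{x\<in>X. 0 < \<lfloor>B x x\<rfloor>} = X - {x\<in>X. B x x < 0}"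
    proof -
      have "0 < \<lfloor>B x x\<rfloor> \<longleftrightarrow> \<not> B x x < 0" if x: "x \<in> X" for x
      proof -
        have "\<lfloor>B x x\<rfloor> \<noteq> 0" using fl[OF x] Xf(3)[OF x] by (metis of_int_0)
        moreover have "B x x < 0 \<longleftrightarrow> \<lfloor>B x x\<rfloor> < 0" by simp
        ultimately show ?thesis by linarith
      qed
      then show ?thesis by blast
    qed
    also have "card \<dots> = card X - 1" using lor(1) by (subst card_Diff_subset) (auto intro: finite_subset[OF _ Xf(1)])
    finally show ?thesis using lor(2) by simp
  qed
  ultimately show ?thesis using d by (intro exI[of _ A]) simp
qed

lemma diagonal_standard: "diagonal S (replicate_mset (Suc (8 * n)) 1 + {#- 1#})"
proof -
  obtain A where A: "diagonal S A" "size A = 8 * n + 2" "npos A = 8 * n + 1" using diagonal_exists by blast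
  show ?thesis
    using unimodular_diagonal_units[OF rational_subspace_hull unimodular_in_hull A(1)] A(2,3) by simp
qed

lemma isotropic_pair_exists: "\<exists>e f. e \<in> L \<and> f \<in> L \<and> B e e = 0 \<and> B f f = 0 \<and> B e f = 1"
proof -
  have "diagonal S (add_mset 1 (add_mset (- 1) (replicate_mset (8 * n) 1)))"
    using diagonal_standard by (simp add: add_mset_commute)
  then obtain x y where x: "x \<in> S" "B x x = 1" and y: "y \<in> S" "B x y = 0" "B y y = - 1"
    by (auto simp: diagonal_add_mset orth_def)
  have "B (x + y) (x + y) = 0" "B (x + y) x \<noteq> 0" using x y sym[of y x] by simp_all
  then show ?thesis
    using isotropic_pair[OF rational_subspace_hull unimodular_in_hull even_in_lattice _ x(1)]
      rational_subspaceD(2)[OF rational_subspace_hull x(1) y(1)] by blast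
qed

lemma primitive_transitive:
  assumes m: "m \<ge> 1" and v: "primitive_in L v" "B v v = 2 * of_nat m" and w: "primitive_in L w" "B w w = 2 * of_nat m"
  shows "\<exists>g. isometry g \<and> g ` L = L \<and> g v = w"
proof -
  obtain T where T: "finite T" "T \<subseteq> L" "L = int_span T" using generators by blast
  have gen: "L \<subseteq> M" if "unimodular_in S M" "T \<subseteq> M" for M
    unfolding T(3) by (rule int_span_generated[OF T(1)]) (use unimodular_inD[OF that(1)] that(2) in auto)
  obtain e0 f0 where ef: "e0 \<in> L" "f0 \<in> L" "B e0 e0 = 0" "B f0 f0 = 0" "B e0 f0 = 1"
    using isotropic_pair_exists by blast
  have N: "8 dvd 8 * n" "8 * n > 0" using n by auto
  have nf: "\<exists>e f E g. frame S (8 * n) e f E \<and> u = e + of_nat m *\<^sub>R f \<and> isometry g \<and> g u = u \<and>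
      g ` frame_lattice S (8 * n) e f E = L" if u: "primitive_in L u" "B u u = 2 * of_nat m" for u
    by (rule normal_form[OF rational_subspace_hull span_hull unimodular_in_hull even_in_lattice T(1,2) gen
      diagonal_standard N m u ef])
  from nf[OF v] obtain e f E g where g: "frame S (8 * n) e f E" "v = e + of_nat m *\<^sub>R f" "isometry g" "g v = v"
    "g ` frame_lattice S (8 * n) e f E = L" by blast
  from nf[OF w] obtain e' f' E' h where h: "frame S (8 * n) e' f' E'" "w = e' + of_nat m *\<^sub>R f'" "isometry h" "h w = w"
    "h ` frame_lattice S (8 * n) e' f' E' = L" by blast
  from frame_map[OF rational_subspace_hull span_hull g(1) h(1)] obtain t where t: "isometry t" "t e = e'" "t f = f'"
    "t ` frame_lattice S (8 * n) e f E = frame_lattice S (8 * n) e' f' E'" by blast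
  have tv: "t v = w" using t g(2) h(2) by (simp add: isometryD[OF t(1)])
  \<comment> \<open>The outer maps bring in the lattices and fix \<open>v\<close> and
    \<open>w\<close>; the inner \<open>t\<close> carries v = e + m f to w = e' + m f'.\<close>
  define k where "k = h \<circ> (t \<circ> inv_into UNIV g)"
  have inj: "inj g" using isometryD(2)[OF g(3)] by (simp add: bij_is_inj)
  have "isometry k" unfolding k_def by (intro isometry_comp isometry_inv g h t)
  moreover have "k v = w"
  proof -
    have "inv_into UNIV g v = v" using inv_f_f[OF inj, of v] g(4) by simp
    then show ?thesis using tv h(4) by (simp add: k_def)
  qed
  moreover have "k ` L = L"
  proof -
    have "inv_into UNIV g ` L = frame_lattice S (8 * n) e f E"
      using image_inv_f_f[OF inj, of "frame_lattice S (8 * n) e f E"] unfolding g(5) .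
    then show ?thesis unfolding k_def image_comp[symmetric] by (simp only: t(4) h(5))
  qed
  ultimately show ?thesis by blast
qed

text \<open>In a hyperbolic pair e, f the vector e + m f has norm 2 m, and its pairing 1 with f
  makes it primitive.\<close>

lemma primitive_exists:
  shows "\<exists>v. primitive_in L v \<and> B v v = 2 * of_nat m"
proof -
  obtain e f where ef: "e \<in> L" "f \<in> L" "B e e = 0" "B f f = 0" "B e f = 1"
    using isotropic_pair_exists by blast
  define v where "v = e + of_int (int m) *\<^sub>R f"
  have "v \<in> L" unfolding v_def by (intro lattice_add lattice_scale ef)
  moreover have "B v f = 1" "B v v = 2 * of_nat m" using ef sym[of f e] by (simp_all add: v_def)
  ultimately show ?thesis using pairing_primitive[OF unimodular_in_hull _ ef(2)] by blast
qed

lemma isometry_primitive: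
  assumes g: "isometry g" "g ` L = L" and v: "primitive_in L v" shows "primitive_in L (g v)"
  unfolding primitive_in_def
proof (intro conjI allI impI notI)
  show "g v \<in> L" using g(2) v by (auto simp: primitive_in_def)
  fix k :: int assume k: "k > 1" "g v /\<^sub>R of_int k \<in> L"
  then have "g (v /\<^sub>R of_int k) \<in> g ` L" using g(2) by (simp add: isometryD[OF g(1)])
  then have "v /\<^sub>R of_int k \<in> L" using isometryD(2)[OF g(1)] by (auto simp: bij_def dest: injD)
  then show False using v k(1) by (auto simp: primitive_in_def)
qed

end

theorem theorem3p9p1:
  fixes m n :: nat
    and B :: "'v::real_vector \<Rightarrow> 'v \<Rightarrow> real"
    and L :: "'v set"
  assumes "m \<ge> 1" and "n \<ge> 1"
    and "is_lattice B L"
    and "even_lattice B L"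
    and "unimodular_lattice B L"
    and "has_signature B (8 * n + 1) 1"
  shows "card (orbits (Aut_lattice B L)
                 (primitive_vectors_of_norm B L (2 * real m)) (\<lambda>f v. f v)) = 1"
proof -
  interpret even_unimodular B L n
    using assms by unfold_locales (auto simp: is_lattice_def)
  let ?P = "primitive_vectors_of_norm B L (2 * real m)"
  have carrier: "carrier (Aut_lattice B L) = {g. isometry g \<and> g ` L = L}"
    by (auto simp: Aut_lattice_def isometry_def)
  have orbit: "orbit (Aut_lattice B L) (\<lambda>f v. f v) v = ?P" if v: "v \<in> ?P" for v
  proof (intro equalityI subsetI)
    fix w assume "w \<in> orbit (Aut_lattice B L) (\<lambda>f v. f v) v"
    then obtain g where "isometry g" "g ` L = L" "w = g v"
      unfolding orbit_def carrier by (elim CollectE exE conjE) (rule that)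
    then show "w \<in> ?P"
      using v isometry_primitive[of g v] isometryD(3)[of g v v] by (simp add: primitive_vectors_of_norm_def)
  next
    fix w assume "w \<in> ?P"
    then obtain g where "isometry g" "g ` L = L" "g v = w"
      using primitive_transitive[OF assms(1), of v w] v by (auto simp: primitive_vectors_of_norm_def)
    then show "w \<in> orbit (Aut_lattice B L) (\<lambda>f v. f v) v"
      unfolding orbit_def carrier by (intro CollectI exI[of _ g]) simp
  qed
  \<comment> \<open>Transitivity alone would leave room for an empty set of vectors, with no orbit
    at all.\<close>
  obtain v where "v \<in> ?P" using primitive_exists[of m] by (auto simp: primitive_vectors_of_norm_def)
  then have "orbits (Aut_lattice B L) ?P (\<lambda>f v. f v) = {?P}"
    using orbit unfolding orbits_def by auto
  then show ?thesis by simp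
qed

end
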